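(* Let $M^n$ be a complete hypersurface with constant weighted mean curvature $\lambda$ properly immersed in the Gaussian space $\mathbb{R}^{n+1}$. Suppose that the image of the Gauss map $N:M\to S^n$ is contained in $S^n\setminus\bar S_+^{n-1}$. Then $M$ is a hyperplane.
   Context: $S^n\setminus\bar S_+^{n-1}$ denotes the set of all $x=(x_1,\dots,x_{n+1})\in S^n$ such that $(x_1,x_2)\in\mathbb{R}^2\setminus([0,\infty)\times\{0\})$. The Gaussian space $\mathbb{R}^{n+1}$ is $\mathbb{R}^{n+1}$ with its canonical metric and the weight function $f(x)=|x|^2/4$ (weighted measure $e^{-f}\,d\mathrm{vol}$). Hypersurfaces are smooth, connected, immersed, and carry a smooth unit normal field $N$; the map $N: M\to S^n$ is the Gauss map. "Complete" refers to the induced metric. "Hyperplane" means affine hyperplane (not necessarily through the origin). With $\bar\nabla$ the flat connection, the mean curvature is the trace of the second fundamental form, $H=\sum_i\langle\bar\nabla_{e_i}e_i,N\rangle$ for a local orthonormal frame $e_1,\dots,e_n$ of $TM$. The hypersurface has constant weighted mean curvature $\lambda$ (with $\lambda\in\mathbb{R}$ constant) if $H+\frac12\langle x,N\rangle=\lambda$ on $M$, where $x$ is the position vector. *)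

theory Defs
  imports "HOL-Analysis.Analysis"
begin

section \<open>Smooth maps between Euclidean spaces\<close>

text \<open>Meant for open \<^term>\<open>S\<close> and finite-dimensional \<^typ>\<open>'a\<close>, where continuity of all
  directional derivatives of the Frechet derivative amounts to the usual class of \<open>C\<^sup>k\<close> maps.\<close>

primrec Ck_on :: "nat \<Rightarrow> 'a::real_normed_vector set \<Rightarrow> ('a \<Rightarrow> 'b::real_normed_vector) \<Rightarrow> bool" where
  "Ck_on 0 S f \<longleftrightarrow> continuous_on S f"
| "Ck_on (Suc k) S f \<longleftrightarrow> (\<forall>x\<in>S. f differentiable (at x)) \<and>
     (\<forall>v. Ck_on k S (\<lambda>x. frechet_derivative f (at x) v))"

definition smooth_on :: "'a::real_normed_vector set \<Rightarrow> ('a \<Rightarrow> 'b::real_normed_vector) \<Rightarrow> bool" where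
  "smooth_on S f \<longleftrightarrow> (\<forall>k. Ck_on k S f)"


section \<open>Smooth manifolds and smooth maps on them\<close>

text \<open>A chart is a pair of its domain and its coordinate map; the coordinate map is only
  meaningful on the domain.\<close>

type_synonym ('p, 'n) chart = "'p set \<times> ('p \<Rightarrow> real ^ 'n)"

definition in_chart :: "('p, 'n::finite) chart \<Rightarrow> ('p \<Rightarrow> 'b) \<Rightarrow> real ^ 'n \<Rightarrow> 'b" where
  "in_chart c f = f \<circ> inv_into (fst c) (snd c)"

definition smooth_manifold :: "'p topology \<Rightarrow> ('p, 'n::finite) chart set \<Rightarrow> bool" where
  "smooth_manifold T A \<longleftrightarrow>
     Hausdorff_space T \<and> second_countable T \<and>
     (\<Union>(U, \<phi>)\<in>A. U) = topspace T \<and>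
     (\<forall>(U, \<phi>)\<in>A. openin T U \<and> open (\<phi> ` U) \<and>
        homeomorphic_map (subtopology T U) (top_of_set (\<phi> ` U)) \<phi>) \<and>
     (\<forall>(U, \<phi>)\<in>A. \<forall>(V, \<psi>)\<in>A. smooth_on (\<phi> ` (U \<inter> V)) (in_chart (U, \<phi>) \<psi>))"

definition smooth_map ::
    "('p, 'n::finite) chart set \<Rightarrow> ('p \<Rightarrow> 'b::real_normed_vector) \<Rightarrow> bool" where
  "smooth_map A f \<longleftrightarrow> (\<forall>(U, \<phi>)\<in>A. smooth_on (\<phi> ` U) (in_chart (U, \<phi>) f))"

text \<open>The differential at \<open>p\<close>, with tangent vectors given by their coordinates in a chart
  around \<open>p\<close>.\<close>

definition differential ::
    "('p, 'n::finite) chart \<Rightarrow> ('p \<Rightarrow> 'b::real_normed_vector) \<Rightarrow> 'p \<Rightarrow> real ^ 'n \<Rightarrow> 'b" where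
  "differential c f p = frechet_derivative (in_chart c f) (at (snd c p))"


section \<open>Immersed hypersurfaces with a unit normal field\<close>

locale immersed_hypersurface =
  fixes T :: "'p topology"
    and A :: "('p, 'n::finite) chart set"
    and X :: "'p \<Rightarrow> real ^ 'm::finite"
    and N :: "'p \<Rightarrow> real ^ 'm"
  assumes codim_one: "CARD('m) = Suc CARD('n)"
    and manifold: "smooth_manifold T A"
    and nonempty: "topspace T \<noteq> {}"
    and connected: "connected_space T"
    and smooth_X: "smooth_map A X"
    and immersion: "\<And>U \<phi> p. (U, \<phi>) \<in> A \<Longrightarrow> p \<in> U \<Longrightarrow> inj (differential (U, \<phi>) X p)"
    and smooth_N: "smooth_map A N"
    and unit_N: "\<And>p. p \<in> topspace T \<Longrightarrow> norm (N p) = 1"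
    and normal_N: "\<And>U \<phi> p u. (U, \<phi>) \<in> A \<Longrightarrow> p \<in> U \<Longrightarrow> differential (U, \<phi>) X p u \<bullet> N p = 0"


subsection \<open>Mean curvature\<close>

text \<open>For a local parametrization \<open>F\<close> of the hypersurface and a vector field on its parameter
  domain with coordinates \<open>v\<close>, the corresponding tangent field along \<open>F\<close> is \<open>push_field F v\<close>.\<close>

definition push_field ::
    "(real ^ 'n \<Rightarrow> real ^ 'm) \<Rightarrow> (real ^ 'n \<Rightarrow> real ^ 'n) \<Rightarrow> real ^ 'n \<Rightarrow> real ^ 'm::finite" where
  "push_field F v y = frechet_derivative F (at y) (v y)"

definition orthonormal_frame ::
    "(real ^ 'n \<Rightarrow> real ^ 'm::finite) \<Rightarrow> (real ^ 'n) set \<Rightarrow> ('n::finite \<Rightarrow> real ^ 'n \<Rightarrow> real ^ 'n) \<Rightarrow> bool"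
  where
  "orthonormal_frame F W v \<longleftrightarrow>
     (\<forall>i. smooth_on W (v i)) \<and>
     (\<forall>y\<in>W. \<forall>i j. push_field F (v i) y \<bullet> push_field F (v j) y = (if i = j then 1 else 0))"

text \<open>With \<open>e\<^sub>i = push_field F (v i)\<close>, the flat covariant derivative of \<open>e\<^sub>i\<close> in direction
  \<open>e\<^sub>i\<close> is the derivative of \<open>e\<^sub>i\<close>, as a function of the parameter, in direction \<open>v i\<close>. The
  sum below depends neither on the chart nor on the frame.\<close>

definition has_mean_curvature ::
    "('p, 'n::finite) chart set \<Rightarrow> ('p \<Rightarrow> real ^ 'm::finite) \<Rightarrow> ('p \<Rightarrow> real ^ 'm) \<Rightarrow> 'p \<Rightarrow> real \<Rightarrow> bool"
  where
  "has_mean_curvature A X N p H \<longleftrightarrow>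
     (\<exists>(U, \<phi>)\<in>A. \<exists>W v. let F = in_chart (U, \<phi>) X in
        p \<in> U \<and> open W \<and> \<phi> p \<in> W \<and> W \<subseteq> \<phi> ` U \<and> orthonormal_frame F W v \<and>
        H = (\<Sum>i\<in>UNIV.
              frechet_derivative (push_field F (v i)) (at (\<phi> p)) (v i (\<phi> p)) \<bullet> N p))"

definition constant_weighted_mean_curvature ::
    "'p topology \<Rightarrow> ('p, 'n::finite) chart set \<Rightarrow> ('p \<Rightarrow> real ^ 'm::finite) \<Rightarrow>
      ('p \<Rightarrow> real ^ 'm) \<Rightarrow> real \<Rightarrow> bool" where
  "constant_weighted_mean_curvature T A X N l \<longleftrightarrow>
     (\<forall>p\<in>topspace T. \<exists>H. has_mean_curvature A X N p H \<and> H + (1/2) * (X p \<bullet> N p) = l)"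


subsection \<open>Completeness of the induced metric\<close>

text \<open>Piecewise \<open>C\<^sup>1\<close> curves of finite length. The integrability condition is needed because
  the derivative is not required to stay bounded near the finitely many exceptional
  parameters, and the integral of a non-integrable function is \<open>0\<close> by convention.\<close>

definition admissible_curve ::
    "'p topology \<Rightarrow> ('p, 'n::finite) chart set \<Rightarrow> ('p \<Rightarrow> real ^ 'm::finite) \<Rightarrow> (real \<Rightarrow> 'p) \<Rightarrow> bool"
  where
  "admissible_curve T A X c \<longleftrightarrow>
     continuous_map (top_of_set {0..1}) T c \<and>
     (\<exists>S. finite S \<and> (\<forall>(U, \<phi>)\<in>A. (\<phi> \<circ> c) C1_differentiable_on ({t \<in> {0..1}. c t \<in> U} - S))) \<and>
     (\<lambda>t. norm (vector_derivative (X \<circ> c) (at t))) integrable_on {0..1}"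

definition curve_length :: "('p \<Rightarrow> real ^ 'm::finite) \<Rightarrow> (real \<Rightarrow> 'p) \<Rightarrow> real" where
  "curve_length X c = integral {0..1} (\<lambda>t. norm (vector_derivative (X \<circ> c) (at t)))"

definition induced_dist ::
    "'p topology \<Rightarrow> ('p, 'n::finite) chart set \<Rightarrow> ('p \<Rightarrow> real ^ 'm::finite) \<Rightarrow> 'p \<Rightarrow> 'p \<Rightarrow> real"
  where
  "induced_dist T A X p q =
     (if p \<in> topspace T \<and> q \<in> topspace T
      then Inf {curve_length X c | c. admissible_curve T A X c \<and> c 0 = p \<and> c 1 = q}
      else 0)"

definition complete_hypersurface ::
    "'p topology \<Rightarrow> ('p, 'n::finite) chart set \<Rightarrow> ('p \<Rightarrow> real ^ 'm::finite) \<Rightarrow> bool" where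
  "complete_hypersurface T A X \<longleftrightarrow> Metric_space.mcomplete (topspace T) (induced_dist T A X)"


section \<open>The slit sphere and hyperplanes\<close>

text \<open>\<open>i\<close> and \<open>j\<close> are the indices of the first and the second coordinate.\<close>

definition slit_sphere :: "'m::finite \<Rightarrow> 'm \<Rightarrow> (real ^ 'm) set" where
  "slit_sphere i j = {x \<in> sphere 0 1. (x $ i, x $ j) \<notin> {0..} \<times> {0}}"

text \<open>Injectivity says that the immersion parametrizes the hyperplane exactly once.\<close>

definition is_hyperplane :: "'p topology \<Rightarrow> ('p \<Rightarrow> real ^ 'm::finite) \<Rightarrow> bool" where
  "is_hyperplane T X \<longleftrightarrow>
     inj_on X (topspace T) \<and> (\<exists>a b. a \<noteq> 0 \<and> X ` topspace T = {x. a \<bullet> x = b})"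

end

theory Submission
  imports Defs
begin

text \<open>
  Write \<open>div\<^sub>f\<close> for the divergence of tangential fields weighted by \<open>e\<^bsup>-f\<^esup>\<close>, \<open>f = |x|\<^sup>2/4\<close>, and \<open>A\<close> for
  the Weingarten map \<open>v \<mapsto> dN(v)\<close>. Differentiating \<open>H + \<langle>x, N\<rangle>/2 = \<lambda>\<close> turns the Codazzi equation
  into \<open>div\<^sub>f (A V) = \<Sum>\<^sub>a \<langle>A e\<^sub>a, \<nabla>\<^bsub>e\<^sub>a\<^esub> V\<rangle>\<close> for every tangential field \<open>V\<close> (lemma \<open>wdiv_shape\<close>): the
  Gauss map is a weighted harmonic map.

  On the slit sphere the two distinguished coordinates of \<open>N\<close> are \<open>r (cos \<theta>, sin \<theta>)\<close> with \<open>r > 0\<close> and a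
  single-valued bounded angle \<open>\<theta>\<close>. The field \<open>r\<^sup>2 \<nabla>\<theta>\<close> is \<open>A\<close> applied to the rotation field about the
  slit. As a rotation field has skew derivative, \<open>div\<^sub>f (r\<^sup>2 \<nabla>\<theta>) = 0\<close>, hence
  \<open>div\<^sub>f (\<theta> r\<^sup>2 \<nabla>\<theta>) = r\<^sup>2 |\<nabla>\<theta>|\<^sup>2\<close>. Once \<open>\<nabla>\<theta> = 0\<close> is known, \<open>W = - \<nabla> log r\<close> satisfies
  \<open>div\<^sub>f W = |A|\<^sup>2 + |W|\<^sup>2\<close>.

  Both identities are exploited by the same principle (theorem \<open>parabolicity\<close>): if
  \<open>div\<^sub>f W \<ge> q + c |W|\<^sup>2\<close> with \<open>c > 0\<close> and \<open>q \<ge> 0\<close>, then \<open>q = 0\<close>. It follows from the divergence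
  theorem with the cutoff functions \<open>\<Phi>\<^sub>R = (R - |x|\<^sup>2)\<^sub>+\<close>. They have compact support because the
  immersion is proper, and their energy is controlled by the divergence
  \<open>n + \<lambda> \<langle>x, N\<rangle> - |x|\<^sup>2/2\<close> of the tangential part of \<open>x\<close>, which is negative outside a compact set.
  The first application gives \<open>\<nabla>\<theta> = 0\<close> (\<open>shape_rot_eq_0\<close>), the second \<open>A = 0\<close> (\<open>shape_eq_0\<close>).

  If \<open>A = 0\<close>, then \<open>N\<close> is constant and the immersion is a proper local homeomorphism into a
  hyperplane. It has a global section because hyperplanes are convex, so it is a bijection onto the
  hyperplane (\<open>homeomorphism_onto\<close>).

  The derivative of a map on the hypersurface is represented without coordinates as a linear map
  on the ambient space that vanishes on the normal line (\<open>tder\<close>). Coordinates enter mainly in the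
  Codazzi equation and in the divergence theorem. The latter is proved in framed charts and glued
  by partitions of unity.
\<close>


section \<open>Calculus of continuously differentiable maps\<close>

definition C1_on :: "'a::real_normed_vector set \<Rightarrow> ('a \<Rightarrow> 'b::real_normed_vector) \<Rightarrow> bool" where
  "C1_on S f \<longleftrightarrow> Ck_on (Suc 0) S f"

lemma C1_on_iff:
  "C1_on S f \<longleftrightarrow> (\<forall>x\<in>S. (f has_derivative frechet_derivative f (at x)) (at x)) \<and>
     (\<forall>v. continuous_on S (\<lambda>x. frechet_derivative f (at x) v))"
  unfolding C1_on_def by (auto simp: frechet_derivative_works)

lemma C1_onD:
  "C1_on S f \<Longrightarrow> x \<in> S \<Longrightarrow> (f has_derivative frechet_derivative f (at x)) (at x)"
  "C1_on S f \<Longrightarrow> continuous_on S (\<lambda>x. frechet_derivative f (at x) v)"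
  by (auto simp: C1_on_iff)

lemma C1_onI:
  assumes "\<And>x. x \<in> S \<Longrightarrow> (f has_derivative f' x) (at x)"
    and "\<And>v. continuous_on S (\<lambda>x. f' x v)"
  shows "C1_on S f"
proof -
  have "frechet_derivative f (at x) = f' x" if "x \<in> S" for x
    using frechet_derivative_at[OF assms(1)[OF that]] by simp
  then show ?thesis
    using assms by (auto simp: C1_on_iff cong: continuous_on_cong)
qed

lemma smooth_on_C1:
  assumes "smooth_on S f"
  shows "C1_on S f" "C1_on S (\<lambda>x. frechet_derivative f (at x) v)"
  using assms unfolding smooth_on_def C1_on_def
  by (blast, metis Ck_on.simps(2))

lemma C1_on_continuous: "C1_on S f \<Longrightarrow> continuous_on S f"
  by (meson C1_onD(1) continuous_at_imp_continuous_on has_derivative_continuous)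

lemma C1_on_subset: "C1_on S f \<Longrightarrow> T \<subseteq> S \<Longrightarrow> C1_on T f"
  unfolding C1_on_iff by (meson continuous_on_subset subsetD)

lemma C1_on_cong:
  assumes "C1_on S f" "open S" "\<And>x. x \<in> S \<Longrightarrow> f x = g x"
  shows "C1_on S g"
proof (rule C1_onI[where f'="\<lambda>x. frechet_derivative f (at x)"])
  fix x assume "x \<in> S"
  with assms show "(g has_derivative frechet_derivative f (at x)) (at x)"
    by (metis C1_onD(1) has_derivative_transform_within_open)
qed (rule C1_onD(2)[OF assms(1)])

lemma C1_on_local:
  assumes "\<And>x. x \<in> S \<Longrightarrow> \<exists>O'. open O' \<and> x \<in> O' \<and> C1_on O' f"
  shows "C1_on S f"
  unfolding C1_on_iff
proof (intro conjI ballI allI)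
  fix x assume "x \<in> S"
  with assms show "(f has_derivative frechet_derivative f (at x)) (at x)"
    by (meson C1_onD(1))
next
  fix v
  show "continuous_on S (\<lambda>x. frechet_derivative f (at x) v)"
  proof (rule continuous_at_imp_continuous_on, rule ballI)
    fix x assume "x \<in> S"
    then obtain O' where O: "open O'" "x \<in> O'" "C1_on O' f" using assms by blast
    show "isCont (\<lambda>x. frechet_derivative f (at x) v) x"
      using continuous_on_eq_continuous_at[OF O(1)] C1_onD(2)[OF O(3)] O(2) by blast
  qed
qed

lemma C1_on_const [simp]: "C1_on S (\<lambda>x. c)"
  by (rule C1_onI[where f'="\<lambda>x v. 0"]) auto

lemma C1_on_bounded_linear: "bounded_linear f \<Longrightarrow> C1_on S f"
  by (rule C1_onI[where f'="\<lambda>x. f"]) (auto intro: bounded_linear_imp_has_derivative)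

lemma C1_on_id: "C1_on S (\<lambda>x. x)"
  by (rule C1_on_bounded_linear) (rule bounded_linear_ident)

lemma C1_on_add:
  assumes "C1_on S f" "C1_on S g" shows "C1_on S (\<lambda>x. f x + g x)"
  using assms
  by (intro C1_onI[where f'="\<lambda>x v. frechet_derivative f (at x) v + frechet_derivative g (at x) v"])
     (auto intro!: has_derivative_add C1_onD continuous_on_add)

lemma C1_on_sum:
  assumes "\<And>i. i \<in> I \<Longrightarrow> C1_on S (f i)" shows "C1_on S (\<lambda>x. \<Sum>i\<in>I. f i x)"
  using assms by (induction I rule: infinite_finite_induct) (auto intro: C1_on_add)

lemma C1_on_linear_compose:
  assumes "bounded_linear h" "C1_on S f" shows "C1_on S (\<lambda>x. h (f x))"
proof (rule C1_onI[where f'="\<lambda>x v. h (frechet_derivative f (at x) v)"])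
  show "((\<lambda>x. h (f x)) has_derivative (\<lambda>v. h (frechet_derivative f (at x) v))) (at x)" if "x \<in> S" for x
    by (rule bounded_linear.has_derivative[OF assms(1) C1_onD(1)[OF assms(2) that]])
  show "continuous_on S (\<lambda>x. h (frechet_derivative f (at x) v))" for v
    by (rule bounded_linear.continuous_on[OF assms(1) C1_onD(2)[OF assms(2)]])
qed

lemma C1_on_bilinear:
  assumes "bounded_bilinear h" "C1_on S f" "C1_on S g"
  shows "C1_on S (\<lambda>x. h (f x) (g x))"
proof (rule C1_onI)
  show "((\<lambda>x. h (f x) (g x)) has_derivative
     (\<lambda>v. h (f x) (frechet_derivative g (at x) v) + h (frechet_derivative f (at x) v) (g x))) (at x)"
    if "x \<in> S" for x
    using bounded_bilinear.FDERIV[OF assms(1) C1_onD(1)[OF assms(2) that] C1_onD(1)[OF assms(3) that]] .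
  show "continuous_on S (\<lambda>x. h (f x) (frechet_derivative g (at x) v) + h (frechet_derivative f (at x) v) (g x))" for v
    by (intro continuous_on_add bounded_bilinear.continuous_on[OF assms(1)] C1_on_continuous C1_onD(2) assms)
qed

lemmas C1_on_scaleR = C1_on_bilinear[OF bounded_bilinear_scaleR]
  and C1_on_inner = C1_on_bilinear[OF bounded_bilinear_inner]
  and C1_on_mult = C1_on_bilinear[OF bounded_bilinear_mult]

lemma C1_on_minus: "C1_on S f \<Longrightarrow> C1_on S (\<lambda>x. - f x)"
  by (rule C1_on_linear_compose[OF bounded_linear_minus[OF bounded_linear_ident]])

lemma C1_on_diff: "C1_on S f \<Longrightarrow> C1_on S g \<Longrightarrow> C1_on S (\<lambda>x. f x - g x)"
  using C1_on_add[OF _ C1_on_minus] by fastforce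

lemma C1_on_prod:
  fixes f :: "'i \<Rightarrow> 'a::real_normed_vector \<Rightarrow> real"
  assumes "\<And>i. i \<in> I \<Longrightarrow> C1_on S (f i)" shows "C1_on S (\<lambda>x. \<Prod>i\<in>I. f i x)"
  using assms by (induction I rule: infinite_finite_induct) (auto intro: C1_on_mult)

lemma C1_on_det:
  fixes f :: "'a::real_normed_vector \<Rightarrow> real^'n^'n"
  assumes "\<And>i j. C1_on S (\<lambda>x. f x $ i $ j)" shows "C1_on S (\<lambda>x. det (f x))"
  unfolding det_def
  by (intro C1_on_sum C1_on_mult C1_on_prod C1_on_const assms)

lemma has_derivative_euclidean_sum:
  fixes v :: "'a::euclidean_space"
  assumes "(f has_derivative D) F"
  shows "D v = (\<Sum>b\<in>Basis. (v \<bullet> b) *\<^sub>R D b)"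
proof -
  have "D v = D (\<Sum>b\<in>Basis. (v \<bullet> b) *\<^sub>R b)" by (simp add: euclidean_representation)
  then show ?thesis
    using has_derivative_linear[OF assms] by (simp add: linear_sum linear_scale)
qed

text \<open>Linearity in the direction reduces joint continuity of the derivative to the finitely many
  basis directions.\<close>

lemma C1_on_joint_continuous:
  fixes f :: "'a::euclidean_space \<Rightarrow> 'b::real_normed_vector"
  assumes f: "C1_on T f" and g: "continuous_on S g" "g ` S \<subseteq> T" and v: "continuous_on S v"
  shows "continuous_on S (\<lambda>x. frechet_derivative f (at (g x)) (v x))"
proof -
  have "continuous_on S (\<lambda>x. \<Sum>b\<in>Basis. (v x \<bullet> b) *\<^sub>R frechet_derivative f (at (g x)) b)"
    by (intro continuous_intros v continuous_on_compose2[OF C1_onD(2)[OF f] g])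
  moreover have "frechet_derivative f (at (g x)) (v x)
      = (\<Sum>b\<in>Basis. (v x \<bullet> b) *\<^sub>R frechet_derivative f (at (g x)) b)" if "x \<in> S" for x
    using has_derivative_euclidean_sum[OF C1_onD(1)[OF f]] g(2) that by blast
  ultimately show ?thesis by (simp cong: continuous_on_cong)
qed

lemma C1_on_compose:
  fixes f :: "'a::euclidean_space \<Rightarrow> 'b::real_normed_vector"
  assumes f: "C1_on T f" and g: "C1_on S g" and sub: "g ` S \<subseteq> T"
  shows "C1_on S (\<lambda>x. f (g x))"
proof (rule C1_onI)
  show "((\<lambda>x. f (g x)) has_derivative
      (\<lambda>v. frechet_derivative f (at (g x)) (frechet_derivative g (at x) v))) (at x)" if "x \<in> S" for x
    using diff_chain_at[OF C1_onD(1)[OF g that] C1_onD(1)[OF f, of "g x"]] sub that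
    by (auto simp: o_def)
  show "continuous_on S (\<lambda>x. frechet_derivative f (at (g x)) (frechet_derivative g (at x) v))" for v
    by (rule C1_on_joint_continuous[OF f C1_on_continuous[OF g] sub C1_onD(2)[OF g]])
qed

text \<open>A derivative field applied to a moving vector is again continuously differentiable; this
  is how second derivatives enter.\<close>

lemma C1_on_derivative_field:
  fixes f :: "'a::euclidean_space \<Rightarrow> 'b::real_normed_vector"
  assumes f: "C1_on S f" and f2: "\<And>u. C1_on S (\<lambda>x. frechet_derivative f (at x) u)"
    and v: "C1_on S v" and "open S"
  shows "C1_on S (\<lambda>x. frechet_derivative f (at x) (v x))"
proof (rule C1_on_cong[OF _ \<open>open S\<close>])
  show "C1_on S (\<lambda>x. \<Sum>b\<in>Basis. (v x \<bullet> b) *\<^sub>R frechet_derivative f (at x) b)"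
    by (intro C1_on_sum C1_on_scaleR C1_on_inner v f2 C1_on_const)
  show "(\<Sum>b\<in>Basis. (v x \<bullet> b) *\<^sub>R frechet_derivative f (at x) b) = frechet_derivative f (at x) (v x)"
    if "x \<in> S" for x
    using has_derivative_euclidean_sum[OF C1_onD(1)[OF f that]] by metis
qed

lemma has_derivative_derivative_field:
  fixes f :: "'a::euclidean_space \<Rightarrow> 'b::real_normed_vector"
  assumes f: "C1_on S f" and f2: "\<And>u. C1_on S (\<lambda>x. frechet_derivative f (at x) u)"
    and v: "(v has_derivative v') (at x)" and "open S" "x \<in> S"
  shows "((\<lambda>y. frechet_derivative f (at y) (v y)) has_derivative
     (\<lambda>h. frechet_derivative (\<lambda>y. frechet_derivative f (at y) (v x)) (at x) h
        + frechet_derivative f (at x) (v' h))) (at x)"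
proof -
  let ?D = "\<lambda>y. frechet_derivative f (at y)"
  let ?D2 = "\<lambda>u. frechet_derivative (\<lambda>y. ?D y u) (at x)"
  have lin: "?D y u = (\<Sum>b\<in>Basis. (u \<bullet> b) *\<^sub>R ?D y b)" if "y \<in> S" for y u
    using has_derivative_euclidean_sum[OF C1_onD(1)[OF f that]] by metis
  have "((\<lambda>y. \<Sum>b\<in>Basis. (v y \<bullet> b) *\<^sub>R ?D y b) has_derivative
     (\<lambda>h. \<Sum>b\<in>Basis. (v x \<bullet> b) *\<^sub>R ?D2 b h + (v' h \<bullet> b) *\<^sub>R ?D x b)) (at x)"
    by (intro has_derivative_sum has_derivative_scaleR[OF has_derivative_inner_left[OF v]]
        C1_onD(1)[OF f2 \<open>x \<in> S\<close>])
  then have 1: "((\<lambda>y. ?D y (v y)) has_derivative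
     (\<lambda>h. \<Sum>b\<in>Basis. (v x \<bullet> b) *\<^sub>R ?D2 b h + (v' h \<bullet> b) *\<^sub>R ?D x b)) (at x)"
    by (rule has_derivative_transform_within_open[OF _ \<open>open S\<close> \<open>x \<in> S\<close>]) (metis lin)
  have "((\<lambda>y. \<Sum>b\<in>Basis. (v x \<bullet> b) *\<^sub>R ?D y b) has_derivative
     (\<lambda>h. \<Sum>b\<in>Basis. (v x \<bullet> b) *\<^sub>R ?D2 b h)) (at x)"
    by (intro has_derivative_sum has_derivative_scaleR_right C1_onD(1)[OF f2 \<open>x \<in> S\<close>])
  then have 3: "((\<lambda>y. ?D y (v x)) has_derivative
     (\<lambda>h. \<Sum>b\<in>Basis. (v x \<bullet> b) *\<^sub>R ?D2 b h)) (at x)"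
    by (rule has_derivative_transform_within_open[OF _ \<open>open S\<close> \<open>x \<in> S\<close>]) (metis lin)
  have 2: "?D2 (v x) = (\<lambda>h. \<Sum>b\<in>Basis. (v x \<bullet> b) *\<^sub>R ?D2 b h)"
    by (rule frechet_derivative_at[OF 3, symmetric])
  show ?thesis
    using 1 unfolding 2 lin[OF \<open>x \<in> S\<close>, of "v' _"] by (simp add: sum.distrib)
qed

lemma C1_on_real_compose:
  fixes h :: "real \<Rightarrow> real"
  assumes h: "\<And>t. t \<in> T \<Longrightarrow> (h has_real_derivative h' t) (at t)" "continuous_on T h'"
    and f: "C1_on S f" "f ` S \<subseteq> T"
  shows "C1_on S (\<lambda>x. h (f x))"
proof (rule C1_on_compose[OF _ f])
  show "C1_on T h"
    by (rule C1_onI[where f'="\<lambda>t v. h' t * v"])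
       (use h in \<open>auto simp: has_field_derivative_def intro: continuous_on_mult_right\<close>)
qed

lemma C1_on_inverse:
  fixes f :: "'a::real_normed_vector \<Rightarrow> real"
  assumes "C1_on S f" "\<And>x. x \<in> S \<Longrightarrow> f x \<noteq> 0"
  shows "C1_on S (\<lambda>x. inverse (f x))"
  by (rule C1_on_real_compose[of "-{0}" inverse "\<lambda>t. - (inverse t ^ Suc (Suc 0))"])
     (use assms in \<open>auto intro!: continuous_intros simp del: power_Suc simp: DERIV_inverse\<close>)

lemma C1_on_divide:
  fixes f g :: "'a::real_normed_vector \<Rightarrow> real"
  assumes "C1_on S f" "C1_on S g" "\<And>x. x \<in> S \<Longrightarrow> g x \<noteq> 0"
  shows "C1_on S (\<lambda>x. f x / g x)"
  using C1_on_mult[OF assms(1) C1_on_inverse[OF assms(2,3)]] by (simp add: divide_inverse)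

lemma C1_on_sqrt:
  assumes "C1_on S f" "\<And>x. x \<in> S \<Longrightarrow> f x > 0"
  shows "C1_on S (\<lambda>x. sqrt (f x))"
  by (rule C1_on_real_compose[of "{0<..}" sqrt "\<lambda>t. inverse (sqrt t) / 2"])
     (use assms in \<open>auto intro!: DERIV_real_sqrt continuous_intros\<close>)

lemma C1_on_exp:
  fixes f :: "'a::real_normed_vector \<Rightarrow> real"
  assumes "C1_on S f"
  shows "C1_on S (\<lambda>x. exp (f x))"
  by (rule C1_on_real_compose[of UNIV exp exp])
     (use assms in \<open>auto intro!: DERIV_exp continuous_intros\<close>)

text \<open>The truncated powers \<open>(max 0 t)\<^sup>k\<close> with \<open>k \<ge> 2\<close> are \<open>C\<^sup>1\<close>; all cutoff functions below are
  built from them.\<close>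

lemma DERIV_truncated_power:
  "((\<lambda>t::real. max 0 t ^ Suc (Suc k)) has_real_derivative (real k + 2) * max 0 t ^ Suc k) (at t)"
proof -
  consider "t < 0" | "t = 0" | "t > 0" by linarith
  then show ?thesis
  proof cases
    case 1
    have "((\<lambda>t::real. 0) has_real_derivative (real k + 2) * max 0 t ^ Suc k) (at t)"
      using 1 by simp
    moreover have "eventually (\<lambda>s. 0 = max 0 s ^ Suc (Suc k)) (nhds t)"
      using eventually_nhds_in_open[of "{..<0}" t] 1 by (auto elim!: eventually_mono)
    ultimately show ?thesis
      using DERIV_cong_ev[of t t "\<lambda>_. 0" "\<lambda>s. max 0 s ^ Suc (Suc k)"] by auto
  next
    case 3
    have "((\<lambda>t::real. t ^ Suc (Suc k)) has_real_derivative (real k + 2) * max 0 t ^ Suc k) (at t)"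
      using DERIV_pow[of "Suc (Suc k)" t] 3 by (simp add: max_def add.commute)
    moreover have "eventually (\<lambda>s. s ^ Suc (Suc k) = max 0 s ^ Suc (Suc k)) (nhds t)"
      using eventually_nhds_in_open[of "{0<..}" t] 3 by (auto elim!: eventually_mono)
    ultimately show ?thesis
      using DERIV_cong_ev[of t t "\<lambda>s. s ^ Suc (Suc k)" "\<lambda>s. max 0 s ^ Suc (Suc k)"] by auto
  next
    case 2
    have "((\<lambda>h::real. max 0 h ^ Suc k) \<longlongrightarrow> max 0 0 ^ Suc k) (at 0)"
      by (intro tendsto_intros)
    then have lim: "((\<lambda>h::real. max 0 h ^ Suc k) \<longlongrightarrow> 0) (at 0)" by simp
    have "norm (max 0 h ^ Suc (Suc k) / h) \<le> max 0 h ^ Suc k" for h :: real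
      by (cases "h > 0") (auto simp: max_def)
    then have "((\<lambda>h::real. max 0 h ^ Suc (Suc k) / h) \<longlongrightarrow> 0) (at 0)"
      by (intro Lim_null_comparison[OF always_eventually lim]) blast
    then show ?thesis
      using 2 unfolding DERIV_def by simp
  qed
qed

lemma C1_on_truncated_power:
  fixes f :: "'a::real_normed_vector \<Rightarrow> real"
  assumes "C1_on S f" "2 \<le> k"
  shows "C1_on S (\<lambda>x. max 0 (f x) ^ k)"
proof -
  obtain j where k: "k = Suc (Suc j)" using assms(2) by (metis Suc_le_D numeral_2_eq_2 Suc_le_mono)
  show ?thesis unfolding k
  proof (rule C1_on_real_compose[where T=UNIV and h="\<lambda>t. max 0 t ^ Suc (Suc j)"])
    show "((\<lambda>t. max 0 t ^ Suc (Suc j)) has_real_derivative (real j + 2) * max 0 t ^ Suc j) (at t)" for t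
      by (rule DERIV_truncated_power)
    show "continuous_on UNIV (\<lambda>t::real. (real j + 2) * max 0 t ^ Suc j)"
      by (intro continuous_intros)
  qed (use assms in auto)
qed

section \<open>Symmetry of second derivatives\<close>

text \<open>Two applications of the mean value theorem express a second difference through the mixed
  derivative. The second difference is symmetric in the two directions, which is why mixed
  derivatives commute.\<close>

lemma second_difference_eq:
  fixes f :: "'a::real_normed_vector \<Rightarrow> real"
  assumes f: "C1_on S f" and fh: "C1_on S (\<lambda>y. frechet_derivative f (at y) h)"
    and s: "0 < s" and sub: "\<And>a b. 0 \<le> a \<Longrightarrow> a \<le> s \<Longrightarrow> 0 \<le> b \<Longrightarrow> b \<le> s \<Longrightarrow> x + a *\<^sub>R h + b *\<^sub>R k \<in> S"
  shows "\<exists>a b. 0 \<le> a \<and> a \<le> s \<and> 0 \<le> b \<and> b \<le> s \<and>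
     f (x + s *\<^sub>R h + s *\<^sub>R k) - f (x + s *\<^sub>R h) - (f (x + s *\<^sub>R k) - f x) =
     s * s * frechet_derivative (\<lambda>y. frechet_derivative f (at y) h) (at (x + a *\<^sub>R h + b *\<^sub>R k)) k"
proof -
  define Dh where "Dh = (\<lambda>y. frechet_derivative f (at y) h)"
  have line: "((\<lambda>t. g (p + t *\<^sub>R u)) has_real_derivative frechet_derivative g (at (p + t *\<^sub>R u)) u) (at t)"
    if "C1_on S g" "p + t *\<^sub>R u \<in> S" for g :: "'a \<Rightarrow> real" and p u t
  proof -
    have "((\<lambda>t. p + t *\<^sub>R u) has_derivative (\<lambda>r. r *\<^sub>R u)) (at t)"
      by (auto intro!: derivative_eq_intros)
    from diff_chain_at[OF this C1_onD(1)[OF that]]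
    have *: "((\<lambda>t. g (p + t *\<^sub>R u)) has_derivative (\<lambda>r. frechet_derivative g (at (p + t *\<^sub>R u)) (r *\<^sub>R u))) (at t)"
      by (simp add: o_def)
    moreover have "frechet_derivative g (at (p + t *\<^sub>R u)) (r *\<^sub>R u) = frechet_derivative g (at (p + t *\<^sub>R u)) u * r" for r
      using linear_scale[OF has_derivative_linear[OF C1_onD(1)[OF that]]] by simp
    ultimately show ?thesis by (simp add: has_field_derivative_def)
  qed
  define g where "g = (\<lambda>t. f ((x + s *\<^sub>R k) + t *\<^sub>R h) - f (x + t *\<^sub>R h))"
  have "\<exists>a>0. a < s \<and> g s - g 0 = (s - 0) * (Dh ((x + s *\<^sub>R k) + a *\<^sub>R h) - Dh (x + a *\<^sub>R h))"
  proof (rule MVT2[OF s])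
    fix t assume t: "0 \<le> t" "t \<le> s"
    have "x + s *\<^sub>R k + t *\<^sub>R h \<in> S" "x + t *\<^sub>R h \<in> S"
      using sub[of t s] sub[of t 0] t s by (auto simp: algebra_simps)
    then show "(g has_real_derivative Dh ((x + s *\<^sub>R k) + t *\<^sub>R h) - Dh (x + t *\<^sub>R h)) (at t)"
      unfolding g_def Dh_def by (intro DERIV_diff line f)
  qed
  then obtain a where a: "0 < a" "a < s" and ga: "g s - g 0 = s * (Dh ((x + s *\<^sub>R k) + a *\<^sub>R h) - Dh (x + a *\<^sub>R h))"
    by auto
  have "\<exists>b>0. b < s \<and> Dh ((x + a *\<^sub>R h) + s *\<^sub>R k) - Dh ((x + a *\<^sub>R h) + 0 *\<^sub>R k)
     = (s - 0) * frechet_derivative Dh (at ((x + a *\<^sub>R h) + b *\<^sub>R k)) k"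
  proof (rule MVT2[OF s])
    fix t assume t: "0 \<le> t" "t \<le> s"
    show "((\<lambda>t. Dh ((x + a *\<^sub>R h) + t *\<^sub>R k)) has_real_derivative
       frechet_derivative Dh (at ((x + a *\<^sub>R h) + t *\<^sub>R k)) k) (at t)"
      using sub[of a t] t a fh unfolding Dh_def by (intro line) auto
  qed
  then obtain b where b: "0 < b" "b < s" and gb: "Dh ((x + a *\<^sub>R h) + s *\<^sub>R k) - Dh (x + a *\<^sub>R h)
     = s * frechet_derivative Dh (at ((x + a *\<^sub>R h) + b *\<^sub>R k)) k"
    by auto
  have "f (x + s *\<^sub>R h + s *\<^sub>R k) - f (x + s *\<^sub>R h) - (f (x + s *\<^sub>R k) - f x) = g s - g 0"
    by (simp add: g_def algebra_simps)
  also have "\<dots> = s * s * frechet_derivative Dh (at ((x + a *\<^sub>R h) + b *\<^sub>R k)) k"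
    using ga gb by (simp add: algebra_simps)
  finally show ?thesis
    using a b unfolding Dh_def by (intro exI[of _ a] exI[of _ b]) auto
qed

text \<open>Arbitrarily close to \<open>x\<close> there are points at which the two mixed derivatives coincide.\<close>

lemma second_derivative_symmetric_real:
  fixes f :: "'a::real_normed_vector \<Rightarrow> real"
  assumes S: "open S" "x \<in> S" and f: "C1_on S f" and f2: "\<And>u. C1_on S (\<lambda>y. frechet_derivative f (at y) u)"
  shows "frechet_derivative (\<lambda>y. frechet_derivative f (at y) h) (at x) k
       = frechet_derivative (\<lambda>y. frechet_derivative f (at y) k) (at x) h"
proof -
  define P where "P = (\<lambda>y. frechet_derivative (\<lambda>y. frechet_derivative f (at y) h) (at y) k)"
  define Q where "Q = (\<lambda>y. frechet_derivative (\<lambda>y. frechet_derivative f (at y) k) (at y) h)"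
  obtain r where r: "r > 0" "ball x r \<subseteq> S" using S by (meson open_contains_ball)
  define M where "M = norm h + norm k + 1"
  have M: "M > 0" unfolding M_def by (smt (verit) norm_ge_zero)
  define s where "s = (\<lambda>n::nat. r / (2 * M * (real n + 1)))"
  have s0: "s n > 0" for n unfolding s_def using r M by auto
  have sM: "s n * M < r" "s n * M = (r/2) / (real n + 1)" for n
  proof -
    show *: "s n * M = (r/2) / (real n + 1)" unfolding s_def using M by (simp add: divide_simps)
    have "(r/2) / (real n + 1) \<le> r / 2" using r by (simp add: field_simps)
    then show "s n * M < r" unfolding * using r by linarith
  qed
  have near: "dist (x + a *\<^sub>R h + b *\<^sub>R k) x \<le> s n * M"
    if "0 \<le> a" "a \<le> s n" "0 \<le> b" "b \<le> s n" for a b n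
  proof -
    have "dist (x + a *\<^sub>R h + b *\<^sub>R k) x = norm (a *\<^sub>R h + b *\<^sub>R k)" by (simp add: dist_norm algebra_simps)
    also have "\<dots> \<le> a * norm h + b * norm k"
      using norm_triangle_ineq[of "a *\<^sub>R h" "b *\<^sub>R k"] that by simp
    also have "\<dots> \<le> s n * norm h + s n * norm k"
      using that by (intro add_mono mult_right_mono) auto
    also have "\<dots> \<le> s n * M" unfolding M_def using s0[of n] by (simp add: algebra_simps)
    finally show ?thesis .
  qed
  have inS: "x + a *\<^sub>R h + b *\<^sub>R k \<in> S"
    if "0 \<le> a" "a \<le> s n" "0 \<le> b" "b \<le> s n" for a b n
    using near[OF that] sM(1)[of n] r(2) by (auto simp: subset_iff dist_commute)
  have "\<exists>p q. dist p x \<le> s n * M \<and> dist q x \<le> s n * M \<and> P p = Q q" for n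
  proof -
    obtain a b where ab: "0 \<le> a" "a \<le> s n" "0 \<le> b" "b \<le> s n"
      and 1: "f (x + s n *\<^sub>R h + s n *\<^sub>R k) - f (x + s n *\<^sub>R h) - (f (x + s n *\<^sub>R k) - f x) =
         s n * s n * P (x + a *\<^sub>R h + b *\<^sub>R k)"
      using second_difference_eq[OF f f2[of h] s0 inS[of _ n], of n] unfolding P_def by auto
    have "x + a *\<^sub>R k + b *\<^sub>R h \<in> S" if "0 \<le> a" "a \<le> s n" "0 \<le> b" "b \<le> s n" for a b
      using inS[of b n a] that by (simp add: algebra_simps)
    then obtain a' b' where ab': "0 \<le> a'" "a' \<le> s n" "0 \<le> b'" "b' \<le> s n"
      and 2: "f (x + s n *\<^sub>R k + s n *\<^sub>R h) - f (x + s n *\<^sub>R k) - (f (x + s n *\<^sub>R h) - f x) =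
         s n * s n * Q (x + a' *\<^sub>R k + b' *\<^sub>R h)"
      using second_difference_eq[OF f f2[of k] s0, of n x h] unfolding Q_def by auto
    have "s n * s n * P (x + a *\<^sub>R h + b *\<^sub>R k) = s n * s n * Q (x + b' *\<^sub>R h + a' *\<^sub>R k)"
      using 1 2 by (simp add: algebra_simps)
    then have "P (x + a *\<^sub>R h + b *\<^sub>R k) = Q (x + b' *\<^sub>R h + a' *\<^sub>R k)"
      using s0[of n] by simp
    then show ?thesis using near[OF ab] near[OF ab'(3,4,1,2)] by blast
  qed
  then have "\<forall>n. \<exists>r. dist (fst r) x \<le> s n * M \<and> dist (snd r) x \<le> s n * M \<and> P (fst r) = Q (snd r)"
    by simp
  from choice[OF this] obtain r' where r':
    "\<And>n. dist (fst (r' n)) x \<le> s n * M" "\<And>n. dist (snd (r' n)) x \<le> s n * M"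
    "\<And>n. P (fst (r' n)) = Q (snd (r' n))" by blast
  define p where "p = (\<lambda>n. fst (r' n))"
  define q where "q = (\<lambda>n. snd (r' n))"
  have pq: "\<And>n. dist (p n) x \<le> s n * M" "\<And>n. dist (q n) x \<le> s n * M" "\<And>n. P (p n) = Q (q n)"
    unfolding p_def q_def by (rule r')+
  have lim: "(\<lambda>n. s n * M) \<longlonglongrightarrow> 0"
    unfolding sM(2) using LIMSEQ_Suc[OF lim_const_over_n[of "r/2"]] by (simp add: add.commute)
  have "(\<lambda>n. dist (p n) x) \<longlonglongrightarrow> 0" "(\<lambda>n. dist (q n) x) \<longlonglongrightarrow> 0"
    by (rule tendsto_sandwich[OF _ _ tendsto_const lim], simp_all add: pq)+
  then have pl: "p \<longlonglongrightarrow> x" "q \<longlonglongrightarrow> x"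
    by (simp_all add: tendsto_dist_iff[symmetric])
  have "isCont P x" "isCont Q x"
    using C1_onD(2)[OF f2] S unfolding P_def Q_def by (auto simp: continuous_on_eq_continuous_at)
  then have "(\<lambda>n. P (p n)) \<longlonglongrightarrow> P x" "(\<lambda>n. Q (q n)) \<longlonglongrightarrow> Q x"
    using pl by (auto intro: isCont_tendsto_compose)
  then have "P x = Q x" using pq(3) LIMSEQ_unique by simp
  then show ?thesis unfolding P_def Q_def .
qed

lemma second_derivative_symmetric:
  fixes f :: "'a::real_normed_vector \<Rightarrow> 'b::euclidean_space"
  assumes S: "open S" "x \<in> S" and f: "C1_on S f" and f2: "\<And>u. C1_on S (\<lambda>y. frechet_derivative f (at y) u)"
  shows "frechet_derivative (\<lambda>y. frechet_derivative f (at y) h) (at x) k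
       = frechet_derivative (\<lambda>y. frechet_derivative f (at y) k) (at x) h"
proof (rule euclidean_eqI)
  fix b :: 'b assume "b \<in> Basis"
  let ?g = "\<lambda>y. f y \<bullet> b"
  have D: "frechet_derivative ?g (at y) u = frechet_derivative f (at y) u \<bullet> b" if "y \<in> S" for y u
    using frechet_derivative_at[OF has_derivative_inner_left[OF C1_onD(1)[OF f that]]]
    by (simp add: fun_eq_iff)
  have g: "C1_on S ?g" by (intro C1_on_inner f C1_on_const)
  have g2: "C1_on S (\<lambda>y. frechet_derivative ?g (at y) u)" for u
    by (rule C1_on_cong[OF _ S(1)]) (use D in \<open>auto intro!: C1_on_inner f2 C1_on_const\<close>)
  have D2: "frechet_derivative (\<lambda>y. frechet_derivative ?g (at y) u) (at x) v
     = frechet_derivative (\<lambda>y. frechet_derivative f (at y) u) (at x) v \<bullet> b" for u v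
  proof -
    have "((\<lambda>y. frechet_derivative ?g (at y) u) has_derivative
        (\<lambda>v. frechet_derivative (\<lambda>y. frechet_derivative f (at y) u) (at x) v \<bullet> b)) (at x)"
      by (rule has_derivative_transform_within_open[OF has_derivative_inner_left[OF C1_onD(1)[OF f2 S(2)]] S])
         (use D in auto)
    from frechet_derivative_at[OF this] show ?thesis by (simp add: fun_eq_iff)
  qed
  show "frechet_derivative (\<lambda>y. frechet_derivative f (at y) h) (at x) k \<bullet> b =
        frechet_derivative (\<lambda>y. frechet_derivative f (at y) k) (at x) h \<bullet> b"
    using second_derivative_symmetric_real[OF S g g2] unfolding D2 by blast
qed


section \<open>Jacobi's formula for determinants\<close>

text \<open>A permutation other than the identity moves at least two indices, so its term in the Leibniz
  formula vanishes to second order at the identity matrix.\<close>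

lemma has_derivative_det_at_one:
  fixes G :: "'a::real_normed_vector \<Rightarrow> real^'n^'n"
  assumes "(G has_derivative G') (at x)" "G x = mat 1"
  shows "((\<lambda>y. det (G y)) has_derivative (\<lambda>h. \<Sum>i\<in>UNIV. G' h $ i $ i)) (at x)"
proof -
  have ent: "((\<lambda>y. G y $ i $ j) has_derivative (\<lambda>h. G' h $ i $ j)) (at x)" for i j
    by (intro bounded_linear.has_derivative[OF bounded_linear_vec_nth] assms)
  have "((\<lambda>y. det (G y)) has_derivative (\<lambda>h. \<Sum>p | p permutes UNIV.
      of_int (sign p) * (\<Sum>i\<in>UNIV. G' h $ i $ p i * (\<Prod>j\<in>UNIV - {i}. G x $ j $ p j)))) (at x)"
    unfolding det_def by (intro has_derivative_sum has_derivative_mult_right has_derivative_prod ent)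
  moreover have "(\<Sum>p | p permutes (UNIV::'n set).
      of_int (sign p) * (\<Sum>i\<in>UNIV. G' h $ i $ p i * (\<Prod>j\<in>UNIV - {i}. G x $ j $ p j)))
      = (\<Sum>i\<in>UNIV. G' h $ i $ i)" for h
  proof -
    have "(\<Sum>i\<in>UNIV. G' h $ i $ p i * (\<Prod>j\<in>UNIV - {i}. G x $ j $ p j)) = 0"
      if p: "p permutes UNIV" "p \<noteq> id" for p
    proof (rule sum.neutral, rule ballI)
      fix i :: 'n
      have "\<exists>j. j \<noteq> i \<and> p j \<noteq> j"
      proof (rule ccontr)
        assume "\<not> ?thesis"
        then have fixed: "p j = j" if "j \<noteq> i" for j using that by blast
        moreover have "p i = i"
          using fixed permutes_inj[OF p(1)] by (metis injD)
        ultimately have "p x = x" for x by metis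
        then show False using p(2) by (auto simp: fun_eq_iff)
      qed
      then obtain j where "j \<in> UNIV - {i}" "G x $ j $ p j = 0"
        unfolding assms(2) by (auto simp: mat_def)
      then have "(\<Prod>j\<in>UNIV - {i}. G x $ j $ p j) = 0" by (intro prod_zero) auto
      then show "G' h $ i $ p i * (\<Prod>j\<in>UNIV - {i}. G x $ j $ p j) = 0" by simp
    qed
    then have "(\<Sum>p | p permutes (UNIV::'n set).
      of_int (sign p) * (\<Sum>i\<in>UNIV. G' h $ i $ p i * (\<Prod>j\<in>UNIV - {i}. G x $ j $ p j)))
      = (\<Sum>p\<in>{id}. of_int (sign p) * (\<Sum>i\<in>UNIV. G' h $ i $ p i * (\<Prod>j\<in>UNIV - {i}. G x $ j $ p j)))"
      by (intro sum.mono_neutral_right) (auto simp: permutes_id finite_permutations)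
    then show ?thesis unfolding assms(2) by (simp add: mat_def)
  qed
  ultimately show ?thesis by simp
qed

text \<open>The basis change \<open>B\<close> moves the general case to the identity matrix, and multiplies the
  determinant by a constant only.\<close>

lemma has_derivative_det:
  fixes G :: "'a::real_normed_vector \<Rightarrow> real^'n^'n" and B :: "real^'n^'n"
  assumes G: "(G has_derivative G') (at x)" and B: "transpose B ** G x ** B = mat 1"
  shows "((\<lambda>y. det (G y)) has_derivative
     (\<lambda>h. det (G x) * (\<Sum>i\<in>UNIV. (transpose B ** G' h ** B) $ i $ i))) (at x)"
proof -
  have lin: "bounded_linear (\<lambda>M::real^'n^'n. transpose B ** M ** B)"
    by (intro linear_conv_bounded_linear[THEN iffD1] linearI)
       (simp_all add: matrix_matrix_mult_def vec_eq_iff sum_distrib_left sum_distrib_right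
         sum.distrib algebra_simps)
  have detx: "det B * det B * det (G x) = 1"
    using arg_cong[OF B, of det] by (simp add: det_mul algebra_simps)
  have "((\<lambda>y. det (transpose B ** G y ** B)) has_derivative
      (\<lambda>h. \<Sum>i\<in>UNIV. (transpose B ** G' h ** B) $ i $ i)) (at x)"
    by (rule has_derivative_det_at_one[OF bounded_linear.has_derivative[OF lin G] B])
  then have "((\<lambda>y. det (G x) * det (transpose B ** G y ** B)) has_derivative
      (\<lambda>h. det (G x) * (\<Sum>i\<in>UNIV. (transpose B ** G' h ** B) $ i $ i))) (at x)"
    by (rule has_derivative_mult_right)
  moreover have "det (G x) * det (transpose B ** G y ** B) = det (G y)" for y
    using detx by (simp add: det_mul algebra_simps)
  ultimately show ?thesis by simp
qed

section \<open>Integrals of continuous functions with compact support\<close>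

definition compactly_supported :: "('a::euclidean_space \<Rightarrow> real) \<Rightarrow> bool" where
  "compactly_supported f \<longleftrightarrow> continuous_on UNIV f \<and> (\<exists>K. compact K \<and> (\<forall>x. x \<notin> K \<longrightarrow> f x = 0))"

lemma compactly_supported_extend:
  fixes f :: "'a::euclidean_space \<Rightarrow> real"
  assumes "open S" "compact K" "K \<subseteq> S" "continuous_on S f" "\<And>x. x \<in> S \<Longrightarrow> x \<notin> K \<Longrightarrow> f x = 0"
  shows "compactly_supported (\<lambda>x. if x \<in> S then f x else 0)"
proof -
  have "continuous_on (S \<union> - K) (\<lambda>x. if x \<in> S then f x else 0)"
  proof (rule continuous_on_open_Un)
    show "open S" by fact
    show "open (- K)" using assms(2) by (simp add: compact_imp_closed open_Compl)
    show "continuous_on S (\<lambda>x. if x \<in> S then f x else 0)"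
      using assms(4) by (simp cong: continuous_on_cong)
    have "continuous_on (- K) (\<lambda>x. 0::real)" by simp
    then show "continuous_on (- K) (\<lambda>x. if x \<in> S then f x else 0)"
      by (rule continuous_on_eq) (use assms(5) in auto)
  qed
  moreover have "S \<union> - K = UNIV" using assms(3) by blast
  moreover have "\<forall>x. x \<notin> K \<longrightarrow> (if x \<in> S then f x else 0) = 0" using assms(5) by auto
  ultimately show ?thesis unfolding compactly_supported_def using assms(2) by metis
qed

lemma compactly_supported_integrable:
  assumes "compactly_supported f" shows "integrable lborel f"
proof -
  obtain K where K: "compact K" "\<And>x. x \<notin> K \<Longrightarrow> f x = 0" and f: "continuous_on UNIV f"
    using assms unfolding compactly_supported_def by blast
  have "integrable lborel (\<lambda>x. indicator K x *\<^sub>R f x)"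
    by (rule borel_integrable_compact[OF K(1) continuous_on_subset[OF f]]) simp
  moreover have "(\<lambda>x. indicator K x *\<^sub>R f x) = f" using K(2) by (auto simp: indicator_def fun_eq_iff)
  ultimately show ?thesis by simp
qed

lemma compactly_supported_absolutely_integrable:
  assumes "compactly_supported f" shows "f absolutely_integrable_on UNIV"
  using compactly_supported_integrable[OF assms]
  by (simp add: absolutely_integrable_on_def integrable_on_lborel compactly_supported_integrable
      absolutely_integrable_measurable set_integrable_def integrable_completion)

lemma integral_nonneg_eq_0D:
  fixes f :: "'a::euclidean_space \<Rightarrow> real"
  assumes "compactly_supported f" "\<And>x. 0 \<le> f x" "integral\<^sup>L lborel f = 0"
  shows "f x = 0"
proof -
  have f: "continuous_on UNIV f" using assms(1) by (simp add: compactly_supported_def)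
  have "AE x in lborel. f x = 0"
    using integral_nonneg_eq_0_iff_AE[OF compactly_supported_integrable[OF assms(1)]] assms(2,3) by simp
  then have "AE x in lebesgue. x \<in> {x. f x = 0}" by (simp add: AE_completion)
  moreover have "closed {x. f x = 0}"
    using f by (intro closed_Collect_eq) auto
  ultimately show ?thesis
    using mem_closed_if_AE_lebesgue[of "{x. f x = 0}" x] by simp
qed

text \<open>Lebesgue measure is translation invariant, so the integral of every difference quotient
  vanishes, and with it the integral of the limit.\<close>

lemma integral_derivative_compact_support:
  fixes h :: "'a::euclidean_space \<Rightarrow> real"
  assumes h: "\<And>x. (h has_derivative h' x) (at x)" and cont: "continuous_on UNIV (\<lambda>x. h' x u)"
    and K: "compact K" "\<And>x. x \<notin> K \<Longrightarrow> h x = 0"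
  shows "integral\<^sup>L lborel (\<lambda>x. h' x u) = 0"
proof -
  have hc: "compactly_supported h"
    unfolding compactly_supported_def
    using K h by (metis continuous_at_imp_continuous_on has_derivative_continuous)
  have off: "h' x u = 0" if "x \<notin> K" for x
  proof -
    have "(h has_derivative (\<lambda>_. 0)) (at x)"
    proof (rule has_derivative_transform_within_open[of "\<lambda>_. 0"])
      show "open (- K)" using K(1) by (simp add: compact_imp_closed open_Compl)
    qed (use that K in auto)
    then show ?thesis using has_derivative_unique[OF h[of x]] by (simp add: fun_eq_iff)
  qed
  have "bounded ((\<lambda>x. h' x u) ` K)"
    using compact_continuous_image[OF continuous_on_subset[OF cont] K(1)] by (simp add: compact_imp_bounded)
  then obtain B where B: "B > 0" "\<And>x. x \<in> K \<Longrightarrow> \<bar>h' x u\<bar> \<le> B"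
    unfolding bounded_pos by auto
  then have B': "\<bar>h' x u\<bar> \<le> B" for x using off[of x] by (cases "x \<in> K") auto
  define t where "t = (\<lambda>n::nat. 1 / (real n + 1))"
  have t: "0 < t n" "t n \<le> 1" for n unfolding t_def by auto
  have t0: "t \<longlonglongrightarrow> 0" unfolding t_def using LIMSEQ_inverse_real_of_nat by (simp add: inverse_eq_divide add.commute)
  define q where "q = (\<lambda>n x. (h (x + t n *\<^sub>R u) - h x) / t n)"
  have shift: "integrable lborel (\<lambda>x. h (x + c))" "integral\<^sup>L lborel (\<lambda>x. h (x + c)) = integral\<^sup>L lborel h" for c
  proof -
    have hm: "h \<in> borel_measurable borel" using hc by (auto simp: compactly_supported_def intro: borel_measurable_continuous_onI)
    have "integrable (distr lborel borel ((+) c)) h"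
      using compactly_supported_integrable[OF hc] by (simp add: lborel_distr_plus)
    then show "integrable lborel (\<lambda>x. h (x + c))"
      by (subst (asm) integrable_distr_eq) (use hm in \<open>auto simp: add.commute\<close>)
    have "integral\<^sup>L lborel h = integral\<^sup>L (distr lborel borel ((+) c)) h" by (simp add: lborel_distr_plus)
    also have "\<dots> = integral\<^sup>L lborel (\<lambda>x. h (c + x))" by (rule integral_distr) (use hm in auto)
    finally show "integral\<^sup>L lborel (\<lambda>x. h (x + c)) = integral\<^sup>L lborel h" by (simp add: add.commute)
  qed
  have q0: "integral\<^sup>L lborel (q n) = 0" for n
    unfolding q_def using shift compactly_supported_integrable[OF hc] by simp
  have line: "((\<lambda>s. h (x + s *\<^sub>R u)) has_real_derivative h' (x + s *\<^sub>R u) u) (at s)" for x s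
  proof -
    have "((\<lambda>s. x + s *\<^sub>R u) has_derivative (\<lambda>r. r *\<^sub>R u)) (at s)"
      by (auto intro!: derivative_eq_intros)
    from diff_chain_at[OF this h]
    have "((\<lambda>s. h (x + s *\<^sub>R u)) has_derivative (\<lambda>r. h' (x + s *\<^sub>R u) (r *\<^sub>R u))) (at s)"
      by (simp add: o_def)
    moreover have "h' (x + s *\<^sub>R u) (r *\<^sub>R u) = h' (x + s *\<^sub>R u) u * r" for r
      using linear_scale[OF has_derivative_linear[OF h]] by simp
    ultimately show ?thesis by (simp add: has_field_derivative_def)
  qed
  define K' where "K' = {y - s *\<^sub>R u | y s. y \<in> K \<and> s \<in> {0..1}}"
  have K': "compact K'"
  proof -
    have "compact ((\<lambda>p. fst p - snd p *\<^sub>R u) ` (K \<times> {0..1::real}))"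
      by (intro compact_continuous_image compact_Times K continuous_intros) auto
    moreover have "(\<lambda>p. fst p - snd p *\<^sub>R u) ` (K \<times> {0..1::real}) = K'" unfolding K'_def by force
    ultimately show ?thesis by simp
  qed
  have qb: "norm (q n x) \<le> B * indicator K' x" for n x
  proof -
    have "\<exists>z>0. z < t n \<and> h (x + t n *\<^sub>R u) - h (x + 0 *\<^sub>R u) = (t n - 0) * h' (x + z *\<^sub>R u) u"
      by (rule MVT2[OF t(1)]) (rule line)
    then obtain z where z: "0 < z" "z < t n" "h (x + t n *\<^sub>R u) - h x = t n * h' (x + z *\<^sub>R u) u" by auto
    then have qz: "q n x = h' (x + z *\<^sub>R u) u" unfolding q_def using t(1)[of n] by simp
    show ?thesis
    proof (cases "x + z *\<^sub>R u \<in> K")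
      case True
      then have "x \<in> K'" unfolding K'_def using z t(2)[of n] by (intro CollectI exI[of _ "x + z *\<^sub>R u"] exI[of _ z]) auto
      then show ?thesis using qz B' by simp
    qed (use qz off B in simp)
  qed
  have "(\<lambda>n. integral\<^sup>L lborel (q n)) \<longlonglongrightarrow> integral\<^sup>L lborel (\<lambda>x. h' x u)"
  proof (rule integral_dominated_convergence[where w="\<lambda>x. B * indicator K' x"])
    show "(\<lambda>x. h' x u) \<in> borel_measurable lborel"
      using cont by (auto intro: borel_measurable_continuous_onI)
    show "q n \<in> borel_measurable lborel" for n
      unfolding q_def using shift compactly_supported_integrable[OF hc]
      by (intro borel_measurable_divide borel_measurable_diff borel_measurable_integrable) auto
    show "integrable lborel (\<lambda>x. B * indicator K' x)"
      using borel_integrable_compact[OF K', of "\<lambda>x. B"] by (simp add: mult.commute)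
    show "AE x in lborel. (\<lambda>n. q n x) \<longlonglongrightarrow> h' x u"
    proof (rule AE_I2)
      fix x
      have "((\<lambda>s. (h (x + s *\<^sub>R u) - h x) / s) \<longlongrightarrow> h' x u) (at 0)"
        using line[of x 0] by (simp add: DERIV_def)
      then show "(\<lambda>n. q n x) \<longlonglongrightarrow> h' x u"
        unfolding q_def by (rule filterlim_compose[of _ _ _ t])
           (use t t0 in \<open>auto simp: filterlim_at less_imp_neq intro!: always_eventually, metis less_irrefl\<close>)
    qed
  qed (use qb in auto)
  then show ?thesis unfolding q0 by (simp add: LIMSEQ_const_iff)
qed

lemma integral_divergence_compact_support:
  fixes Z :: "real^'n \<Rightarrow> real^'n"
  assumes S: "open S" and Z: "C1_on S Z" and K: "compact K" "K \<subseteq> S" "\<And>x. x \<in> S \<Longrightarrow> x \<notin> K \<Longrightarrow> Z x = 0"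
  shows "integral\<^sup>L lborel (\<lambda>x. if x \<in> S then \<Sum>k\<in>UNIV. frechet_derivative Z (at x) (axis k 1) $ k else 0) = 0"
proof -
  define h where "h = (\<lambda>k x. if x \<in> S then Z x $ k else 0)"
  define h' where "h' = (\<lambda>k x u. if x \<in> S then frechet_derivative Z (at x) u $ k else 0)"
  have K': "open (- K)" using K(1) by (simp add: compact_imp_closed open_Compl)
  have off: "h k x = 0" if "x \<notin> K" for x k using that K(3)[of x] by (auto simp: h_def)
  have dh: "(h k has_derivative h' k x) (at x)" for k x
  proof (cases "x \<in> S")
    case True
    have "((\<lambda>x. Z x $ k) has_derivative (\<lambda>u. frechet_derivative Z (at x) u $ k)) (at x)"
      by (intro bounded_linear.has_derivative[OF bounded_linear_vec_nth] C1_onD(1)[OF Z True])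
    then have "(h k has_derivative (\<lambda>u. frechet_derivative Z (at x) u $ k)) (at x)"
      by (rule has_derivative_transform_within_open[OF _ S True]) (simp add: h_def)
    then show ?thesis using True by (simp add: h'_def)
  next
    case False
    then have "x \<in> - K" using K(2) by blast
    then have "(h k has_derivative (\<lambda>u. 0)) (at x)"
      by (intro has_derivative_transform_within_open[OF has_derivative_const K']) (use off in auto)
    then show ?thesis using False by (simp add: h'_def)
  qed
  have h'0: "h' k x u = 0" if "x \<notin> K" for k x u
  proof -
    have "(h k has_derivative (\<lambda>u. 0)) (at x)"
      using that by (intro has_derivative_transform_within_open[OF has_derivative_const K']) (use off in auto)
    then show ?thesis using has_derivative_unique[OF dh] by metis
  qed
  have cs: "compactly_supported (\<lambda>x. h' k x u)" for k u
    unfolding h'_def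
  proof (rule compactly_supported_extend[OF S K(1,2)])
    show "continuous_on S (\<lambda>x. frechet_derivative Z (at x) u $ k)"
      by (intro continuous_on_component C1_onD(2)[OF Z])
    show "frechet_derivative Z (at x) u $ k = 0" if "x \<in> S" "x \<notin> K" for x
      using h'0[of x k u] that by (simp add: h'_def)
  qed
  have "integral\<^sup>L lborel (\<lambda>x. h' k x u) = 0" for k u
    by (rule integral_derivative_compact_support[OF dh _ K(1) off])
       (use cs in \<open>auto simp: compactly_supported_def\<close>)
  then have "integral\<^sup>L lborel (\<lambda>x. \<Sum>k\<in>UNIV. h' k x (axis k 1)) = 0"
    using compactly_supported_integrable[OF cs] by simp
  moreover have "(\<lambda>x. \<Sum>k\<in>UNIV. h' k x (axis k 1))
     = (\<lambda>x. if x \<in> S then \<Sum>k\<in>UNIV. frechet_derivative Z (at x) (axis k 1) $ k else 0)"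
    by (auto simp: h'_def)
  ultimately show ?thesis by simp
qed


subsection \<open>Change of variables\<close>

text \<open>A finite type has a well-ordered copy, and reindexing along it preserves boxes, Lebesgue measure
  and determinants. This carries the change of variables formula from well-ordered index types to
  arbitrary finite ones.\<close>

typedef 'a ordered_copy = "UNIV :: 'a set" by auto

instance ordered_copy :: (finite) finite
proof
  have "(UNIV :: ('a::finite) ordered_copy set) = range Abs_ordered_copy"
    by (metis Rep_ordered_copy_inverse surj_def)
  then show "finite (UNIV :: 'a ordered_copy set)"
    by (metis finite_class.finite_UNIV finite_imageI)
qed

definition enum_index :: "'a::finite \<Rightarrow> nat" where
  "enum_index = (SOME f. inj f)"

lemma inj_enum_index: "inj (enum_index :: 'a::finite \<Rightarrow> nat)"
proof -
  have "\<exists>f :: 'a \<Rightarrow> nat. inj f"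
    using finite_imp_inj_to_nat_seg[OF finite_class.finite_UNIV] by blast
  then show ?thesis unfolding enum_index_def by (rule someI_ex)
qed

instantiation ordered_copy :: (finite) wellorder
begin

definition less_eq_ordered_copy :: "'a ordered_copy \<Rightarrow> 'a ordered_copy \<Rightarrow> bool" where
  "x \<le> y \<longleftrightarrow> enum_index (Rep_ordered_copy x) \<le> enum_index (Rep_ordered_copy y)"

definition less_ordered_copy :: "'a ordered_copy \<Rightarrow> 'a ordered_copy \<Rightarrow> bool" where
  "x < y \<longleftrightarrow> enum_index (Rep_ordered_copy x) < enum_index (Rep_ordered_copy y)"

instance
proof
  fix P :: "'a ordered_copy \<Rightarrow> bool" and a
  assume "\<And>x. (\<And>y. y < x \<Longrightarrow> P y) \<Longrightarrow> P x"
  then show "P a"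
    using measure_induct_rule[of "\<lambda>x. enum_index (Rep_ordered_copy x)" P a]
    unfolding less_ordered_copy_def by blast
next
  fix x y :: "'a ordered_copy"
  assume "x \<le> y" "y \<le> x"
  then have "Rep_ordered_copy x = Rep_ordered_copy y"
    using inj_enum_index unfolding less_eq_ordered_copy_def by (metis antisym injD)
  then show "x = y" by (simp add: Rep_ordered_copy_inject)
qed (auto simp: less_eq_ordered_copy_def less_ordered_copy_def)

end

abbreviation (input) "unr \<equiv> Rep_ordered_copy"
abbreviation (input) "ord \<equiv> Abs_ordered_copy"

lemma unr_ord [simp]: "unr (ord x) = x" "ord (unr y) = y"
  by (simp_all add: Abs_ordered_copy_inverse Rep_ordered_copy_inverse)

lemma bij_unr: "bij unr" "bij ord"
  by (rule o_bij[of ord unr], auto simp: fun_eq_iff, rule o_bij[of unr ord], auto simp: fun_eq_iff)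

definition to_ordered :: "real^'n \<Rightarrow> real^('n::finite) ordered_copy" where
  "to_ordered x = (\<chi> k. x $ unr k)"

definition from_ordered :: "real^('n::finite) ordered_copy \<Rightarrow> real^'n" where
  "from_ordered z = (\<chi> i. z $ ord i)"

lemma ordered_inverse [simp]: "from_ordered (to_ordered x) = x" "to_ordered (from_ordered z) = z"
  by (simp_all add: to_ordered_def from_ordered_def vec_eq_iff)

lemma bounded_linear_ordered: "bounded_linear to_ordered" "bounded_linear from_ordered"
  by (rule linear_conv_bounded_linear[THEN iffD1], rule linearI,
      simp_all add: to_ordered_def from_ordered_def vec_eq_iff)+

lemma continuous_ordered: "continuous_on S to_ordered" "continuous_on R from_ordered"
  by (rule linear_continuous_on bounded_linear_ordered)+

lemma lborel_from_ordered: "distr lborel borel from_ordered = (lborel :: (real^'n::finite) measure)"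
proof (rule lborel_eqI[symmetric])
  fix l u :: "real^'n"
  assume le: "\<And>b. b \<in> Basis \<Longrightarrow> l \<bullet> b \<le> u \<bullet> b"
  have prod: "(\<Prod>b\<in>Basis. w \<bullet> b) = (\<Prod>i\<in>UNIV. w $ i)" for w :: "real^'k::finite"
  proof -
    have *: "Basis = (\<lambda>i::'k. axis i (1::real)) ` UNIV" by (auto simp: Basis_vec_def)
    show ?thesis
      unfolding * by (subst prod.reindex) (auto simp: inj_on_def axis_eq_axis inner_axis)
  qed
  have m: "from_ordered \<in> borel_measurable borel"
    by (intro borel_measurable_continuous_onI continuous_ordered)
  have "emeasure (distr lborel borel from_ordered) (box l u)
      = emeasure lborel (from_ordered -` box l u \<inter> space lborel)"
    by (rule emeasure_distr) (use m in auto)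
  also have "from_ordered -` box l u \<inter> space lborel = box (to_ordered l) (to_ordered u)"
    by (auto simp: mem_box_cart from_ordered_def to_ordered_def; metis unr_ord)
  also have "emeasure lborel (box (to_ordered l) (to_ordered u))
      = ennreal (\<Prod>b\<in>Basis. (to_ordered u - to_ordered l) \<bullet> b)"
  proof (rule emeasure_lborel_box)
    fix b :: "real^'n ordered_copy" assume "b \<in> Basis"
    then show "to_ordered l \<bullet> b \<le> to_ordered u \<bullet> b"
      using le[OF axis_in_Basis_iff[THEN iffD2]] by (auto simp: Basis_vec_def inner_axis to_ordered_def)
  qed
  also have "(\<Prod>b\<in>Basis. (to_ordered u - to_ordered l) \<bullet> b) = (\<Prod>k\<in>UNIV. (u - l) $ unr k)"
    unfolding prod by (simp add: to_ordered_def)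
  also have "\<dots> = (\<Prod>i\<in>UNIV. (u - l) $ i)"
    by (rule prod.reindex_bij_betw[OF bij_unr(1)])
  finally show "emeasure (distr lborel borel from_ordered) (box l u) = ennreal (\<Prod>b\<in>Basis. (u - l) \<bullet> b)"
    unfolding prod .
qed simp

lemma swapidseq_ordered:
  "swapidseq n q \<Longrightarrow> swapidseq n (unr \<circ> q \<circ> ord)"
proof (induction rule: swapidseq.induct)
  case id
  have "unr \<circ> id \<circ> ord = id" by (simp add: fun_eq_iff)
  then show ?case using swapidseq.id by metis
next
  case (comp_Suc n p a b)
  have "unr \<circ> (Transposition.transpose a b \<circ> p) \<circ> ord = Transposition.transpose (unr a) (unr b) \<circ> (unr \<circ> p \<circ> ord)"
    by (auto simp: fun_eq_iff Transposition.transpose_def Rep_ordered_copy_inject)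
  moreover have "unr a \<noteq> unr b" using comp_Suc by (simp add: Rep_ordered_copy_inject)
  ultimately show ?case using comp_Suc swapidseq.comp_Suc by metis
qed

lemma det_ordered:
  fixes A :: "real^'n::finite^'n"
  shows "det (\<chi> a b. A $ unr a $ unr b) = det A"
proof -
  let ?c = "\<lambda>q::'n ordered_copy \<Rightarrow> 'n ordered_copy. unr \<circ> q \<circ> ord"
  have perm: "p permutes UNIV \<longleftrightarrow> bij p" for p :: "'x \<Rightarrow> 'x"
    by (simp add: permutes_univ bij_iff)
  have c: "bij_betw ?c {q. q permutes UNIV} {p. p permutes UNIV}"
  proof (rule bij_betw_byWitness[where f'="\<lambda>p. ord \<circ> p \<circ> unr"])
    show "?c ` {q. q permutes UNIV} \<subseteq> {p. p permutes UNIV}"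
      using bij_unr by (auto simp: perm intro!: bij_comp)
    show "(\<lambda>p. ord \<circ> p \<circ> unr) ` {p. p permutes UNIV} \<subseteq> {q. q permutes UNIV}"
      using bij_unr by (auto simp: perm intro!: bij_comp)
  qed (auto simp: fun_eq_iff)
  have sg: "sign (?c q) = sign q" if "q permutes UNIV" for q
  proof -
    have "permutation q" using that by (auto simp: permutation_permutes)
    then obtain n where "swapidseq n q" unfolding permutation_def by blast
    then show ?thesis
      using evenperm_unique[OF _ refl] swapidseq_ordered unfolding sign_def by metis
  qed
  have "det A = (\<Sum>q | q permutes UNIV. of_int (sign (?c q)) * (\<Prod>i\<in>UNIV. A $ i $ ?c q i))"
    unfolding det_def by (rule sum.reindex_bij_betw[OF c, symmetric])
  also have "\<dots> = (\<Sum>q | q permutes UNIV. of_int (sign q) * (\<Prod>a\<in>UNIV. A $ unr a $ unr (q a)))"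
  proof (rule sum.cong[OF refl])
    fix q :: "'n ordered_copy \<Rightarrow> 'n ordered_copy" assume "q \<in> {q. q permutes UNIV}"
    moreover have "(\<Prod>a\<in>UNIV. A $ unr a $ ?c q (unr a)) = (\<Prod>i\<in>UNIV. A $ i $ ?c q i)"
      by (rule prod.reindex_bij_betw[OF bij_unr(1)])
    ultimately show "of_int (sign (?c q)) * (\<Prod>i\<in>UNIV. A $ i $ ?c q i)
       = of_int (sign q) * (\<Prod>a\<in>UNIV. A $ unr a $ unr (q a))"
      using sg[of q] by simp
  qed
  also have "\<dots> = det (\<chi> a b. A $ unr a $ unr b)" unfolding det_def by simp
  finally show ?thesis by simp
qed

lemma integral_change_of_variables_compact_support:
  fixes g :: "real^'n::finite \<Rightarrow> real^'n" and f1 f2 :: "real^'n \<Rightarrow> real"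
  assumes S: "open S" and g: "\<And>x. x \<in> S \<Longrightarrow> (g has_derivative g' x) (at x)" and inj: "inj_on g S"
    and f1: "compactly_supported f1" "\<And>y. y \<notin> g ` S \<Longrightarrow> f1 y = 0"
    and f2: "compactly_supported f2" "\<And>x. x \<notin> S \<Longrightarrow> f2 x = 0"
    and eq: "\<And>x. x \<in> S \<Longrightarrow> f2 x = \<bar>det (matrix (g' x))\<bar> * f1 (g x)"
  shows "integral\<^sup>L lborel f1 = integral\<^sup>L lborel f2"
proof -
  define h where "h = to_ordered \<circ> g \<circ> from_ordered"
  define R where "R = to_ordered ` S"
  define F where "F = (\<lambda>f :: real^'n \<Rightarrow> real. \<lambda>z. f (from_ordered z))"
  have cs: "compactly_supported (F f)" "integral\<^sup>L lborel (F f) = integral\<^sup>L lborel f"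
    if f: "compactly_supported f" for f
  proof -
    obtain K where K: "compact K" "\<And>x. x \<notin> K \<Longrightarrow> f x = 0" and fc: "continuous_on UNIV f"
      using f unfolding compactly_supported_def by blast
    have "compact (to_ordered ` K)" by (rule compact_continuous_image[OF continuous_ordered(1) K(1)])
    moreover have "F f z = 0" if "z \<notin> to_ordered ` K" for z
      unfolding F_def using that by (intro K(2)) (metis image_eqI ordered_inverse(2))
    moreover have "continuous_on UNIV (F f)"
      unfolding F_def by (rule continuous_on_compose2[OF fc continuous_ordered(2)]) simp
    ultimately show "compactly_supported (F f)" unfolding compactly_supported_def by blast
    have "integral\<^sup>L (distr lborel borel from_ordered) f = integral\<^sup>L lborel (F f)"
      unfolding F_def
      by (rule integral_distr) (auto intro!: borel_measurable_continuous_onI continuous_ordered fc)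
    then show "integral\<^sup>L lborel (F f) = integral\<^sup>L lborel f" by (simp add: lborel_from_ordered)
  qed
  have "open (from_ordered -` S)"
    by (rule open_vimage[OF S continuous_ordered(2)])
  moreover have "from_ordered -` S = R" unfolding R_def by (auto intro: image_eqI[of _ _ "from_ordered _"])
  ultimately have R: "open R" by simp
  have fR: "from_ordered z \<in> S" if "z \<in> R" for z using that by (auto simp: R_def)
  have dh: "(h has_derivative (\<lambda>v. to_ordered (g' (from_ordered z) (from_ordered v)))) (at z within R)"
    if z: "z \<in> R" for z
  proof -
    have "(h has_derivative (to_ordered \<circ> (g' (from_ordered z)) \<circ> from_ordered)) (at z)"
      unfolding h_def
      by (intro diff_chain_at bounded_linear_imp_has_derivative bounded_linear_ordered)
         (use g[OF fR[OF z]] in simp)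
    then show ?thesis by (simp add: o_def has_derivative_at_withinI)
  qed
  have dd: "det (matrix (\<lambda>v. to_ordered (g' (from_ordered z) (from_ordered v)))) = det (matrix (g' (from_ordered z)))" for z
  proof -
    have "matrix (\<lambda>v. to_ordered (g' (from_ordered z) (from_ordered v)))
        = (\<chi> a b. matrix (g' (from_ordered z)) $ unr a $ unr b)"
    proof -
      have ax: "from_ordered (axis k 1) = axis (unr k) 1" for k :: "'n ordered_copy"
        by (auto simp: from_ordered_def axis_def vec_eq_iff)
      show ?thesis by (simp add: matrix_def vec_eq_iff to_ordered_def ax)
    qed
    then show ?thesis by (simp add: det_ordered)
  qed
  have injh: "inj_on h R"
    unfolding h_def R_def using inj by (auto simp: inj_on_def) (metis ordered_inverse(1))
  have hR: "h ` R = to_ordered ` (g ` S)" unfolding h_def R_def by (auto simp: image_image)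
  define v :: "real \<Rightarrow> real^1" where "v = (\<lambda>r. vec r)"
  have blv: "bounded_linear v"
    unfolding v_def by (intro linear_conv_bounded_linear[THEN iffD1] linearI) (simp_all add: vec_eq_iff)
  have ai: "(\<lambda>z. v (F f z)) absolutely_integrable_on Q" "integral Q (\<lambda>z. v (F f z)) = v (integral\<^sup>L lborel f)"
    if f: "compactly_supported f" and z: "\<And>z. z \<notin> Q \<Longrightarrow> F f z = 0" for f Q
  proof -
    have a: "F f absolutely_integrable_on UNIV"
      by (rule compactly_supported_absolutely_integrable[OF cs(1)[OF f]])
    have r: "(\<lambda>z. if z \<in> Q then v (F f z) else 0) = (\<lambda>z. v (F f z))"
      using z linear_0[OF bounded_linear.linear[OF blv]] by auto
    have b: "(\<lambda>z. v (F f z)) absolutely_integrable_on UNIV"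
      using absolutely_integrable_linear[OF a blv] by (simp add: o_def)
    then show "(\<lambda>z. v (F f z)) absolutely_integrable_on Q"
      using absolutely_integrable_restrict_UNIV[of Q "\<lambda>z. v (F f z)"] r by simp
    have "integral Q (\<lambda>z. v (F f z)) = integral UNIV (\<lambda>z. v (F f z))"
      using integral_restrict_UNIV[of Q "\<lambda>z. v (F f z)"] r by simp
    also have "\<dots> = v (integral UNIV (F f))"
      using integral_linear[OF absolutely_integrable_on_def[THEN iffD1, OF a, THEN conjunct1] blv]
      by (simp add: o_def)
    also have "integral UNIV (F f) = integral\<^sup>L lborel f"
      using integral_lborel[OF compactly_supported_integrable[OF cs(1)[OF f]]] cs(2)[OF f] by simp
    finally show "integral Q (\<lambda>z. v (F f z)) = v (integral\<^sup>L lborel f)" .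
  qed
  have z1: "F f1 z = 0" if "z \<notin> h ` R" for z
    unfolding F_def using that unfolding hR by (intro f1(2)) (metis image_eqI ordered_inverse(2))
  have z2: "F f2 z = 0" if "z \<notin> R" for z
    unfolding F_def using that unfolding R_def by (intro f2(2)) (metis image_eqI ordered_inverse(2))
  have "R \<in> sets lebesgue" using R by auto
  from integral_change_of_variables[OF this dh injh, of "\<lambda>z. v (F f1 z)"] ai(1)[OF f1(1) z1]
  have "integral (h ` R) (\<lambda>z. v (F f1 z)) =
     integral R (\<lambda>z. \<bar>det (matrix (g' (from_ordered z)))\<bar> *\<^sub>R v (F f1 (h z)))"
    unfolding dd by blast
  also have "\<dots> = integral R (\<lambda>z. v (F f2 z))"
  proof (rule integral_cong)
    fix z assume "z \<in> R"
    from eq[OF fR[OF this]]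
    show "\<bar>det (matrix (g' (from_ordered z)))\<bar> *\<^sub>R v (F f1 (h z)) = v (F f2 z)"
      unfolding F_def h_def by (simp add: linear_scale[OF bounded_linear.linear[OF blv], symmetric])
  qed
  finally have "v (integral\<^sup>L lborel f1) = v (integral\<^sup>L lborel f2)"
    using ai(2)[OF f1(1) z1] ai(2)[OF f2(1) z2] by metis
  then show ?thesis unfolding v_def by (simp add: vec_eq_iff)
qed

section \<open>Orthonormal bases adapted to a hyperplane\<close>

lemma orthonormal_expansion:
  fixes e :: "'n::finite \<Rightarrow> real^'m::finite" and \<nu> :: "real^'m"
  assumes card: "CARD('m) = Suc CARD('n)"
    and e: "\<And>i j. e i \<bullet> e j = (if i = j then 1 else 0)"
    and \<nu>: "\<And>i. e i \<bullet> \<nu> = 0" "norm \<nu> = 1"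
  shows "x = (\<Sum>i\<in>UNIV. (x \<bullet> e i) *\<^sub>R e i) + (x \<bullet> \<nu>) *\<^sub>R \<nu>"
proof -
  let ?B = "insert \<nu> (range e)"
  have \<nu>1: "\<nu> \<bullet> \<nu> = 1" using \<nu>(2) by (simp add: dot_square_norm)
  have inj: "inj e"
    by (rule injI) (metis e zero_neq_one)
  have nin: "\<nu> \<notin> range e" using \<nu>(1) \<nu>1 by auto
  have card_B: "card ?B = DIM(real^'m)"
    using nin card by (simp add: card_image[OF inj])
  have "pairwise orthogonal ?B"
    unfolding pairwise_def orthogonal_def using e \<nu>(1) by (auto simp: inner_commute)
  moreover have "0 \<notin> ?B" using e[of i i for i] \<nu>1 by (auto, metis inner_zero_left zero_neq_one)
  ultimately have "independent ?B" by (rule pairwise_orthogonal_independent)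
  then have span: "span ?B = UNIV"
    using card_eq_dim[of ?B UNIV] card_B by (auto simp: dim_UNIV)
  define z where "z = x - ((\<Sum>i\<in>UNIV. (x \<bullet> e i) *\<^sub>R e i) + (x \<bullet> \<nu>) *\<^sub>R \<nu>)"
  have "z \<bullet> e j = 0" for j
  proof -
    have "(\<Sum>i\<in>UNIV. (x \<bullet> e i) * (e i \<bullet> e j)) = (\<Sum>i\<in>UNIV. if i = j then x \<bullet> e j else 0)"
      by (rule sum.cong) (auto simp: e)
    moreover have "\<nu> \<bullet> e j = 0" using \<nu>(1)[of j] by (simp add: inner_commute)
    ultimately show ?thesis
      unfolding z_def by (simp add: inner_diff_left inner_add_left inner_sum_left)
  qed
  moreover have "z \<bullet> \<nu> = 0"
    unfolding z_def using \<nu>1 \<nu>(1) by (simp add: inner_diff_left inner_add_left inner_sum_left)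
  ultimately have "\<forall>b\<in>?B. orthogonal z b" by (auto simp: orthogonal_def)
  then have "orthogonal z z"
    by (intro orthogonal_to_span[of z ?B z]) (auto simp: span)
  then show ?thesis unfolding z_def by (simp add: orthogonal_def)
qed

lemma sum_axis_inner_orthonormal:
  fixes e :: "'n::finite \<Rightarrow> real^'m::finite" and \<nu> :: "real^'m" and D E :: "real^'m \<Rightarrow> real^'k::finite"
  assumes card: "CARD('m) = Suc CARD('n)"
    and e: "\<And>i j. e i \<bullet> e j = (if i = j then 1 else 0)"
    and \<nu>: "\<And>i. e i \<bullet> \<nu> = 0" "norm \<nu> = 1"
    and lin: "linear D" "linear E" and "D \<nu> = 0"
  shows "(\<Sum>a\<in>UNIV. D (axis a 1) \<bullet> E (axis a 1)) = (\<Sum>i\<in>UNIV. D (e i) \<bullet> E (e i))"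
proof -
  have D: "D x = (\<Sum>i\<in>UNIV. (x \<bullet> e i) *\<^sub>R D (e i))" for x
  proof -
    have "D x = D ((\<Sum>i\<in>UNIV. (x \<bullet> e i) *\<^sub>R e i) + (x \<bullet> \<nu>) *\<^sub>R \<nu>)"
      using orthonormal_expansion[OF card e \<nu>] by (rule arg_cong)
    then show ?thesis using \<open>D \<nu> = 0\<close> lin(1) by (simp add: linear_add linear_sum linear_scale)
  qed
  have E: "(\<Sum>a\<in>UNIV. (axis a 1 \<bullet> w) *\<^sub>R E (axis a 1)) = E w" for w
  proof -
    have "w = (\<Sum>a\<in>UNIV. (axis a 1 \<bullet> w) *\<^sub>R axis a 1)"
      using basis_expansion[of w] by (simp add: inner_axis' scalar_mult_eq_scaleR)
    then have "E w = E (\<Sum>a\<in>UNIV. (axis a 1 \<bullet> w) *\<^sub>R axis a 1)" by simp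
    then show ?thesis using lin(2) by (simp add: linear_sum linear_scale)
  qed
  have "(\<Sum>a\<in>UNIV. D (axis a 1) \<bullet> E (axis a 1))
      = (\<Sum>a\<in>UNIV. \<Sum>i\<in>UNIV. (axis a 1 \<bullet> e i) * (D (e i) \<bullet> E (axis a 1)))"
    by (subst D) (simp add: inner_sum_left)
  also have "\<dots> = (\<Sum>i\<in>UNIV. D (e i) \<bullet> (\<Sum>a\<in>UNIV. (axis a 1 \<bullet> e i) *\<^sub>R E (axis a 1)))"
    by (subst sum.swap) (simp add: inner_sum_right)
  finally show ?thesis unfolding E .
qed

lemma trace_orthonormal:
  fixes e :: "'n::finite \<Rightarrow> real^'m::finite" and \<nu> :: "real^'m" and D :: "real^'m \<Rightarrow> real^'m"
  assumes "CARD('m) = Suc CARD('n)"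
    and "\<And>i j. e i \<bullet> e j = (if i = j then 1 else 0)"
    and "\<And>i. e i \<bullet> \<nu> = 0" "norm \<nu> = 1"
    and "linear D" and "D \<nu> = 0"
  shows "(\<Sum>a\<in>UNIV. D (axis a 1) $ a) = (\<Sum>i\<in>UNIV. D (e i) \<bullet> e i)"
  using sum_axis_inner_orthonormal[OF assms(1-5) linear_id assms(6)] by (simp add: inner_axis)


section \<open>Charts\<close>

abbreviation par :: "('p, 'n::finite) chart \<Rightarrow> real^'n \<Rightarrow> 'p" where
  "par c \<equiv> inv_into (fst c) (snd c)"

abbreviation img :: "('p, 'n::finite) chart \<Rightarrow> (real^'n) set" where
  "img c \<equiv> snd c ` fst c"

lemma in_chart_apply: "in_chart c f y = f (par c y)"
  by (simp add: in_chart_def)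

context immersed_hypersurface
begin

lemma chart:
  assumes "c \<in> A"
  shows "openin T (fst c)" "open (img c)"
    "homeomorphic_map (subtopology T (fst c)) (top_of_set (img c)) (snd c)"
  using manifold assms unfolding smooth_manifold_def by (cases c, force)+

lemma chart_topspace: "c \<in> A \<Longrightarrow> fst c \<subseteq> topspace T"
  using chart(1) openin_subset by blast

lemma chart_inj: "c \<in> A \<Longrightarrow> inj_on (snd c) (fst c)"
  using homeomorphic_imp_injective_map[OF chart(3)] chart_topspace
  by (metis inf.absorb_iff2 topspace_subtopology)

lemma par_chart [simp]: "c \<in> A \<Longrightarrow> p \<in> fst c \<Longrightarrow> par c (snd c p) = p"
  by (simp add: chart_inj)

lemma chart_par [simp]: "y \<in> img c \<Longrightarrow> snd c (par c y) = y"
  by (rule f_inv_into_f)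

lemma par_in: "y \<in> img c \<Longrightarrow> par c y \<in> fst c"
  by (rule inv_into_into)

lemma chart_cover: "p \<in> topspace T \<Longrightarrow> \<exists>c\<in>A. p \<in> fst c"
  using manifold unfolding smooth_manifold_def by force

lemma Hausdorff: "Hausdorff_space T"
  using manifold unfolding smooth_manifold_def by blast

lemma chart_continuous:
  assumes "c \<in> A" shows "continuous_map (subtopology T (fst c)) (top_of_set (img c)) (snd c)"
  by (rule homeomorphic_imp_continuous_map[OF chart(3)[OF assms]])

lemma par_continuous:
  assumes "c \<in> A" shows "continuous_map (top_of_set (img c)) T (par c)"
proof -
  obtain g where g: "homeomorphic_maps (subtopology T (fst c)) (top_of_set (img c)) (snd c) g"
    using chart(3)[OF assms] by (auto simp: homeomorphic_map_maps)
  have "continuous_map (top_of_set (img c)) (subtopology T (fst c)) (par c)"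
  proof (rule continuous_map_eq)
    show "continuous_map (top_of_set (img c)) (subtopology T (fst c)) g"
      using g by (simp add: homeomorphic_maps_def)
    fix y assume "y \<in> topspace (top_of_set (img c))"
    then have y: "y \<in> img c" by simp
    from g have "g y \<in> fst c" "snd c (g y) = y"
      using y chart_topspace[OF assms]
      by (auto simp: homeomorphic_maps_def continuous_map_def)
    then show "g y = par c y" using par_chart[OF assms] by metis
  qed
  then show ?thesis by (simp add: continuous_map_in_subtopology)
qed

lemma open_chart_image:
  assumes "c \<in> A" "openin T Q" shows "open (snd c ` (Q \<inter> fst c))"
proof -
  have "openin (subtopology T (fst c)) (Q \<inter> fst c)"
    using assms(2) by (rule openin_subtopology_Int)
  then have "openin (top_of_set (img c)) (snd c ` (Q \<inter> fst c))"
    using homeomorphic_imp_open_map[OF chart(3)[OF assms(1)]] by (auto simp: open_map_def)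
  then show ?thesis using chart(2)[OF assms(1)] by (metis openin_open_eq)
qed

lemma open_par_image:
  assumes "c \<in> A" "open W" "W \<subseteq> img c" shows "openin T (par c ` W)"
proof -
  have "openin (subtopology T (fst c)) {p \<in> topspace (subtopology T (fst c)). snd c p \<in> W}"
    by (rule openin_continuous_map_preimage[OF chart_continuous[OF assms(1)]])
       (metis assms(2,3) Int_absorb1 openin_open)
  moreover have "{p \<in> topspace (subtopology T (fst c)). snd c p \<in> W} = par c ` W"
  proof -
    show ?thesis
    proof (intro equalityI subsetI)
      fix p assume "p \<in> {p \<in> topspace (subtopology T (fst c)). snd c p \<in> W}"
      then have "p \<in> fst c" "snd c p \<in> W" by simp_all
      then show "p \<in> par c ` W"
        using imageI[of "snd c p" W "par c"] assms(1) by simp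
    next
      fix p assume "p \<in> par c ` W"
      then obtain y where y: "y \<in> W" "p = par c y" by (rule imageE)
      have "y \<in> img c" by (rule subsetD[OF assms(3) y(1)])
      then show "p \<in> {p \<in> topspace (subtopology T (fst c)). snd c p \<in> W}"
        using y par_in[of y c] chart_topspace[OF assms(1)] by (simp add: subsetD)
    qed
  qed
  ultimately show ?thesis using chart(1)[OF assms(1)] by (metis openin_trans_full)
qed

lemma continuous_map_in_chart:
  assumes "continuous_map T euclidean f" "c \<in> A"
  shows "continuous_on (img c) (in_chart c f)"
  using continuous_map_compose[OF par_continuous[OF assms(2)] assms(1)]
  by (simp add: in_chart_def)

lemma continuous_map_local:
  fixes f :: "'p \<Rightarrow> 'b::topological_space"
  assumes "\<And>p. p \<in> topspace T \<Longrightarrow> \<exists>c\<in>A. \<exists>W. open W \<and> W \<subseteq> img c \<and> p \<in> fst c \<and> snd c p \<in> W \<and>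
     continuous_on W (in_chart c f)"
  shows "continuous_map T euclidean f"
proof (rule continuous_map_openin_preimage_eq[THEN iffD2], intro conjI allI impI)
  show "f \<in> topspace T \<rightarrow> topspace euclidean" by simp
  fix G :: "'b set" assume "openin euclidean G"
  then have G: "open G" by simp
  show "openin T (topspace T \<inter> f -` G)"
  proof (subst openin_subopen, rule ballI)
    fix p assume p: "p \<in> topspace T \<inter> f -` G"
    then obtain c W where c: "c \<in> A" and W: "open W" "W \<subseteq> img c" "p \<in> fst c" "snd c p \<in> W"
      and f: "continuous_on W (in_chart c f)" using assms by blast
    let ?W = "W \<inter> in_chart c f -` G"
    have o: "open ?W" using continuous_on_open_vimage[OF W(1)] f G by (metis inf_commute)
    have "openin T (par c ` ?W)" using o W(2) by (intro open_par_image[OF c]) auto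
    moreover have "p \<in> par c ` ?W"
      using p c W by (intro image_eqI[of _ _ "snd c p"]) (auto simp: in_chart_apply)
    moreover have "par c ` ?W \<subseteq> topspace T \<inter> f -` G"
      using W(2) chart_topspace[OF c] par_in[of _ c] by (auto simp: in_chart_apply)
    ultimately show "\<exists>Q. openin T Q \<and> p \<in> Q \<and> Q \<subseteq> topspace T \<inter> f -` G" by blast
  qed
qed


section \<open>Maps of class \<open>C\<^sup>1\<close> and tangential derivatives\<close>

definition C1M :: "('p \<Rightarrow> 'b::real_normed_vector) \<Rightarrow> bool" where
  "C1M f \<longleftrightarrow> (\<forall>c\<in>A. C1_on (img c) (in_chart c f))"

text \<open>The derivative of a map on the hypersurface, extended to the ambient space by zero on the
  normal line. Unlike the derivatives in charts it does not refer to coordinates, and its trace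
  is the divergence.\<close>

definition tder :: "('p \<Rightarrow> 'b::real_normed_vector) \<Rightarrow> (real^'m \<Rightarrow> 'b) \<Rightarrow> 'p \<Rightarrow> bool" where
  "tder f D p \<longleftrightarrow> bounded_linear D \<and> D (N p) = 0 \<and>
     (\<forall>c\<in>A. p \<in> fst c \<longrightarrow>
        (in_chart c f has_derivative (\<lambda>u. D (differential c X p u))) (at (snd c p)))"

lemma C1M_X: "C1M X"
  unfolding C1M_def
proof
  fix c assume "c \<in> A"
  with smooth_X have "smooth_on (img c) (in_chart c X)"
    unfolding smooth_map_def by (simp add: case_prod_beta)
  then show "C1_on (img c) (in_chart c X)" by (rule smooth_on_C1)
qed

lemma C1M_N: "C1M N"
  unfolding C1M_def
proof
  fix c assume "c \<in> A"
  with smooth_N have "smooth_on (img c) (in_chart c N)"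
    unfolding smooth_map_def by (simp add: case_prod_beta)
  then show "C1_on (img c) (in_chart c N)" by (rule smooth_on_C1)
qed

lemma C1_dX: "c \<in> A \<Longrightarrow> C1_on (img c) (\<lambda>y. frechet_derivative (in_chart c X) (at y) u)"
  using smooth_X unfolding smooth_map_def by (intro smooth_on_C1(2)) (simp add: case_prod_beta)

lemma C1_dN: "c \<in> A \<Longrightarrow> C1_on (img c) (\<lambda>y. frechet_derivative (in_chart c N) (at y) u)"
  using smooth_N unfolding smooth_map_def by (intro smooth_on_C1(2)) (simp add: case_prod_beta)

lemma C1MD: "C1M f \<Longrightarrow> c \<in> A \<Longrightarrow> C1_on (img c) (in_chart c f)"
  by (simp add: C1M_def)

lemma has_derivative_X:
  assumes "c \<in> A" "p \<in> fst c"
  shows "(in_chart c X has_derivative differential c X p) (at (snd c p))"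
  unfolding differential_def by (rule C1_onD(1)[OF C1MD[OF C1M_X assms(1)]]) (use assms in auto)

lemma differential_injective: "c \<in> A \<Longrightarrow> p \<in> fst c \<Longrightarrow> inj (differential c X p)"
  using immersion[of "fst c" "snd c"] by simp

lemma differential_normal: "c \<in> A \<Longrightarrow> p \<in> fst c \<Longrightarrow> differential c X p u \<bullet> N p = 0"
  using normal_N[of "fst c" "snd c"] by simp

lemma transition:
  assumes "c \<in> A" "c' \<in> A"
  shows "open (snd c' ` (fst c' \<inter> fst c))" "C1_on (snd c' ` (fst c' \<inter> fst c)) (in_chart c' (snd c))"
proof -
  show "open (snd c' ` (fst c' \<inter> fst c))"
    using open_chart_image[OF assms(2) chart(1)[OF assms(1)]] by (simp add: Int_commute)
  have "smooth_on (snd c' ` (fst c' \<inter> fst c)) (in_chart c' (snd c))"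
  proof -
    have "\<forall>c\<in>A. \<forall>d\<in>A. smooth_on (snd c ` (fst c \<inter> fst d)) (in_chart c (snd d))"
      using manifold unfolding smooth_manifold_def case_prod_beta prod.collapse by blast
    then show ?thesis using assms by blast
  qed
  then show "C1_on (snd c' ` (fst c' \<inter> fst c)) (in_chart c' (snd c))" by (rule smooth_on_C1)
qed

lemma in_chart_transition:
  assumes "c \<in> A" "c' \<in> A" "y \<in> snd c' ` (fst c' \<inter> fst c)"
  shows "in_chart c' f y = in_chart c f (in_chart c' (snd c) y)"
proof -
  have "par c' y \<in> fst c" using assms par_chart[OF assms(2)] by auto
  then show ?thesis using assms(1) by (simp add: in_chart_apply)
qed

lemma has_derivative_transition:
  assumes c: "c \<in> A" "c' \<in> A" and p: "p \<in> fst c" "p \<in> fst c'"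
    and f: "(in_chart c f has_derivative D) (at (snd c p))"
  shows "(in_chart c' f has_derivative (\<lambda>u. D (frechet_derivative (in_chart c' (snd c)) (at (snd c' p)) u)))
     (at (snd c' p))"
proof -
  let ?O = "snd c' ` (fst c' \<inter> fst c)"
  have pO: "snd c' p \<in> ?O" using p by blast
  have tp: "in_chart c' (snd c) (snd c' p) = snd c p" using c p by (simp add: in_chart_apply)
  have "((in_chart c f \<circ> in_chart c' (snd c)) has_derivative
      (D \<circ> frechet_derivative (in_chart c' (snd c)) (at (snd c' p)))) (at (snd c' p))"
    by (rule diff_chain_at[OF C1_onD(1)[OF transition(2)[OF c] pO]]) (use f tp in simp)
  then have "((in_chart c f \<circ> in_chart c' (snd c)) has_derivative
     (\<lambda>u. D (frechet_derivative (in_chart c' (snd c)) (at (snd c' p)) u))) (at (snd c' p))"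
    by (simp add: o_def)
  then show ?thesis
    by (rule has_derivative_transform_within_open[OF _ transition(1)[OF c] pO])
       (unfold comp_apply, rule in_chart_transition[OF c, symmetric])
qed

lemma differential_transition:
  assumes c: "c \<in> A" "c' \<in> A" and p: "p \<in> fst c" "p \<in> fst c'"
  shows "differential c' X p u
     = differential c X p (frechet_derivative (in_chart c' (snd c)) (at (snd c' p)) u)"
  using has_derivative_unique[OF has_derivative_transition[OF c p has_derivative_X[OF c(1) p(1)]]
      has_derivative_X[OF c(2) p(2)]]
  by (simp add: fun_eq_iff)

text \<open>One chart suffices, by the chain rule for the transition maps.\<close>

lemma tderI:
  assumes c: "c \<in> A" "p \<in> fst c" and D: "bounded_linear D" "D (N p) = 0"
    and f: "(in_chart c f has_derivative (\<lambda>u. D (differential c X p u))) (at (snd c p))"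
  shows "tder f D p"
  unfolding tder_def
proof (intro conjI ballI impI D)
  fix c' assume c': "c' \<in> A" "p \<in> fst c'"
  show "(in_chart c' f has_derivative (\<lambda>u. D (differential c' X p u))) (at (snd c' p))"
    unfolding differential_transition[OF c(1) c'(1) c(2) c'(2)]
    by (rule has_derivative_transition[OF c(1) c'(1) c(2) c'(2) f])
qed

lemma tderD:
  assumes "tder f D p"
  shows "bounded_linear D" "linear D" "D (N p) = 0"
    "c \<in> A \<Longrightarrow> p \<in> fst c \<Longrightarrow> (in_chart c f has_derivative (\<lambda>u. D (differential c X p u))) (at (snd c p))"
  using assms unfolding tder_def by (auto intro: bounded_linear.linear)

text \<open>Smooth orthonormal frames express the coordinates of a tangential field as inner products.\<close>

definition framed :: "('p, 'n) chart \<Rightarrow> (real^'n) set \<Rightarrow> ('n \<Rightarrow> real^'n \<Rightarrow> real^'n) \<Rightarrow> bool" where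
  "framed c W v \<longleftrightarrow> c \<in> A \<and> open W \<and> W \<subseteq> img c \<and> orthonormal_frame (in_chart c X) W v"

lemma framed_props:
  assumes "framed c W v"
  shows "c \<in> A" "open W" "W \<subseteq> img c" "C1_on W (v i)"
  using assms unfolding framed_def orthonormal_frame_def by (auto intro: smooth_on_C1(1))

lemma frame_at:
  assumes W: "framed c W v" and p: "p \<in> fst c" "snd c p \<in> W"
  defines "e \<equiv> \<lambda>i. differential c X p (v i (snd c p))"
  shows "e i \<bullet> e j = (if i = j then 1 else 0)" "e i \<bullet> N p = 0" "norm (N p) = 1"
proof -
  show "e i \<bullet> e j = (if i = j then 1 else 0)"
    using W p unfolding framed_def orthonormal_frame_def e_def push_field_def differential_def by blast
  show "e i \<bullet> N p = 0" unfolding e_def using framed_props(1)[OF W] p(1) by (rule differential_normal)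
  show "norm (N p) = 1" using unit_N chart_topspace[OF framed_props(1)[OF W]] p(1) by blast
qed

lemma frame_expansion:
  assumes "framed c W v" "p \<in> fst c" "snd c p \<in> W"
  shows "x = (\<Sum>i\<in>UNIV. (x \<bullet> differential c X p (v i (snd c p))) *\<^sub>R differential c X p (v i (snd c p)))
     + (x \<bullet> N p) *\<^sub>R N p"
  by (rule orthonormal_expansion[OF codim_one frame_at(1)[OF assms] frame_at(2,3)[OF assms]])

lemma frame_trace:
  assumes "framed c W v" "p \<in> fst c" "snd c p \<in> W" and "linear D" "D (N p) = 0"
  shows "(\<Sum>a\<in>UNIV. D (axis a 1) $ a)
     = (\<Sum>i\<in>UNIV. D (differential c X p (v i (snd c p))) \<bullet> differential c X p (v i (snd c p)))"
  by (rule trace_orthonormal[OF codim_one frame_at(1)[OF assms(1-3)] frame_at(2,3)[OF assms(1-3)] assms(4,5)])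

lemma frame_sum_inner:
  fixes D E :: "real^'m \<Rightarrow> real^'k::finite"
  assumes "framed c W v" "p \<in> fst c" "snd c p \<in> W" and "linear D" "linear E" "D (N p) = 0"
  shows "(\<Sum>a\<in>UNIV. D (axis a 1) \<bullet> E (axis a 1))
     = (\<Sum>i\<in>UNIV. D (differential c X p (v i (snd c p))) \<bullet> E (differential c X p (v i (snd c p))))"
  by (rule sum_axis_inner_orthonormal[OF codim_one frame_at(1)[OF assms(1-3)] frame_at(2,3)[OF assms(1-3)] assms(4-6)])

text \<open>The expansion of the image of \<open>u\<close> in the frame, pulled back by injectivity of the differential.\<close>

lemma frame_coordinates:
  assumes W: "framed c W v" and p: "p \<in> fst c" "snd c p \<in> W"
  shows "u = (\<Sum>i\<in>UNIV. (differential c X p u \<bullet> differential c X p (v i (snd c p))) *\<^sub>R v i (snd c p))"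
proof -
  note c = framed_props(1)[OF W]
  have lin: "linear (differential c X p)"
    using has_derivative_linear[OF has_derivative_X[OF c p(1)]] .
  have "differential c X p u = differential c X p
      (\<Sum>i\<in>UNIV. (differential c X p u \<bullet> differential c X p (v i (snd c p))) *\<^sub>R v i (snd c p))"
    using frame_expansion[OF W p, of "differential c X p u"] differential_normal[OF c p(1), of u]
    by (simp add: linear_sum[OF lin] linear_scale[OF lin])
  then show ?thesis using differential_injective[OF c p(1)] by (meson injD)
qed

end

text \<open>Near every point at which a mean curvature is defined there is an orthonormal frame; this is
  the structure on which the calculus below is built.\<close>

locale framed_hypersurface = immersed_hypersurface T A X N
  for T :: "'p topology" and A :: "('p, 'n::finite) chart set" and X N :: "'p \<Rightarrow> real ^ 'm::finite" +
  assumes frames: "p \<in> topspace T \<Longrightarrow> \<exists>c W v. framed c W v \<and> p \<in> fst c \<and> snd c p \<in> W"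
begin

lemma frame_obtain:
  assumes "p \<in> topspace T"
  obtains c W v where "framed c W v" "c \<in> A" "p \<in> fst c" "snd c p \<in> W"
  using frames[OF assms] framed_props(1) by blast

lemma tangent_decomposition:
  assumes W: "framed c W v" and p: "p \<in> fst c" "snd c p \<in> W"
  shows "\<exists>u. x = differential c X p u + (x \<bullet> N p) *\<^sub>R N p"
proof -
  have lin: "linear (differential c X p)"
    by (rule has_derivative_linear[OF has_derivative_X[OF framed_props(1)[OF W] p(1)]])
  show ?thesis
    using frame_expansion[OF W p, of x]
    by (intro exI[of _ "\<Sum>i\<in>UNIV. (x \<bullet> differential c X p (v i (snd c p))) *\<^sub>R v i (snd c p)"])
       (simp add: linear_sum[OF lin] linear_scale[OF lin])
qed

lemma tder_unique:
  assumes p: "p \<in> topspace T" and D: "tder f D p" "tder f D' p"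
  shows "D = D'"
proof
  fix x
  obtain c W v where W: "framed c W v" "c \<in> A" "p \<in> fst c" "snd c p \<in> W"
    using frame_obtain[OF p] .
  obtain u where u: "x = differential c X p u + (x \<bullet> N p) *\<^sub>R N p"
    using tangent_decomposition[OF W(1,3,4)] by blast
  have "D (differential c X p u) = D' (differential c X p u)"
    using has_derivative_unique[OF tderD(4)[OF D(1) W(2,3)] tderD(4)[OF D(2) W(2,3)]]
    by (simp add: fun_eq_iff)
  then have "D (differential c X p u + (x \<bullet> N p) *\<^sub>R N p) = D' (differential c X p u + (x \<bullet> N p) *\<^sub>R N p)"
    using tderD(2,3)[OF D(1)] tderD(2,3)[OF D(2)] by (simp add: linear_add linear_scale)
  then show "D x = D' x" using u by metis
qed

lemma tder_exists:
  assumes f: "C1M f" and p: "p \<in> topspace T"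
  shows "\<exists>D. tder f D p"
proof -
  obtain c W v where W: "framed c W v" "c \<in> A" "p \<in> fst c" "snd c p \<in> W"
    using frame_obtain[OF p] .
  define e where "e = (\<lambda>i. differential c X p (v i (snd c p)))"
  define f' where "f' = frechet_derivative (in_chart c f) (at (snd c p))"
  have df: "(in_chart c f has_derivative f') (at (snd c p))"
    unfolding f'_def by (rule C1_onD(1)[OF C1MD[OF f W(2)]]) (use W in auto)
  have lin: "linear f'" by (rule has_derivative_linear[OF df])
  let ?D = "\<lambda>x. \<Sum>i\<in>UNIV. (x \<bullet> e i) *\<^sub>R f' (v i (snd c p))"
  have "tder f ?D p"
  proof (rule tderI[OF W(2,3)])
    show "bounded_linear ?D"
      by (intro bounded_linear_sum bounded_linear_scaleR_left[THEN bounded_linear_compose]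
          bounded_linear_inner_left)
    show "?D (N p) = 0"
      using frame_at(2)[OF W(1,3,4)] by (simp add: e_def inner_commute)
    have "?D (differential c X p u) = f' u" for u
      by (subst (2) frame_coordinates[OF W(1,3,4), of u])
         (simp add: linear_sum[OF lin] linear_scale[OF lin] e_def)
    then show "(in_chart c f has_derivative (\<lambda>u. ?D (differential c X p u))) (at (snd c p))"
      using df by simp
  qed
  then show ?thesis by blast
qed

definition tderiv :: "('p \<Rightarrow> 'b::real_normed_vector) \<Rightarrow> 'p \<Rightarrow> real^'m \<Rightarrow> 'b" where
  "tderiv f p = (SOME D. tder f D p)"

lemma tder_tderiv: "C1M f \<Longrightarrow> p \<in> topspace T \<Longrightarrow> tder f (tderiv f p) p"
  unfolding tderiv_def using tder_exists by (rule someI_ex)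

lemma tderiv_eq: "tder f D p \<Longrightarrow> p \<in> topspace T \<Longrightarrow> tderiv f p = D"
  unfolding tderiv_def using tder_unique by blast

lemma tderiv_chart:
  assumes "C1M f" "c \<in> A" "p \<in> fst c"
  shows "tderiv f p (differential c X p u) = differential c f p u"
proof -
  have "p \<in> topspace T" using chart_topspace assms by blast
  from tderD(4)[OF tder_tderiv[OF assms(1) this] assms(2,3)]
  show ?thesis unfolding differential_def by (metis frechet_derivative_at)
qed


subsection \<open>Rules of differentiation\<close>

lemma tder_cong:
  assumes "tder f D p" "\<And>q. q \<in> topspace T \<Longrightarrow> f q = g q"
  shows "tder g D p"
  unfolding tder_def
proof (intro conjI ballI impI tderD(1,3)[OF assms(1)])
  fix c assume c: "c \<in> A" "p \<in> fst c"
  show "(in_chart c g has_derivative (\<lambda>u. D (differential c X p u))) (at (snd c p))"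
  proof (rule has_derivative_transform_within_open[OF tderD(4)[OF assms(1) c] chart(2)[OF c(1)]])
    show "in_chart c f y = in_chart c g y" if "y \<in> img c" for y
      using assms(2) par_in[OF that] chart_topspace[OF c(1)] by (auto simp: in_chart_apply)
  qed (use c in auto)
qed

lemma tder_cong_open:
  assumes "tder f D p" "openin T Q" "p \<in> Q" "\<And>q. q \<in> Q \<Longrightarrow> f q = g q"
  shows "tder g D p"
  unfolding tder_def
proof (intro conjI ballI impI tderD(1,3)[OF assms(1)])
  fix c assume c: "c \<in> A" "p \<in> fst c"
  show "(in_chart c g has_derivative (\<lambda>u. D (differential c X p u))) (at (snd c p))"
  proof (rule has_derivative_transform_within_open[OF tderD(4)[OF assms(1) c] open_chart_image[OF c(1) assms(2)]])
    show "in_chart c f y = in_chart c g y" if "y \<in> snd c ` (Q \<inter> fst c)" for y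
      using that assms(4) c by (auto simp: in_chart_apply)
  qed (use c assms(3) in auto)
qed

lemma tder_const: "tder (\<lambda>q. a) (\<lambda>x. 0) p"
  unfolding tder_def by (simp add: in_chart_def o_def)

lemma tder_add:
  assumes "tder f D p" "tder g E p" shows "tder (\<lambda>q. f q + g q) (\<lambda>x. D x + E x) p"
  unfolding tder_def
proof (intro conjI ballI impI)
  show "bounded_linear (\<lambda>x. D x + E x)" by (intro bounded_linear_add tderD[OF assms(1)] tderD[OF assms(2)])
  show "D (N p) + E (N p) = 0" using tderD(3)[OF assms(1)] tderD(3)[OF assms(2)] by simp
  show "(in_chart c (\<lambda>q. f q + g q) has_derivative (\<lambda>u. D (differential c X p u) + E (differential c X p u))) (at (snd c p))"
    if "c \<in> A" "p \<in> fst c" for c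
    using has_derivative_add[OF tderD(4)[OF assms(1) that] tderD(4)[OF assms(2) that]]
    by (simp add: in_chart_def o_def)
qed

lemma tder_linear:
  assumes "bounded_linear h" "tder f D p" shows "tder (\<lambda>q. h (f q)) (\<lambda>x. h (D x)) p"
  unfolding tder_def
proof (intro conjI ballI impI)
  show "bounded_linear (\<lambda>x. h (D x))"
    by (rule bounded_linear_compose[OF assms(1) tderD(1)[OF assms(2)]])
  show "h (D (N p)) = 0" using tderD(3)[OF assms(2)] linear_0[OF bounded_linear.linear[OF assms(1)]] by simp
  show "(in_chart c (\<lambda>q. h (f q)) has_derivative (\<lambda>u. h (D (differential c X p u)))) (at (snd c p))"
    if "c \<in> A" "p \<in> fst c" for c
    using bounded_linear.has_derivative[OF assms(1) tderD(4)[OF assms(2) that]]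
    by (simp add: in_chart_def o_def)
qed

lemma tder_minus: "tder f D p \<Longrightarrow> tder (\<lambda>q. - f q) (\<lambda>x. - D x) p"
  by (rule tder_linear[OF bounded_linear_minus[OF bounded_linear_ident]])

lemma tder_diff: "tder f D p \<Longrightarrow> tder g E p \<Longrightarrow> tder (\<lambda>q. f q - g q) (\<lambda>x. D x - E x) p"
  using tder_add[OF _ tder_minus] by fastforce

lemma tder_bilinear:
  assumes h: "bounded_bilinear h" and f: "tder f D p" "tder g E p"
  shows "tder (\<lambda>q. h (f q) (g q)) (\<lambda>x. h (f p) (E x) + h (D x) (g p)) p"
  unfolding tder_def
proof (intro conjI ballI impI)
  show "bounded_linear (\<lambda>x. h (f p) (E x) + h (D x) (g p))"
    by (intro bounded_linear_add bounded_linear_compose[OF bounded_bilinear.bounded_linear_right[OF h] tderD(1)[OF f(2)]]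
        bounded_linear_compose[OF bounded_bilinear.bounded_linear_left[OF h] tderD(1)[OF f(1)]])
  show "h (f p) (E (N p)) + h (D (N p)) (g p) = 0"
    using tderD(3)[OF f(1)] tderD(3)[OF f(2)] bounded_bilinear.zero_left[OF h] bounded_bilinear.zero_right[OF h] by simp
  show "(in_chart c (\<lambda>q. h (f q) (g q)) has_derivative
      (\<lambda>u. h (f p) (E (differential c X p u)) + h (D (differential c X p u)) (g p))) (at (snd c p))"
    if "c \<in> A" "p \<in> fst c" for c
    using bounded_bilinear.FDERIV[OF h tderD(4)[OF f(1) that] tderD(4)[OF f(2) that]] that
    by (simp add: in_chart_def o_def)
qed

lemmas tder_scaleR = tder_bilinear[OF bounded_bilinear_scaleR]
  and tder_inner = tder_bilinear[OF bounded_bilinear_inner]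
  and tder_mult = tder_bilinear[OF bounded_bilinear_mult]

lemma tder_compose:
  assumes h: "(h has_derivative h') (at (f p))" and f: "tder f D p"
  shows "tder (\<lambda>q. h (f q)) (\<lambda>x. h' (D x)) p"
  unfolding tder_def
proof (intro conjI ballI impI)
  show "bounded_linear (\<lambda>x. h' (D x))"
    by (rule bounded_linear_compose[OF has_derivative_bounded_linear[OF h] tderD(1)[OF f]])
  show "h' (D (N p)) = 0" using tderD(3)[OF f] linear_0[OF has_derivative_linear[OF h]] by simp
  fix c assume c: "c \<in> A" "p \<in> fst c"
  have "((h \<circ> in_chart c f) has_derivative (h' \<circ> (\<lambda>u. D (differential c X p u)))) (at (snd c p))"
    by (rule diff_chain_at[OF tderD(4)[OF f c]]) (use h c in \<open>simp add: in_chart_apply\<close>)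
  then show "(in_chart c (\<lambda>q. h (f q)) has_derivative (\<lambda>u. h' (D (differential c X p u)))) (at (snd c p))"
    by (simp add: in_chart_def o_def)
qed

lemma tder_real_compose:
  fixes h :: "real \<Rightarrow> real"
  assumes "(h has_real_derivative h') (at (f p))" "tder f D p"
  shows "tder (\<lambda>q. h (f q)) (\<lambda>x. h' * D x) p"
  using tder_compose[OF assms(1)[unfolded has_field_derivative_def] assms(2)] .

lemma C1M_const: "C1M (\<lambda>q. a)"
  unfolding C1M_def by (simp add: in_chart_def o_def)

lemma C1M_add: "C1M f \<Longrightarrow> C1M g \<Longrightarrow> C1M (\<lambda>q. f q + g q)"
  unfolding C1M_def in_chart_def o_def by (auto intro: C1_on_add)

lemma C1M_diff: "C1M f \<Longrightarrow> C1M g \<Longrightarrow> C1M (\<lambda>q. f q - g q)"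
  unfolding C1M_def in_chart_def o_def by (auto intro: C1_on_diff)

lemma C1M_sum: "(\<And>i. i \<in> I \<Longrightarrow> C1M (f i)) \<Longrightarrow> C1M (\<lambda>q. \<Sum>i\<in>I. f i q)"
  unfolding C1M_def in_chart_def o_def by (intro ballI C1_on_sum) blast

lemma C1M_bilinear: "bounded_bilinear h \<Longrightarrow> C1M f \<Longrightarrow> C1M g \<Longrightarrow> C1M (\<lambda>q. h (f q) (g q))"
  unfolding C1M_def in_chart_def o_def by (auto intro: C1_on_bilinear)

lemmas C1M_scaleR = C1M_bilinear[OF bounded_bilinear_scaleR]
  and C1M_inner = C1M_bilinear[OF bounded_bilinear_inner]
  and C1M_mult = C1M_bilinear[OF bounded_bilinear_mult]

lemma C1M_divide:
  fixes f g :: "'p \<Rightarrow> real"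
  assumes "C1M f" "C1M g" "\<And>q. q \<in> topspace T \<Longrightarrow> g q \<noteq> 0"
  shows "C1M (\<lambda>q. f q / g q)"
  unfolding C1M_def
proof
  fix c assume c: "c \<in> A"
  have "C1_on (img c) (\<lambda>y. in_chart c f y / in_chart c g y)"
  proof (rule C1_on_divide)
    show "in_chart c g y \<noteq> 0" if "y \<in> img c" for y
      using assms(3) par_in[OF that] chart_topspace[OF c] by (auto simp: in_chart_apply)
  qed (use assms c in \<open>auto simp: C1M_def\<close>)
  then show "C1_on (img c) (in_chart c (\<lambda>q. f q / g q))" by (simp add: in_chart_def o_def)
qed

lemma C1M_truncated_power:
  fixes f :: "'p \<Rightarrow> real"
  shows "C1M f \<Longrightarrow> 2 \<le> k \<Longrightarrow> C1M (\<lambda>q. max 0 (f q) ^ k)"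
  unfolding C1M_def in_chart_def o_def by (auto intro: C1_on_truncated_power)

lemma C1M_local:
  assumes "\<And>p. p \<in> topspace T \<Longrightarrow> \<exists>c\<in>A. \<exists>W. open W \<and> W \<subseteq> img c \<and> p \<in> fst c \<and> snd c p \<in> W \<and>
     C1_on W (in_chart c f)"
  shows "C1M f"
  unfolding C1M_def
proof
  fix c' assume c': "c' \<in> A"
  show "C1_on (img c') (in_chart c' f)"
  proof (rule C1_on_local)
    fix y assume y: "y \<in> img c'"
    define p where "p = par c' y"
    have p: "p \<in> fst c'" "snd c' p = y" "p \<in> topspace T"
      unfolding p_def using y par_in[OF y] chart_topspace[OF c'] by auto
    obtain c W where c: "c \<in> A" and W: "open W" "W \<subseteq> img c" "p \<in> fst c" "snd c p \<in> W" "C1_on W (in_chart c f)"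
      using assms[OF p(3)] by blast
    let ?V = "snd c' ` (fst c' \<inter> fst c)"
    let ?t = "in_chart c' (snd c)"
    have o: "open ?V" "C1_on ?V ?t" using transition[OF c c'] by auto
    let ?O = "?V \<inter> ?t -` W"
    have oO: "open ?O"
      using continuous_on_open_vimage[OF o(1)] C1_on_continuous[OF o(2)] W(1) by (metis inf_commute)
    have yO: "y \<in> ?O" using p W(3,4) c' by (auto simp: in_chart_apply p_def[symmetric])
    have "C1_on ?O (\<lambda>z. in_chart c f (?t z))"
      by (rule C1_on_compose[OF W(5) C1_on_subset[OF o(2)]]) auto
    then have "C1_on ?O (in_chart c' f)"
      by (rule C1_on_cong[OF _ oO]) (rule in_chart_transition[OF c c', symmetric], blast)
    then show "\<exists>O'. open O' \<and> y \<in> O' \<and> C1_on O' (in_chart c' f)" using oO yO by blast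
  qed
qed

lemma C1M_continuous: "C1M f \<Longrightarrow> continuous_map T euclidean f"
  by (rule continuous_map_local) (metis C1MD C1_on_continuous chart(2) chart_cover image_eqI subset_refl)


subsection \<open>Divergence\<close>

definition tdiv :: "('p \<Rightarrow> real^'m) \<Rightarrow> 'p \<Rightarrow> real" where
  "tdiv V p = (\<Sum>a\<in>UNIV. tderiv V p (axis a 1) $ a)"

lemma tdiv_eq: "tder V D p \<Longrightarrow> p \<in> topspace T \<Longrightarrow> tdiv V p = (\<Sum>a\<in>UNIV. D (axis a 1) $ a)"
  unfolding tdiv_def by (simp add: tderiv_eq)

lemma tdiv_frame:
  assumes V: "C1M V" and W: "framed c W v" "p \<in> fst c" "snd c p \<in> W"
  shows "tdiv V p = (\<Sum>i\<in>UNIV. differential c V p (v i (snd c p)) \<bullet> differential c X p (v i (snd c p)))"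
proof -
  note c = framed_props(1)[OF W(1)]
  have p: "p \<in> topspace T" using chart_topspace[OF c] W by blast
  show ?thesis
    unfolding tdiv_def
    using frame_trace[OF W tderD(2,3)[OF tder_tderiv[OF V p]]] tderiv_chart[OF V c W(2)] by simp
qed

lemma tdiv_continuous:
  assumes V: "C1M V" shows "continuous_map T euclidean (tdiv V)"
proof (rule continuous_map_local)
  fix p assume "p \<in> topspace T"
  then obtain c W v where W: "framed c W v" "c \<in> A" "p \<in> fst c" "snd c p \<in> W"
    using frame_obtain by blast
  note fr = framed_props[OF W(1)]
  have "continuous_on W (\<lambda>y. \<Sum>i\<in>UNIV. frechet_derivative (in_chart c V) (at y) (v i y)
      \<bullet> frechet_derivative (in_chart c X) (at y) (v i y))"
    by (intro continuous_on_sum continuous_on_inner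
        C1_on_joint_continuous[OF C1_on_subset[OF C1MD[OF V W(2)] fr(3)] continuous_on_id]
        C1_on_joint_continuous[OF C1_on_subset[OF C1MD[OF C1M_X W(2)] fr(3)] continuous_on_id]
        C1_on_continuous[OF fr(4)]) auto
  moreover have "in_chart c (tdiv V) y = (\<Sum>i\<in>UNIV. frechet_derivative (in_chart c V) (at y) (v i y)
      \<bullet> frechet_derivative (in_chart c X) (at y) (v i y))" if "y \<in> W" for y
  proof -
    have y: "y \<in> img c" using that fr(3) by blast
    then show ?thesis
      using tdiv_frame[OF V W(1) par_in[OF y]] that
      by (simp add: in_chart_apply differential_def)
  qed
  ultimately have "continuous_on W (in_chart c (tdiv V))" by (simp cong: continuous_on_cong)
  then show "\<exists>c\<in>A. \<exists>W. open W \<and> W \<subseteq> img c \<and> p \<in> fst c \<and> snd c p \<in> W \<and> continuous_on W (in_chart c (tdiv V))"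
    using W fr by blast
qed

section \<open>The Weingarten map\<close>


definition shape :: "'p \<Rightarrow> real^'m \<Rightarrow> real^'m" where
  "shape p = tderiv N p"

lemma tder_N: "p \<in> topspace T \<Longrightarrow> tder N (shape p) p"
  unfolding shape_def by (rule tder_tderiv[OF C1M_N])

lemma shape_linear: "p \<in> topspace T \<Longrightarrow> linear (shape p)" and shape_N: "p \<in> topspace T \<Longrightarrow> shape p (N p) = 0"
  using tderD[OF tder_N] by blast+

lemma shape_chart: "c \<in> A \<Longrightarrow> p \<in> fst c \<Longrightarrow> shape p (differential c X p u) = differential c N p u"
  unfolding shape_def by (rule tderiv_chart[OF C1M_N])

lemma N_unit: "p \<in> topspace T \<Longrightarrow> N p \<bullet> N p = 1"
  using unit_N by (simp add: dot_square_norm)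

lemma shape_normal:
  assumes p: "p \<in> topspace T" shows "shape p x \<bullet> N p = 0"
proof -
  have "tder (\<lambda>q. N q \<bullet> N q) (\<lambda>x. N p \<bullet> shape p x + shape p x \<bullet> N p) p"
    by (intro tder_inner tder_N p)
  then have "tder (\<lambda>q. 1) (\<lambda>x. N p \<bullet> shape p x + shape p x \<bullet> N p) p"
    by (rule tder_cong) (rule N_unit)
  from tder_unique[OF p this tder_const] have "N p \<bullet> shape p x + shape p x \<bullet> N p = 0" by (simp add: fun_eq_iff)
  then show ?thesis by (simp add: inner_commute)
qed

lemma tder_X:
  assumes p: "p \<in> topspace T" shows "tder X (\<lambda>x. x - (x \<bullet> N p) *\<^sub>R N p) p"
proof -
  obtain c where c: "c \<in> A" "p \<in> fst c" using chart_cover[OF p] by blast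
  show ?thesis
  proof (rule tderI[OF c])
    show "bounded_linear (\<lambda>x. x - (x \<bullet> N p) *\<^sub>R N p)"
      by (intro bounded_linear_sub bounded_linear_ident
          bounded_linear_scaleR_left[THEN bounded_linear_compose] bounded_linear_inner_left)
    show "N p - (N p \<bullet> N p) *\<^sub>R N p = 0" using N_unit[OF p] by simp
    show "(in_chart c X has_derivative (\<lambda>u. differential c X p u - (differential c X p u \<bullet> N p) *\<^sub>R N p)) (at (snd c p))"
      using has_derivative_X[OF c] differential_normal[OF c] by simp
  qed
qed

text \<open>Differentiating \<open>dX(w) \<bullet> N = 0\<close> once more expresses the second fundamental form through
  second derivatives of the immersion, which are symmetric.\<close>

lemma second_fundamental_form:
  assumes c: "c \<in> A" "p \<in> fst c"
  shows "differential c N p u \<bullet> differential c X p w =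
    - (frechet_derivative (\<lambda>y. frechet_derivative (in_chart c X) (at y) w) (at (snd c p)) u \<bullet> N p)"
proof -
  let ?y = "snd c p"
  have y: "?y \<in> img c" using c by simp
  let ?g = "\<lambda>y. frechet_derivative (in_chart c X) (at y) w \<bullet> in_chart c N y"
  have 1: "(?g has_derivative (\<lambda>u. frechet_derivative (in_chart c X) (at ?y) w \<bullet> frechet_derivative (in_chart c N) (at ?y) u
      + frechet_derivative (\<lambda>y. frechet_derivative (in_chart c X) (at y) w) (at ?y) u \<bullet> in_chart c N ?y)) (at ?y)"
    by (intro has_derivative_inner C1_onD(1)[OF C1_dX[OF c(1)] y] C1_onD(1)[OF C1MD[OF C1M_N c(1)] y])
  have "(?g has_derivative (\<lambda>u. 0)) (at ?y)"
  proof (rule has_derivative_transform_within_open[OF has_derivative_const chart(2)[OF c(1)] y])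
    show "0 = ?g z" if "z \<in> img c" for z
      using differential_normal[OF c(1) par_in[OF that], of w] that
      by (simp add: differential_def in_chart_apply)
  qed
  from has_derivative_unique[OF 1 this]
  have "frechet_derivative (in_chart c X) (at ?y) w \<bullet> frechet_derivative (in_chart c N) (at ?y) u
      + frechet_derivative (\<lambda>y. frechet_derivative (in_chart c X) (at y) w) (at ?y) u \<bullet> in_chart c N ?y = 0"
    by (rule fun_cong)
  then show ?thesis using c by (simp add: differential_def in_chart_apply inner_commute)
qed

lemma shape_symmetric_chart:
  assumes c: "c \<in> A" "p \<in> fst c"
  shows "differential c N p u \<bullet> differential c X p w = differential c N p w \<bullet> differential c X p u"
proof -
  have "snd c p \<in> img c" using c by simp
  from second_derivative_symmetric[OF chart(2)[OF c(1)] this C1MD[OF C1M_X c(1)] C1_dX[OF c(1)]]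
  show ?thesis unfolding second_fundamental_form[OF c] by simp
qed

lemma shape_symmetric:
  assumes p: "p \<in> topspace T" shows "shape p x \<bullet> y = x \<bullet> shape p y"
proof -
  obtain c W v where W: "framed c W v" "c \<in> A" "p \<in> fst c" "snd c p \<in> W"
    using frame_obtain[OF p] .
  obtain u where u: "x = differential c X p u + (x \<bullet> N p) *\<^sub>R N p"
    using tangent_decomposition[OF W(1,3,4)] by blast
  obtain w where w: "y = differential c X p w + (y \<bullet> N p) *\<^sub>R N p"
    using tangent_decomposition[OF W(1,3,4)] by blast
  have shape: "shape p (differential c X p u + a *\<^sub>R N p) = differential c N p u" for u a
    using shape_linear[OF p] shape_N[OF p] shape_chart[OF W(2,3)] by (simp add: linear_add linear_scale)
  have nN: "differential c N p u \<bullet> N p = 0" for u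
    using shape_normal[OF p, of "differential c X p u"] unfolding shape_chart[OF W(2,3)] .
  have *: "shape p (differential c X p u + a *\<^sub>R N p) \<bullet> (differential c X p w + b *\<^sub>R N p)
     = (differential c X p u + a *\<^sub>R N p) \<bullet> shape p (differential c X p w + b *\<^sub>R N p)" for a b
    using shape_symmetric_chart[OF W(2,3), of u w] nN[of u] nN[of w]
    by (simp only: shape inner_add_right inner_add_left inner_scaleR_left inner_scaleR_right
        inner_commute[of "N p"] inner_commute[of "differential c X p u"] mult_zero_right add_0_right)
  from *[of "x \<bullet> N p" "y \<bullet> N p"] show ?thesis unfolding u[symmetric] w[symmetric] .
qed


subsection \<open>Codazzi\<close>

lemma C1_push_field:
  assumes W: "framed c W v"
  shows "C1_on W (\<lambda>y. frechet_derivative (in_chart c X) (at y) (v i y))"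
  by (rule C1_on_derivative_field[OF
        C1_on_subset[OF C1MD[OF C1M_X framed_props(1)[OF W]] framed_props(3)[OF W]]
        C1_on_subset[OF C1_dX[OF framed_props(1)[OF W]] framed_props(3)[OF W]]
        framed_props(4)[OF W] framed_props(2)[OF W]])

definition tangential :: "('p \<Rightarrow> real^'m) \<Rightarrow> bool" where
  "tangential V \<longleftrightarrow> (\<forall>q\<in>topspace T. V q \<bullet> N q = 0)"

text \<open>Expansion in the frame shows that the coordinates of a \<open>C\<^sup>1\<close> tangential field are \<open>C\<^sup>1\<close>.\<close>

lemma tangential_coordinates:
  assumes W: "framed c W v" and V: "C1M V" "tangential V"
  defines "\<tau> \<equiv> \<lambda>y. \<Sum>i\<in>UNIV. (in_chart c V y \<bullet> frechet_derivative (in_chart c X) (at y) (v i y)) *\<^sub>R v i y"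
  shows "C1_on W \<tau>" "\<And>y. y \<in> W \<Longrightarrow> frechet_derivative (in_chart c X) (at y) (\<tau> y) = in_chart c V y"
proof -
  note fr = framed_props[OF W]
  show "C1_on W \<tau>"
    unfolding \<tau>_def
    by (intro C1_on_sum C1_on_scaleR C1_on_inner C1_push_field[OF W] C1_on_subset[OF C1MD[OF V(1) fr(1)] fr(3)] fr(4))
  fix y assume y: "y \<in> W"
  then have y': "y \<in> img c" using fr(3) by blast
  define p where "p = par c y"
  have p: "p \<in> fst c" "snd c p = y" "snd c p \<in> W" "p \<in> topspace T"
    unfolding p_def using y y' par_in[OF y'] chart_topspace[OF fr(1)] by auto
  have lin: "linear (differential c X p)"
    by (rule has_derivative_linear[OF has_derivative_X[OF fr(1) p(1)]])
  have "V p = (\<Sum>i\<in>UNIV. (V p \<bullet> differential c X p (v i (snd c p))) *\<^sub>R differential c X p (v i (snd c p)))"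
    using frame_expansion[OF W p(1,3), of "V p"] V(2) p(4) by (simp add: tangential_def)
  also have "\<dots> = differential c X p (\<tau> y)"
    unfolding \<tau>_def
    by (simp add: linear_sum[OF lin] linear_scale[OF lin] in_chart_apply p_def[symmetric])
       (simp add: differential_def p(2))
  finally show "frechet_derivative (in_chart c X) (at y) (\<tau> y) = in_chart c V y"
    using p(2) by (simp add: differential_def in_chart_apply p_def[symmetric])
qed

lemma C1M_shape:
  assumes V: "C1M V" "tangential V"
  shows "C1M (\<lambda>q. shape q (V q))"
proof (rule C1M_local)
  fix p assume "p \<in> topspace T"
  then obtain c W v where W: "framed c W v" "c \<in> A" "p \<in> fst c" "snd c p \<in> W"
    using frame_obtain by blast
  note fr = framed_props[OF W(1)]
  define \<tau> where "\<tau> = (\<lambda>y. \<Sum>i\<in>UNIV. (in_chart c V y \<bullet> frechet_derivative (in_chart c X) (at y) (v i y)) *\<^sub>R v i y)"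
  have \<tau>: "C1_on W \<tau>" "\<And>y. y \<in> W \<Longrightarrow> frechet_derivative (in_chart c X) (at y) (\<tau> y) = in_chart c V y"
    unfolding \<tau>_def using tangential_coordinates[OF W(1) V] by auto
  have "C1_on W (\<lambda>y. frechet_derivative (in_chart c N) (at y) (\<tau> y))"
    by (rule C1_on_derivative_field[OF C1_on_subset[OF C1MD[OF C1M_N fr(1)] fr(3)]
          C1_on_subset[OF C1_dN[OF fr(1)] fr(3)] \<tau>(1) fr(2)])
  then have "C1_on W (in_chart c (\<lambda>q. shape q (V q)))"
  proof (rule C1_on_cong[OF _ fr(2)])
    fix y assume y: "y \<in> W"
    then have y': "y \<in> img c" using fr(3) by blast
    show "frechet_derivative (in_chart c N) (at y) (\<tau> y) = in_chart c (\<lambda>q. shape q (V q)) y"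
      using shape_chart[OF fr(1) par_in[OF y'], of "\<tau> y"] \<tau>(2)[OF y] y'
      by (simp add: in_chart_apply differential_def)
  qed
  then show "\<exists>c\<in>A. \<exists>W. open W \<and> W \<subseteq> img c \<and> p \<in> fst c \<and> snd c p \<in> W \<and> C1_on W (in_chart c (\<lambda>q. shape q (V q)))"
    using W fr by blast
qed

definition tr_shape :: "'p \<Rightarrow> real" where
  "tr_shape = tdiv N"

lemma tr_shape_frame:
  assumes W: "framed c W v" "p \<in> fst c" "snd c p \<in> W"
  shows "tr_shape p = (\<Sum>i\<in>UNIV. differential c N p (v i (snd c p)) \<bullet> differential c X p (v i (snd c p)))"
  unfolding tr_shape_def by (rule tdiv_frame[OF C1M_N W])

text \<open>The Codazzi equation in the form in which it is used: the divergence of the image of a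
  tangential field under the Weingarten map. Its two sides differ by terms that cancel because
  second derivatives commute, and because the derivative of an orthonormal frame is skew while
  the Weingarten map is symmetric.\<close>

lemma tdiv_shape:
  assumes V: "C1M V" "tangential V" and p: "p \<in> topspace T"
    and h: "tder tr_shape h p"
  shows "tdiv (\<lambda>q. shape q (V q)) p = h (V p) + (\<Sum>a\<in>UNIV. shape p (axis a 1) \<bullet> tderiv V p (axis a 1))"
proof -
  obtain c W v where W: "framed c W v" "c \<in> A" "p \<in> fst c" "snd c p \<in> W"
    using frame_obtain[OF p] .
  note fr = framed_props[OF W(1)]
  define x where "x = snd c p"
  have x: "x \<in> W" "x \<in> img c" "par c x = p" using W fr by (auto simp: x_def)
  let ?X = "\<lambda>y. frechet_derivative (in_chart c X) (at y)"
  let ?N = "\<lambda>y. frechet_derivative (in_chart c N) (at y)"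
  let ?X2 = "\<lambda>u. frechet_derivative (\<lambda>y. ?X y u) (at x)"
  let ?N2 = "\<lambda>u. frechet_derivative (\<lambda>y. ?N y u) (at x)"
  define \<tau> where "\<tau> = (\<lambda>y. \<Sum>i\<in>UNIV. (in_chart c V y \<bullet> ?X y (v i y)) *\<^sub>R v i y)"
  have \<tau>: "C1_on W \<tau>" "\<And>y. y \<in> W \<Longrightarrow> ?X y (\<tau> y) = in_chart c V y"
    unfolding \<tau>_def using tangential_coordinates[OF W(1) V] by auto
  define t where "t = \<tau> x"
  define \<tau>' where "\<tau>' = frechet_derivative \<tau> (at x)"
  define w where "w = (\<lambda>i. v i x)"
  define w' where "w' = (\<lambda>i. frechet_derivative (v i) (at x))"
  define e where "e = (\<lambda>i. ?X x (w i))"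
  have cX: "C1_on W (in_chart c X)" "\<And>u. C1_on W (\<lambda>y. ?X y u)"
    using C1_on_subset[OF C1MD[OF C1M_X fr(1)] fr(3)] C1_on_subset[OF C1_dX[OF fr(1)] fr(3)] by auto
  have cN: "C1_on W (in_chart c N)" "\<And>u. C1_on W (\<lambda>y. ?N y u)"
    using C1_on_subset[OF C1MD[OF C1M_N fr(1)] fr(3)] C1_on_subset[OF C1_dN[OF fr(1)] fr(3)] by auto
  have dX: "differential c X p = ?X x" and dN: "differential c N p = ?N x"
    by (simp_all add: differential_def x_def)
  have symX: "?X2 u k = ?X2 k u" for u k
    by (rule second_derivative_symmetric[OF fr(2) x(1) cX])
  have symN: "?N2 u k = ?N2 k u" for u k
    by (rule second_derivative_symmetric[OF fr(2) x(1) cN])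
  have sym: "?N x u \<bullet> ?X x k = ?N x k \<bullet> ?X x u" for u k
    using shape_symmetric_chart[OF W(2,3), of u k] unfolding dX dN .
  have dv: "(v i has_derivative w' i) (at x)" for i
    unfolding w'_def by (rule C1_onD(1)[OF fr(4) x(1)])
  have d\<tau>: "(\<tau> has_derivative \<tau>') (at x)"
    unfolding \<tau>'_def by (rule C1_onD(1)[OF \<tau>(1) x(1)])
  have fX: "((\<lambda>y. ?X y (g y)) has_derivative (\<lambda>k. ?X2 (g x) k + ?X x (g' k))) (at x)"
    if "(g has_derivative g') (at x)" for g g'
    by (rule has_derivative_derivative_field[OF cX that fr(2) x(1)])
  have fN: "((\<lambda>y. ?N y (g y)) has_derivative (\<lambda>k. ?N2 (g x) k + ?N x (g' k))) (at x)"
    if "(g has_derivative g') (at x)" for g g'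
    by (rule has_derivative_derivative_field[OF cN that fr(2) x(1)])
  have ort: "?X y (v i y) \<bullet> ?X y (v j y) = (if i = j then 1 else 0)" if "y \<in> W" for y i j
    using W(1) that unfolding framed_def orthonormal_frame_def push_field_def by blast
  define e' where "e' = (\<lambda>i k. ?X2 (w i) k + ?X x (w' i k))"
  have de: "((\<lambda>y. ?X y (v i y)) has_derivative e' i) (at x)" for i
    using fX[OF dv, of i] unfolding e'_def w_def .
  have skew: "e' i k \<bullet> e j + e i \<bullet> e' j k = 0" for i j k
  proof -
    have "((\<lambda>y. ?X y (v i y) \<bullet> ?X y (v j y)) has_derivative
       (\<lambda>k. ?X x (v i x) \<bullet> e' j k + e' i k \<bullet> ?X x (v j x))) (at x)"
      by (intro has_derivative_inner de)
    then have "((\<lambda>y. if i = j then 1 else 0) has_derivative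
       (\<lambda>k. ?X x (v i x) \<bullet> e' j k + e' i k \<bullet> ?X x (v j x))) (at x)"
      by (rule has_derivative_transform_within_open[OF _ fr(2) x(1)]) (use ort in auto)
    from has_derivative_unique[OF this has_derivative_const]
    show ?thesis by (simp add: fun_eq_iff e_def w_def add.commute)
  qed
  have cancel: "(\<Sum>i\<in>UNIV. ?N x (w i) \<bullet> e' i k) = 0" for k
  proof -
    have ex: "?N x (w i) = (\<Sum>j\<in>UNIV. (?N x (w i) \<bullet> e j) *\<^sub>R e j)" for i
    proof -
      have "?N x (w i) \<bullet> N p = 0"
        using shape_normal[OF p, of "differential c X p (w i)"] unfolding shape_chart[OF W(2,3)] dN .
      then show ?thesis
        using frame_expansion[OF W(1,3,4), of "?N x (w i)"] by (simp add: e_def w_def dX x_def)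
    qed
    define B where "B = (\<Sum>i\<in>UNIV. \<Sum>j\<in>UNIV. (?N x (w i) \<bullet> e j) * (e j \<bullet> e' i k))"
    have B: "(\<Sum>i\<in>UNIV. ?N x (w i) \<bullet> e' i k) = B"
      unfolding B_def by (subst ex) (simp add: inner_sum_left)
    have "B = (\<Sum>i\<in>UNIV. \<Sum>j\<in>UNIV. (?N x (w j) \<bullet> e i) * (e i \<bullet> e' j k))"
      unfolding B_def by (rule sum.swap)
    also have "\<dots> = - B"
    proof -
      have *: "(?N x (w j) \<bullet> e i) * (e i \<bullet> e' j k) = - ((?N x (w i) \<bullet> e j) * (e j \<bullet> e' i k))" for i j
      proof -
        have "e i \<bullet> e' j k = - (e j \<bullet> e' i k)"
          using skew[of i k j] by (simp add: inner_commute[of "e j"])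
        moreover have "?N x (w j) \<bullet> e i = ?N x (w i) \<bullet> e j" unfolding e_def by (rule sym)
        ultimately show ?thesis by simp
      qed
      show ?thesis
        unfolding B_def sum_negf[symmetric] by (intro sum.cong refl) (rule *)
    qed
    finally have "B = - B" .
    then show ?thesis using B by simp
  qed
  \<comment> \<open>differentiate the trace along \<open>V\<close>; the part from the motion of the frame drops out by \<open>cancel\<close>\<close>
  have 1: "(in_chart c tr_shape has_derivative (\<lambda>k. \<Sum>i\<in>UNIV. ?N x (w i) \<bullet> e' i k + (?N2 (w i) k + ?N x (w' i k)) \<bullet> e i)) (at x)"
  proof (rule has_derivative_transform_within_open[OF _ fr(2) x(1)])
    show "((\<lambda>y. \<Sum>i\<in>UNIV. ?N y (v i y) \<bullet> ?X y (v i y)) has_derivative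
       (\<lambda>k. \<Sum>i\<in>UNIV. ?N x (w i) \<bullet> e' i k + (?N2 (w i) k + ?N x (w' i k)) \<bullet> e i)) (at x)"
      unfolding w_def e_def by (intro has_derivative_sum has_derivative_inner de fN[OF dv])
    fix y assume "y \<in> W"
    then show "(\<Sum>i\<in>UNIV. ?N y (v i y) \<bullet> ?X y (v i y)) = in_chart c tr_shape y"
      using tr_shape_frame[OF W(1) par_in[of y c]] fr(3) by (auto simp: in_chart_apply differential_def)
  qed
  have "(in_chart c tr_shape has_derivative (\<lambda>u. h (?X x u))) (at x)"
    using tderD(4)[OF h W(2,3)] unfolding dX x_def .
  from has_derivative_unique[OF this 1] have "h (?X x k) = (\<Sum>i\<in>UNIV. ?N x (w i) \<bullet> e' i k + (?N2 (w i) k + ?N x (w' i k)) \<bullet> e i)" for k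
    by (rule fun_cong)
  moreover have "?X x t = V p"
    unfolding t_def using \<tau>(2)[OF x(1)] x(3) by (simp add: in_chart_apply)
  ultimately have "h (V p) = (\<Sum>i\<in>UNIV. ?N x (w i) \<bullet> e' i t + (?N2 (w i) t + ?N x (w' i t)) \<bullet> e i)"
    by metis
  also have "\<dots> = (\<Sum>i\<in>UNIV. ?N x (w i) \<bullet> e' i t) + (\<Sum>i\<in>UNIV. (?N2 (w i) t + ?N x (w' i t)) \<bullet> e i)"
    by (rule sum.distrib)
  also have "\<dots> = (\<Sum>i\<in>UNIV. (?N2 (w i) t + ?N x (w' i t)) \<bullet> e i) - (\<Sum>i\<in>UNIV. ?N x (w i) \<bullet> e' i t)"
    unfolding cancel by simp
  also have "\<dots> = (\<Sum>i\<in>UNIV. ?N2 (w i) t \<bullet> e i - ?N x (w i) \<bullet> ?X2 (w i) t)"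
    unfolding sum_subtractf[symmetric] e'_def
    by (rule sum.cong) (use sym in \<open>auto simp: e_def inner_add_left inner_add_right\<close>)
  finally have hV: "h (V p) = (\<Sum>i\<in>UNIV. ?N2 (w i) t \<bullet> e i - ?N x (w i) \<bullet> ?X2 (w i) t)" .
  \<comment> \<open>the divergence in the same frame, where it can be compared with \<open>hV\<close>\<close>
  have "(in_chart c (\<lambda>q. shape q (V q)) has_derivative (\<lambda>k. ?N2 t k + ?N x (\<tau>' k))) (at x)"
    unfolding t_def
  proof (rule has_derivative_transform_within_open[OF fN[OF d\<tau>] fr(2) x(1)])
    fix y assume y: "y \<in> W"
    then have "y \<in> img c" using fr(3) by blast
    then show "?N y (\<tau> y) = in_chart c (\<lambda>q. shape q (V q)) y"
      using shape_chart[OF fr(1) par_in, of y "\<tau> y"] \<tau>(2)[OF y] by (simp add: in_chart_apply differential_def)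
  qed
  then have dS: "differential c (\<lambda>q. shape q (V q)) p = (\<lambda>k. ?N2 t k + ?N x (\<tau>' k))"
    unfolding differential_def x_def[symmetric] by (rule frechet_derivative_at[symmetric])
  have lhs: "tdiv (\<lambda>q. shape q (V q)) p = (\<Sum>i\<in>UNIV. (?N2 t (w i) + ?N x (\<tau>' (w i))) \<bullet> e i)"
    using tdiv_frame[OF C1M_shape[OF V] W(1,3,4)] unfolding dS dX by (simp add: w_def e_def x_def)
  have "(in_chart c V has_derivative (\<lambda>k. ?X2 t k + ?X x (\<tau>' k))) (at x)"
    unfolding t_def by (rule has_derivative_transform_within_open[OF fX[OF d\<tau>] fr(2) x(1)]) (rule \<tau>(2))
  then have dV: "differential c V p = (\<lambda>k. ?X2 t k + ?X x (\<tau>' k))"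
    unfolding differential_def x_def[symmetric] by (rule frechet_derivative_at[symmetric])
  have "(\<Sum>a\<in>UNIV. shape p (axis a 1) \<bullet> tderiv V p (axis a 1))
      = (\<Sum>i\<in>UNIV. shape p (differential c X p (v i (snd c p))) \<bullet> tderiv V p (differential c X p (v i (snd c p))))"
    by (rule frame_sum_inner[OF W(1,3,4) shape_linear[OF p] tderD(2)[OF tder_tderiv[OF V(1) p]] shape_N[OF p]])
  also have "\<dots> = (\<Sum>i\<in>UNIV. ?N x (w i) \<bullet> (?X2 t (w i) + ?X x (\<tau>' (w i))))"
    unfolding shape_chart[OF W(2,3)] tderiv_chart[OF V(1) W(2,3)] dV dN by (simp add: w_def x_def)
  finally have rhs: "(\<Sum>a\<in>UNIV. shape p (axis a 1) \<bullet> tderiv V p (axis a 1))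
     = (\<Sum>i\<in>UNIV. ?N x (w i) \<bullet> (?X2 t (w i) + ?X x (\<tau>' (w i))))" .
  show ?thesis
    unfolding lhs rhs hV sum.distrib[symmetric]
  proof (rule sum.cong[OF refl])
    fix i
    show "(?N2 t (w i) + ?N x (\<tau>' (w i))) \<bullet> e i
      = ?N2 (w i) t \<bullet> e i - ?N x (w i) \<bullet> ?X2 (w i) t + ?N x (w i) \<bullet> (?X2 t (w i) + ?X x (\<tau>' (w i)))"
      using sym[of "\<tau>' (w i)" "w i"] symX[of t "w i"] symN[of t "w i"]
      by (simp add: inner_add_left inner_add_right e_def)
  qed
qed

section \<open>The weighted divergence theorem\<close>


subsection \<open>In a single chart\<close>

definition gram :: "('p, 'n) chart \<Rightarrow> real^'n \<Rightarrow> real^'n^'n" where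
  "gram c y = (\<chi> k l. frechet_derivative (in_chart c X) (at y) (axis k 1)
     \<bullet> frechet_derivative (in_chart c X) (at y) (axis l 1))"

text \<open>The Riemannian volume density times the Gaussian weight \<open>e\<^bsup>-|x|\<^sup>2/4\<^esup>\<close>.\<close>

definition dens :: "('p, 'n) chart \<Rightarrow> real^'n \<Rightarrow> real" where
  "dens c y = sqrt (det (gram c y)) * exp (- (in_chart c X y \<bullet> in_chart c X y) / 4)"

text \<open>For tangential \<open>V\<close> this is \<open>e\<^bsup>f\<^esup> div (e\<^bsup>-f\<^esup> V)\<close> with \<open>f = |x|\<^sup>2/4\<close>.\<close>

definition wdiv :: "('p \<Rightarrow> real^'m) \<Rightarrow> 'p \<Rightarrow> real" where
  "wdiv V p = tdiv V p - (X p \<bullet> V p) / 2"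

lemma bilinear_matrix_entry:
  fixes L M :: "real^'n \<Rightarrow> real^'m" and B :: "real^'k^'n"
  assumes "linear L" "linear M"
  shows "(transpose B ** (\<chi> k l. L (axis k 1) \<bullet> M (axis l 1)) ** B) $ i $ j = L (column i B) \<bullet> M (column j B)"
proof -
  have ex: "F (column i B) = (\<Sum>k\<in>UNIV. B $ k $ i *\<^sub>R F (axis k 1))" if "linear F" for F :: "real^'n \<Rightarrow> real^'m" and i
  proof -
    have "column i B = (\<Sum>k\<in>UNIV. B $ k $ i *\<^sub>R axis k 1)"
      using basis_expansion[of "column i B"] by (simp add: column_def scalar_mult_eq_scaleR)
    then show ?thesis using that by (simp add: linear_sum linear_scale)
  qed
  have LM: "L (column i B) \<bullet> M (column j B)
      = (\<Sum>k\<in>UNIV. \<Sum>l\<in>UNIV. B $ k $ i * (B $ l $ j * (L (axis k 1) \<bullet> M (axis l 1))))"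
    unfolding ex[OF assms(1)] ex[OF assms(2)] inner_sum_left inner_scaleR_left
    by (simp add: inner_sum_right sum_distrib_left)
  have "(transpose B ** (\<chi> k l. L (axis k 1) \<bullet> M (axis l 1)) ** B) $ i $ j
      = (\<Sum>l\<in>UNIV. \<Sum>k\<in>UNIV. B $ k $ i * (L (axis k 1) \<bullet> M (axis l 1)) * B $ l $ j)"
    by (simp add: matrix_matrix_mult_def transpose_def sum_distrib_right)
  also have "\<dots> = (\<Sum>k\<in>UNIV. \<Sum>l\<in>UNIV. B $ k $ i * (L (axis k 1) \<bullet> M (axis l 1)) * B $ l $ j)"
    by (rule sum.swap)
  finally show ?thesis unfolding LM by (simp only: mult_ac)
qed

definition frame_matrix :: "('n \<Rightarrow> real^'n \<Rightarrow> real^'n) \<Rightarrow> real^'n \<Rightarrow> real^'n^'n" where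
  "frame_matrix v y = (\<chi> k i. v i y $ k)"

lemma column_frame_matrix [simp]: "column i (frame_matrix v y) = v i y"
  by (simp add: column_def frame_matrix_def vec_eq_iff)

lemma linear_dX: "c \<in> A \<Longrightarrow> y \<in> img c \<Longrightarrow> linear (frechet_derivative (in_chart c X) (at y))"
  by (rule has_derivative_linear[OF C1_onD(1)[OF C1MD[OF C1M_X]]])

lemma gram_frame:
  assumes W: "framed c W v" "y \<in> W"
  shows "transpose (frame_matrix v y) ** gram c y ** frame_matrix v y = mat 1"
proof -
  note fr = framed_props[OF W(1)]
  have "linear (frechet_derivative (in_chart c X) (at y))"
    by (rule linear_dX[OF fr(1)]) (use W(2) fr(3) in blast)
  then have "(transpose (frame_matrix v y) ** gram c y ** frame_matrix v y) $ i $ j = (if i = j then 1 else 0)" for i j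
    unfolding gram_def
    using W unfolding framed_def orthonormal_frame_def push_field_def
    by (subst bilinear_matrix_entry) auto
  then show ?thesis by (simp add: vec_eq_iff mat_def)
qed

lemma det_gram_pos:
  assumes "framed c W v" "y \<in> W" shows "det (gram c y) > 0"
proof -
  have "det (frame_matrix v y) * det (gram c y) * det (frame_matrix v y) = 1"
    using arg_cong[OF gram_frame[OF assms], of det] by (simp add: det_mul)
  then have *: "(det (frame_matrix v y))\<^sup>2 * det (gram c y) = 1" by (simp add: power2_eq_square mult_ac)
  show ?thesis
  proof (rule ccontr)
    assume "\<not> det (gram c y) > 0"
    then have "(det (frame_matrix v y))\<^sup>2 * det (gram c y) \<le> 0"
      by (intro mult_nonneg_nonpos) auto
    then show False using * by simp
  qed
qed

lemma dens_pos: "framed c W v \<Longrightarrow> y \<in> W \<Longrightarrow> dens c y > 0"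
  unfolding dens_def using det_gram_pos by simp

lemma C1_gram: "c \<in> A \<Longrightarrow> C1_on (img c) (\<lambda>y. gram c y $ k $ l)"
  unfolding gram_def by (auto intro!: C1_on_inner C1_dX)

lemma dens_continuous:
  assumes "c \<in> A" shows "continuous_on (img c) (dens c)"
  unfolding dens_def
  by (intro continuous_intros continuous_on_divide C1_on_continuous[OF C1_on_det[OF C1_gram]]
      C1_on_continuous[OF C1MD[OF C1M_X]] assms) auto

lemma C1_dens:
  assumes W: "framed c W v" shows "C1_on W (dens c)"
proof -
  note fr = framed_props[OF W]
  have "C1_on W (\<lambda>y. - (in_chart c X y \<bullet> in_chart c X y) * (1/4))"
    by (intro C1_on_mult C1_on_minus C1_on_inner C1_on_const C1_on_subset[OF C1MD[OF C1M_X fr(1)] fr(3)])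
  then show ?thesis
    unfolding dens_def
    by (intro C1_on_mult C1_on_sqrt C1_on_exp C1_on_det C1_on_subset[OF C1_gram[OF fr(1)] fr(3)])
       (use det_gram_pos[OF W] in auto)
qed

text \<open>In an orthonormal frame, Jacobi's formula for the Gram determinant is a sum over the frame.\<close>

lemma has_derivative_dens:
  assumes W: "framed c W v" "x \<in> W"
  defines "dX \<equiv> frechet_derivative (in_chart c X) (at x)"
    and "d2X \<equiv> \<lambda>u. frechet_derivative (\<lambda>y. frechet_derivative (in_chart c X) (at y) u) (at x)"
  shows "(dens c has_derivative
     (\<lambda>h. dens c x * ((\<Sum>i\<in>UNIV. d2X (v i x) h \<bullet> dX (v i x)) - (in_chart c X x \<bullet> dX h) / 2))) (at x)"
proof -
  note fr = framed_props[OF W(1)]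
  have x: "x \<in> img c" using W fr(3) by blast
  let ?B = "frame_matrix v x"
  let ?G' = "\<lambda>h. (\<chi> k l. dX (axis k 1) \<bullet> d2X (axis l 1) h + d2X (axis k 1) h \<bullet> dX (axis l 1)) :: real^'n^'n"
  have d2: "((\<lambda>y. frechet_derivative (in_chart c X) (at y) u) has_derivative d2X u) (at x)" for u
    unfolding d2X_def by (rule C1_onD(1)[OF C1_dX[OF fr(1)] x])
  have lin: "linear dX" unfolding dX_def by (rule linear_dX[OF fr(1) x])
  have sym: "d2X u h = d2X h u" for u h
    unfolding d2X_def
    by (rule second_derivative_symmetric[OF chart(2)[OF fr(1)] x C1MD[OF C1M_X fr(1)] C1_dX[OF fr(1)]])
  have lin2: "linear (\<lambda>u. d2X u h)" for h
    unfolding sym[of _ h] by (rule has_derivative_linear[OF d2])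
  have "((\<lambda>y. gram c y) has_derivative ?G') (at x)"
  proof (subst has_derivative_componentwise_within, rule ballI)
    fix b :: "real^'n^'n" assume "b \<in> Basis"
    then obtain k l where b: "b = axis k (axis l 1)" by (auto simp: Basis_vec_def)
    have "((\<lambda>y. gram c y $ k $ l) has_derivative (\<lambda>h. ?G' h $ k $ l)) (at x)"
      unfolding gram_def dX_def by simp (rule has_derivative_inner[OF d2 d2])
    then show "((\<lambda>y. gram c y \<bullet> b) has_derivative (\<lambda>h. ?G' h \<bullet> b)) (at x)"
      unfolding b by (simp add: inner_axis)
  qed
  from has_derivative_det[OF this gram_frame[OF W]]
  have "((\<lambda>y. det (gram c y)) has_derivative
     (\<lambda>h. det (gram c x) * (\<Sum>i\<in>UNIV. (transpose ?B ** ?G' h ** ?B) $ i $ i))) (at x)" .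
  moreover have "(transpose ?B ** ?G' h ** ?B) $ i $ i = 2 * (d2X (v i x) h \<bullet> dX (v i x))" for h i
  proof -
    have "?G' h = (\<chi> k l. dX (axis k 1) \<bullet> d2X (axis l 1) h) + (\<chi> k l. d2X (axis k 1) h \<bullet> dX (axis l 1))"
      by (simp add: vec_eq_iff)
    then have "transpose ?B ** ?G' h ** ?B
      = transpose ?B ** (\<chi> k l. dX (axis k 1) \<bullet> d2X (axis l 1) h) ** ?B
      + transpose ?B ** (\<chi> k l. d2X (axis k 1) h \<bullet> dX (axis l 1)) ** ?B"
      by (simp add: matrix_add_ldistrib matrix_matrix_mult_def vec_eq_iff sum.distrib algebra_simps)
    then show ?thesis
      using bilinear_matrix_entry[OF lin lin2, of ?B h i i] bilinear_matrix_entry[OF lin2 lin, of ?B h i i]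
      by (simp add: inner_commute)
  qed
  ultimately have dG: "((\<lambda>y. det (gram c y)) has_derivative
     (\<lambda>h. det (gram c x) * (\<Sum>i\<in>UNIV. 2 * (d2X (v i x) h \<bullet> dX (v i x))))) (at x)" by simp
  define g where "g = det (gram c x)"
  have g: "g > 0" unfolding g_def by (rule det_gram_pos[OF W])
  have "(sqrt has_derivative (\<lambda>t. inverse (sqrt g) / 2 * t)) (at g)"
    using DERIV_real_sqrt[OF g] unfolding has_field_derivative_def .
  from diff_chain_at[OF dG this[unfolded g_def]]
  have ds: "((\<lambda>y. sqrt (det (gram c y))) has_derivative
     (\<lambda>h. sqrt g * (\<Sum>i\<in>UNIV. d2X (v i x) h \<bullet> dX (v i x)))) (at x)"
  proof -
    have gg: "sqrt g * sqrt g = g" using g by simp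
    have "inverse (sqrt g) / 2 * (g * (\<Sum>i\<in>UNIV. 2 * (d2X (v i x) h \<bullet> dX (v i x))))
       = sqrt g * (\<Sum>i\<in>UNIV. d2X (v i x) h \<bullet> dX (v i x))" for h
      using g unfolding sum_distrib_left[symmetric] by (subst (2) gg[symmetric]) (simp add: field_simps)
    then show ?thesis
      using diff_chain_at[OF dG \<open>(sqrt has_derivative (\<lambda>t. inverse (sqrt g) / 2 * t)) (at g)\<close>[unfolded g_def]]
      by (simp add: o_def g_def)
  qed
  have dx: "(in_chart c X has_derivative dX) (at x)"
    unfolding dX_def by (rule C1_onD(1)[OF C1MD[OF C1M_X fr(1)] x])
  have "((\<lambda>y. - (in_chart c X y \<bullet> in_chart c X y) / 4) has_derivative (\<lambda>h. - (in_chart c X x \<bullet> dX h) / 2)) (at x)"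
    by (rule has_derivative_eq_rhs)
       (rule has_derivative_divide'[OF has_derivative_minus[OF has_derivative_inner[OF dx dx]]],
        auto simp: fun_eq_iff inner_commute)
  then have de: "((\<lambda>y. exp (- (in_chart c X y \<bullet> in_chart c X y) / 4)) has_derivative
     (\<lambda>h. - (in_chart c X x \<bullet> dX h) / 2 * exp (- (in_chart c X x \<bullet> in_chart c X x) / 4))) (at x)"
    by (rule has_derivative_exp)
  show ?thesis
    unfolding dens_def
    by (rule has_derivative_eq_rhs[OF has_derivative_mult[OF ds de]])
       (auto simp: fun_eq_iff g_def algebra_simps)
qed

text \<open>The density is chosen so that the coordinate divergence becomes the weighted one.\<close>

lemma coordinate_divergence:
  assumes V: "C1M V" "tangential V" and W: "framed c W v" "x \<in> W"
  defines "\<tau> \<equiv> \<lambda>y. \<Sum>i\<in>UNIV. (in_chart c V y \<bullet> frechet_derivative (in_chart c X) (at y) (v i y)) *\<^sub>R v i y"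
  shows "(\<Sum>k\<in>UNIV. frechet_derivative (\<lambda>y. dens c y *\<^sub>R \<tau> y) (at x) (axis k 1) $ k) = wdiv V (par c x) * dens c x"
proof -
  note fr = framed_props[OF W(1)]
  have x: "x \<in> img c" using W fr(3) by blast
  define p where "p = par c x"
  have p: "p \<in> fst c" "snd c p = x" "snd c p \<in> W" using x W par_in[OF x] by (auto simp: p_def)
  define dX where "dX = frechet_derivative (in_chart c X) (at x)"
  define d2X where "d2X = (\<lambda>u. frechet_derivative (\<lambda>y. frechet_derivative (in_chart c X) (at y) u) (at x))"
  have \<tau>: "C1_on W \<tau>" "\<And>y. y \<in> W \<Longrightarrow> frechet_derivative (in_chart c X) (at y) (\<tau> y) = in_chart c V y"
    unfolding \<tau>_def using tangential_coordinates[OF W(1) V] by auto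
  define \<tau>' where "\<tau>' = frechet_derivative \<tau> (at x)"
  have d\<tau>: "(\<tau> has_derivative \<tau>') (at x)" unfolding \<tau>'_def by (rule C1_onD(1)[OF \<tau>(1) W(2)])
  have lin\<tau>: "linear \<tau>'" by (rule has_derivative_linear[OF d\<tau>])
  have lin: "linear dX" unfolding dX_def by (rule linear_dX[OF fr(1) x])
  have cX: "C1_on W (in_chart c X)" "\<And>u. C1_on W (\<lambda>y. frechet_derivative (in_chart c X) (at y) u)"
    using C1_on_subset[OF C1MD[OF C1M_X fr(1)] fr(3)] C1_on_subset[OF C1_dX[OF fr(1)] fr(3)] by auto
  define D where "D = (\<lambda>h. dens c x * ((\<Sum>i\<in>UNIV. d2X (v i x) h \<bullet> dX (v i x)) - (in_chart c X x \<bullet> dX h) / 2))"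
  have dD: "(dens c has_derivative D) (at x)"
    unfolding D_def dX_def d2X_def by (rule has_derivative_dens[OF W])
  have linD: "linear D" by (rule has_derivative_linear[OF dD])
  have "((\<lambda>y. dens c y *\<^sub>R \<tau> y) has_derivative (\<lambda>h. dens c x *\<^sub>R \<tau>' h + D h *\<^sub>R \<tau> x)) (at x)"
    by (rule has_derivative_scaleR[OF dD d\<tau>])
  then have "frechet_derivative (\<lambda>y. dens c y *\<^sub>R \<tau> y) (at x) = (\<lambda>h. dens c x *\<^sub>R \<tau>' h + D h *\<^sub>R \<tau> x)"
    by (rule frechet_derivative_at[symmetric])
  then have 1: "(\<Sum>k\<in>UNIV. frechet_derivative (\<lambda>y. dens c y *\<^sub>R \<tau> y) (at x) (axis k 1) $ k)
     = dens c x * (\<Sum>k\<in>UNIV. \<tau>' (axis k 1) $ k) + (\<Sum>k\<in>UNIV. D (axis k 1) * \<tau> x $ k)"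
    by (simp add: sum.distrib sum_distrib_left)
  have ex: "(\<Sum>k\<in>UNIV. u $ k *\<^sub>R axis k 1) = u" for u :: "real^'n"
    using basis_expansion[of u] by (simp add: scalar_mult_eq_scaleR)
  have 2: "(\<Sum>k\<in>UNIV. D (axis k 1) * \<tau> x $ k) = D (\<tau> x)"
  proof -
    have "D (\<Sum>k\<in>UNIV. \<tau> x $ k *\<^sub>R axis k 1) = (\<Sum>k\<in>UNIV. D (axis k 1) * \<tau> x $ k)"
      by (simp add: linear_sum[OF linD] linear_scale[OF linD] mult.commute)
    then show ?thesis unfolding ex by simp
  qed
  have 3: "(\<Sum>k\<in>UNIV. \<tau>' (axis k 1) $ k) = (\<Sum>i\<in>UNIV. dX (\<tau>' (v i x)) \<bullet> dX (v i x))"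
  proof -
    have fc: "u $ k = (\<Sum>i\<in>UNIV. (dX u \<bullet> dX (v i x)) * v i x $ k)" for u k
      using arg_cong[OF frame_coordinates[OF W(1) p(1,3), of u], of "\<lambda>z. z $ k"] p(2)
      by (simp add: differential_def dX_def)
    have "(\<Sum>k\<in>UNIV. \<tau>' (axis k 1) $ k)
        = (\<Sum>i\<in>UNIV. \<Sum>k\<in>UNIV. (dX (\<tau>' (axis k 1)) \<bullet> dX (v i x)) * v i x $ k)"
      by (subst sum.swap) (intro sum.cong refl fc)
    also have "\<dots> = (\<Sum>i\<in>UNIV. dX (\<tau>' (\<Sum>k\<in>UNIV. v i x $ k *\<^sub>R axis k 1)) \<bullet> dX (v i x))"
      by (simp add: linear_sum[OF lin\<tau>] linear_scale[OF lin\<tau>] linear_sum[OF lin] linear_scale[OF lin]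
          inner_sum_left mult.commute)
    finally show ?thesis unfolding ex .
  qed
  have sym: "d2X u h = d2X h u" for u h
    unfolding d2X_def by (rule second_derivative_symmetric[OF fr(2) W(2) cX])
  have "(in_chart c V has_derivative (\<lambda>k. d2X (\<tau> x) k + dX (\<tau>' k))) (at x)"
    unfolding d2X_def dX_def
    by (rule has_derivative_transform_within_open[OF
          has_derivative_derivative_field[OF cX d\<tau> fr(2) W(2)] fr(2) W(2)]) (rule \<tau>(2))
  then have dV: "differential c V p = (\<lambda>k. d2X (\<tau> x) k + dX (\<tau>' k))"
    unfolding differential_def p(2) by (rule frechet_derivative_at[symmetric])
  have 4: "tdiv V p = (\<Sum>i\<in>UNIV. (d2X (\<tau> x) (v i x) + dX (\<tau>' (v i x))) \<bullet> dX (v i x))"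
    using tdiv_frame[OF V(1) W(1) p(1,3)] unfolding dV by (simp add: p(2) differential_def dX_def)
  have 5: "dX (\<tau> x) = V p" "in_chart c X x = X p"
    using \<tau>(2)[OF W(2)] by (simp_all add: dX_def in_chart_apply p_def)
  show ?thesis
    unfolding 1 2 3 wdiv_def p_def[symmetric] 4 sym[of "\<tau> x"] unfolding D_def 5
    by (simp add: inner_add_left sum.distrib algebra_simps)
qed

text \<open>The support condition keeps away from the boundary of the coordinate domain.\<close>

definition supported :: "('p, 'n) chart \<Rightarrow> (real^'n) set \<Rightarrow> ('p \<Rightarrow> 'b::zero) \<Rightarrow> bool" where
  "supported c W f \<longleftrightarrow>
     (\<exists>C. compact C \<and> C \<subseteq> W \<and> (\<forall>q\<in>topspace T. f q \<noteq> 0 \<longrightarrow> q \<in> fst c \<and> snd c q \<in> C))"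

lemma closed_par_image:
  assumes c: "c \<in> A" and C: "compact C" "C \<subseteq> img c"
  shows "closedin T (par c ` C)"
proof -
  have "compactin (top_of_set (img c)) C" using C by (simp add: compactin_subtopology)
  then have "compactin T (par c ` C)" by (rule image_compactin[OF _ par_continuous[OF c]])
  then show ?thesis by (rule compactin_imp_closedin[OF Hausdorff])
qed

lemma wdiv_eq_0:
  assumes "openin T Q" "p \<in> Q" "\<And>q. q \<in> Q \<Longrightarrow> V q = 0"
  shows "wdiv V p = 0"
proof -
  have p: "p \<in> topspace T" using assms openin_subset by blast
  have "tder V (\<lambda>x. 0) p"
    by (rule tder_cong_open[OF tder_const[of 0] assms(1,2)]) (use assms(3) in simp)
  from tdiv_eq[OF this p] show ?thesis unfolding wdiv_def using assms(2,3) by simp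
qed

lemma supported_wdiv:
  assumes c: "c \<in> A" "W \<subseteq> img c" and V: "supported c W V"
  shows "supported c W (wdiv V)"
proof -
  obtain C where C: "compact C" "C \<subseteq> W" "\<And>q. q \<in> topspace T \<Longrightarrow> V q \<noteq> 0 \<Longrightarrow> q \<in> fst c \<and> snd c q \<in> C"
    using V unfolding supported_def by blast
  have cl: "closedin T (par c ` C)" by (rule closed_par_image[OF c(1) C(1)]) (use C(2) c(2) in blast)
  have "q \<in> par c ` C" if q: "q \<in> topspace T" "wdiv V q \<noteq> 0" for q
  proof (rule ccontr)
    assume "q \<notin> par c ` C"
    then have q': "q \<in> topspace T - par c ` C" using q by blast
    have "V q = 0" if "q \<in> topspace T - par c ` C" for q
      using C(3)[of q] that par_chart[OF c(1), of q] by (metis DiffE imageI)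
    from wdiv_eq_0[of _ q V, OF openin_diff[OF openin_topspace cl] q' this] show False using q(2) by blast
  qed
  note * = this
  have "q \<in> fst c \<and> snd c q \<in> C" if q: "q \<in> topspace T" "wdiv V q \<noteq> 0" for q
  proof -
    obtain y where y: "y \<in> C" "q = par c y" using *[OF q] by (rule imageE)
    have "y \<in> img c" using y(1) C(2) c(2) by (auto dest: subsetD)
    then show ?thesis using y par_in[of y c] by simp
  qed
  then show ?thesis using C(1,2) unfolding supported_def by blast
qed

definition chart_integral :: "('p, 'n) chart \<Rightarrow> ('p \<Rightarrow> real) \<Rightarrow> real" where
  "chart_integral c g = integral\<^sup>L lborel (\<lambda>y. if y \<in> img c then g (par c y) * dens c y else 0)"

lemma chart_integral_compactly_supported:
  assumes c: "c \<in> A" and g: "continuous_map T euclidean g" "supported c (img c) g"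
  shows "compactly_supported (\<lambda>y. if y \<in> img c then g (par c y) * dens c y else 0)"
proof -
  obtain C where C: "compact C" "C \<subseteq> img c" "\<And>q. q \<in> topspace T \<Longrightarrow> g q \<noteq> 0 \<Longrightarrow> q \<in> fst c \<and> snd c q \<in> C"
    using g(2) unfolding supported_def by blast
  show ?thesis
  proof (rule compactly_supported_extend[OF chart(2)[OF c] C(1,2)])
    show "continuous_on (img c) (\<lambda>y. g (par c y) * dens c y)"
      using continuous_map_in_chart[OF g(1) c] dens_continuous[OF c]
      by (intro continuous_on_mult) (simp_all add: in_chart_def o_def)
    fix y assume y: "y \<in> img c" "y \<notin> C"
    then have "g (par c y) = 0"
      using C(3)[of "par c y"] par_in[OF y(1)] chart_topspace[OF c] by auto
    then show "g (par c y) * dens c y = 0" by simp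
  qed
qed

lemma chart_integral_wdiv:
  assumes V: "C1M V" "tangential V" and W: "framed c W v" and sup: "supported c W V"
  shows "chart_integral c (wdiv V) = 0"
proof -
  note fr = framed_props[OF W]
  define \<tau> where "\<tau> = (\<lambda>y. \<Sum>i\<in>UNIV. (in_chart c V y \<bullet> frechet_derivative (in_chart c X) (at y) (v i y)) *\<^sub>R v i y)"
  obtain C where C: "compact C" "C \<subseteq> W" "\<And>q. q \<in> topspace T \<Longrightarrow> V q \<noteq> 0 \<Longrightarrow> q \<in> fst c \<and> snd c q \<in> C"
    using sup unfolding supported_def by blast
  have "integral\<^sup>L lborel (\<lambda>x. if x \<in> W then \<Sum>k\<in>UNIV. frechet_derivative (\<lambda>y. dens c y *\<^sub>R \<tau> y) (at x) (axis k 1) $ k else 0) = 0"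
  proof (rule integral_divergence_compact_support[OF fr(2) _ C(1,2)])
    show "C1_on W (\<lambda>y. dens c y *\<^sub>R \<tau> y)"
      unfolding \<tau>_def by (intro C1_on_scaleR C1_dens[OF W] tangential_coordinates(1)[OF W V])
    fix x assume x: "x \<in> W" "x \<notin> C"
    then have x': "x \<in> img c" using fr(3) by blast
    have "V (par c x) = 0"
      using C(3)[of "par c x"] par_in[OF x'] chart_topspace[OF fr(1)] x x' by auto
    then show "dens c x *\<^sub>R \<tau> x = 0" by (simp add: \<tau>_def in_chart_apply)
  qed
  moreover have "(\<lambda>x. if x \<in> W then \<Sum>k\<in>UNIV. frechet_derivative (\<lambda>y. dens c y *\<^sub>R \<tau> y) (at x) (axis k 1) $ k else 0)
     = (\<lambda>y. if y \<in> img c then wdiv V (par c y) * dens c y else 0)"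
  proof
    fix x
    obtain C' where C': "C' \<subseteq> W" "\<And>q. q \<in> topspace T \<Longrightarrow> wdiv V q \<noteq> 0 \<Longrightarrow> q \<in> fst c \<and> snd c q \<in> C'"
      using supported_wdiv[OF fr(1,3) sup] unfolding supported_def by blast
    have "wdiv V (par c x) = 0" if "x \<in> img c" "x \<notin> W"
      using C'(2)[of "par c x"] that C'(1) par_in[OF that(1)] chart_topspace[OF fr(1)] by auto
    then show "(if x \<in> W then \<Sum>k\<in>UNIV. frechet_derivative (\<lambda>y. dens c y *\<^sub>R \<tau> y) (at x) (axis k 1) $ k else 0)
     = (if x \<in> img c then wdiv V (par c x) * dens c x else 0)"
      using coordinate_divergence[OF V W, of x] fr(3) unfolding \<tau>_def by auto
  qed
  ultimately show ?thesis unfolding chart_integral_def by simp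
qed


lemma par_topspace: "c \<in> A \<Longrightarrow> y \<in> img c \<Longrightarrow> par c y \<in> topspace T"
  by (rule subsetD[OF chart_topspace par_in])

subsection \<open>Independence of the chart\<close>

lemma gram_transition:
  assumes c: "c \<in> A" "c' \<in> A" and y: "y \<in> snd c' ` (fst c' \<inter> fst c)"
  defines "B \<equiv> matrix (frechet_derivative (in_chart c' (snd c)) (at y))"
  shows "gram c' y = transpose B ** gram c (in_chart c' (snd c) y) ** B"
proof -
  define p where "p = par c' y"
  have y': "y \<in> img c'" using y by blast
  have p: "p \<in> fst c'" "p \<in> fst c" "snd c' p = y" "snd c p = in_chart c' (snd c) y"
    using y c by (auto simp: p_def in_chart_apply)
  have "linear (frechet_derivative (in_chart c' (snd c)) (at y))"
    by (rule has_derivative_linear[OF C1_onD(1)[OF transition(2)[OF c] y]])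
  then have col: "column k B = frechet_derivative (in_chart c' (snd c)) (at y) (axis k 1)" for k
    unfolding B_def by (simp add: column_def matrix_def vec_eq_iff)
  have "in_chart c' (snd c) y \<in> img c" using p by (metis imageI)
  note lin = linear_dX[OF c(1) this]
  show ?thesis
    unfolding gram_def vec_eq_iff
    by (simp add: bilinear_matrix_entry[OF lin lin] col)
       (use differential_transition[OF c p(2,1)] p(3,4) in \<open>simp add: differential_def\<close>)
qed

lemma dens_transition:
  assumes c: "c \<in> A" "c' \<in> A" and y: "y \<in> snd c' ` (fst c' \<inter> fst c)"
  shows "dens c' y = \<bar>det (matrix (frechet_derivative (in_chart c' (snd c)) (at y)))\<bar> * dens c (in_chart c' (snd c) y)"
proof -
  let ?B = "matrix (frechet_derivative (in_chart c' (snd c)) (at y))"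
  have "det (gram c' y) = (det ?B)\<^sup>2 * det (gram c (in_chart c' (snd c) y))"
    unfolding gram_transition[OF c y] by (simp add: det_mul power2_eq_square mult_ac)
  then have "sqrt (det (gram c' y)) = \<bar>det ?B\<bar> * sqrt (det (gram c (in_chart c' (snd c) y)))"
    by (simp add: real_sqrt_mult)
  then show ?thesis unfolding dens_def using in_chart_transition[OF c y, of X] by simp
qed

text \<open>The densities of two charts differ by the Jacobian of the transition map.\<close>

lemma chart_integral_swap:
  assumes c: "c \<in> A" "c' \<in> A" and g: "continuous_map T euclidean g"
    and sup: "supported c (img c) g" "supported c' (img c') g"
  shows "chart_integral c g = chart_integral c' g"
  unfolding chart_integral_def
proof (rule integral_change_of_variables_compact_support)
  let ?O = "snd c' ` (fst c' \<inter> fst c)"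
  let ?t = "in_chart c' (snd c)"
  have t: "?t (snd c' p) = snd c p" if "p \<in> fst c'" for p using that c by (simp add: in_chart_apply)
  show "open ?O" by (rule transition(1)[OF c])
  show "(?t has_derivative frechet_derivative ?t (at x)) (at x)" if "x \<in> ?O" for x
    by (rule C1_onD(1)[OF transition(2)[OF c] that])
  show "inj_on ?t ?O"
    using chart_inj[OF c(1)] t by (auto simp: inj_on_def)
  show "compactly_supported (\<lambda>y. if y \<in> img c then g (par c y) * dens c y else 0)"
    by (rule chart_integral_compactly_supported[OF c(1) g sup(1)])
  show "compactly_supported (\<lambda>y. if y \<in> img c' then g (par c' y) * dens c' y else 0)"
    by (rule chart_integral_compactly_supported[OF c(2) g sup(2)])
  have nz: "q \<in> fst c" "q \<in> fst c'" if "q \<in> topspace T" "g q \<noteq> 0" for q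
    using sup that unfolding supported_def by blast+
  show "(if y \<in> img c then g (par c y) * dens c y else 0) = 0" if y: "y \<notin> ?t ` ?O" for y
  proof (cases "y \<in> img c \<and> g (par c y) \<noteq> 0")
    case True
    then have p: "par c y \<in> fst c" "snd c (par c y) = y" using par_in[of y c] by simp_all
    then have "par c y \<in> fst c'" using nz(2)[of "par c y"] True par_topspace[OF c(1), of y] by simp
    then have "y \<in> ?t ` ?O" using p t by (intro image_eqI[of _ _ "snd c' (par c y)"]) auto
    then show ?thesis using y by blast
  qed auto
  show "(if x \<in> img c' then g (par c' x) * dens c' x else 0) = 0" if x: "x \<notin> ?O" for x
  proof (cases "x \<in> img c' \<and> g (par c' x) \<noteq> 0")
    case True
    then have p: "par c' x \<in> fst c'" "snd c' (par c' x) = x" using par_in[of x c'] by simp_all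
    then have "par c' x \<in> fst c" using nz(1)[of "par c' x"] True par_topspace[OF c(2), of x] by simp
    then have "x \<in> ?O" using p by (intro image_eqI[of _ _ "par c' x"]) auto
    then show ?thesis using x by blast
  qed auto
  fix x assume x: "x \<in> ?O"
  then obtain p where p: "p \<in> fst c'" "p \<in> fst c" "x = snd c' p" by blast
  then show "(if x \<in> img c' then g (par c' x) * dens c' x else 0)
     = \<bar>det (matrix (frechet_derivative ?t (at x)))\<bar> *
       (if ?t x \<in> img c then g (par c (?t x)) * dens c (?t x) else 0)"
    using dens_transition[OF c x] t c by simp
qed


subsection \<open>Partitions of unity\<close>

lemma supported_mono: "supported c W f \<Longrightarrow> W \<subseteq> W' \<Longrightarrow> supported c W' f"
  unfolding supported_def by blast

lemma supported_imp:
  assumes "supported c W f" "\<And>q. q \<in> topspace T \<Longrightarrow> f q = 0 \<Longrightarrow> g q = 0"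
  shows "supported c W g"
  using assms unfolding supported_def by metis

text \<open>A truncated square in coordinates, extended by zero. The extension is \<open>C\<^sup>1\<close> because compact
  sets of coordinates have closed images in a Hausdorff space.\<close>

lemma bump_exists:
  assumes W: "framed c W v" and p: "p \<in> fst c" "snd c p \<in> W"
  shows "\<exists>b::'p \<Rightarrow> real. C1M b \<and> supported c W b \<and> (\<forall>q. 0 \<le> b q) \<and>
     (\<exists>Q. openin T Q \<and> p \<in> Q \<and> (\<forall>q\<in>Q. 1 \<le> b q))"
proof -
  note fr = framed_props[OF W]
  define y0 where "y0 = snd c p"
  obtain r where r: "r > 0" "cball y0 r \<subseteq> W"
    using fr(2) p(2) unfolding y0_def by (meson open_contains_cball)
  \<comment> \<open>the factor makes \<open>u\<close> at least \<open>1\<close> on the ball of radius \<open>r / 2\<close>\<close>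
  define u where "u = (\<lambda>y. 4 / r ^ 4 * max 0 (r\<^sup>2 - (y - y0) \<bullet> (y - y0)) ^ 2)"
  define b where "b = (\<lambda>q. if q \<in> fst c then u (snd c q) else 0)"
  have u0: "u y = 0" if "y \<notin> cball y0 r" for y
  proof -
    have "r < norm (y - y0)" using that by (simp add: dist_norm norm_minus_commute)
    then have "r\<^sup>2 < (norm (y - y0))\<^sup>2" using r(1) by (intro power_strict_mono) auto
    then show ?thesis unfolding u_def by (simp add: power2_norm_eq_inner)
  qed
  have sup: "supported c W b"
    unfolding supported_def using r(2) u0 by (intro exI[of _ "cball y0 r"]) (auto simp: b_def)
  have C: "closedin T (par c ` cball y0 r)"
    by (rule closed_par_image[OF fr(1) compact_cball]) (use r(2) fr(3) in blast)
  have off: "b q = 0" if "q \<notin> par c ` cball y0 r" for q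
    using u0[of "snd c q"] that par_chart[OF fr(1), of q] unfolding b_def by (metis imageI)
  have C1u: "C1_on UNIV u"
    unfolding u_def
    by (intro C1_on_mult C1_on_const C1_on_truncated_power C1_on_diff C1_on_inner C1_on_id) simp
  have "C1M b"
  proof (rule C1M_local)
    fix q assume q: "q \<in> topspace T"
    show "\<exists>d\<in>A. \<exists>V. open V \<and> V \<subseteq> img d \<and> q \<in> fst d \<and> snd d q \<in> V \<and> C1_on V (in_chart d b)"
    proof (cases "q \<in> fst c")
      case True
      have "C1_on (img c) (in_chart c b)"
        by (rule C1_on_cong[OF C1_on_subset[OF C1u] chart(2)[OF fr(1)]])
           (auto simp: in_chart_apply b_def fr(1))
      then show ?thesis using True chart(2)[OF fr(1)] fr(1) by blast
    next
      case False
      have "par c ` cball y0 r \<subseteq> fst c"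
        by (intro image_subsetI par_in subsetD[OF fr(3)] subsetD[OF r(2)])
      then have q': "q \<notin> par c ` cball y0 r" using False by (rule contra_subsetD)
      obtain d where d: "d \<in> A" "q \<in> fst d" using chart_cover[OF q] by blast
      let ?V = "snd d ` ((topspace T - par c ` cball y0 r) \<inter> fst d)"
      have V: "open ?V" by (rule open_chart_image[OF d(1) openin_diff[OF openin_topspace C]])
      have "C1_on ?V (in_chart d b)"
        by (rule C1_on_cong[OF C1_on_const[of _ 0] V]) (use off d(1) in \<open>auto simp: in_chart_apply\<close>)
      then show ?thesis using V d q q' by blast
    qed
  qed
  moreover have "0 \<le> b q" for q unfolding b_def u_def by simp
  moreover have "\<exists>Q. openin T Q \<and> p \<in> Q \<and> (\<forall>q\<in>Q. 1 \<le> b q)"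
  proof (intro exI conjI ballI)
    let ?B = "ball y0 (r / 2)"
    have B: "?B \<subseteq> img c" using r fr(3) by (auto simp: subset_iff)
    show "openin T (par c ` ?B)" by (rule open_par_image[OF fr(1) open_ball B])
    show "p \<in> par c ` ?B" using r(1) p fr(1) by (intro image_eqI[of _ _ y0]) (auto simp: y0_def)
    fix q assume "q \<in> par c ` ?B"
    then obtain y where y: "y \<in> ?B" "q = par c y" by (rule imageE)
    have y': "y \<in> img c" using B y(1) by blast
    have "norm (y - y0) \<le> r / 2" using y(1) by (simp add: dist_norm norm_minus_commute)
    then have "(norm (y - y0))\<^sup>2 \<le> (r / 2)\<^sup>2" by (intro power_mono) auto
    then have "(y - y0) \<bullet> (y - y0) \<le> r\<^sup>2 / 4"
      unfolding power2_norm_eq_inner by (simp add: power_divide)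
    moreover have "0 \<le> (y - y0) \<bullet> (y - y0)" by simp
    ultimately have "r\<^sup>2 / 2 \<le> r\<^sup>2 - (y - y0) \<bullet> (y - y0)" by linarith
    then have "r\<^sup>2 / 2 \<le> max 0 (r\<^sup>2 - (y - y0) \<bullet> (y - y0))"
      by (rule order_trans) (rule max.cobounded2)
    then have "(r\<^sup>2 / 2)\<^sup>2 \<le> max 0 (r\<^sup>2 - (y - y0) \<bullet> (y - y0)) ^ 2" by (intro power_mono) auto
    then have "4 / r ^ 4 * (r\<^sup>2 / 2)\<^sup>2 \<le> u y" unfolding u_def using r(1) by (intro mult_left_mono) auto
    then have "1 \<le> u y" using r(1) by (simp add: power_divide flip: power_mult)
    then show "1 \<le> b q" using y(2) y' par_in[OF y'] by (simp add: b_def)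
  qed
  ultimately show ?thesis using sup by blast
qed

definition unity_partition :: "'p set \<Rightarrow> ('p \<Rightarrow> ('p, 'n) chart) \<Rightarrow> ('p \<Rightarrow> (real^'n) set) \<Rightarrow>
    ('p \<Rightarrow> 'p \<Rightarrow> real) \<Rightarrow> 'p set \<Rightarrow> bool" where
  "unity_partition P \<kappa> \<Omega> \<eta> K \<longleftrightarrow> finite P \<and>
     (\<forall>i\<in>P. (\<exists>v. framed (\<kappa> i) (\<Omega> i) v) \<and> C1M (\<eta> i) \<and> supported (\<kappa> i) (\<Omega> i) (\<eta> i) \<and>
        (\<forall>q\<in>topspace T. 0 \<le> \<eta> i q)) \<and>
     (\<forall>q\<in>K. (\<Sum>i\<in>P. \<eta> i q) = 1)"

lemma partition_exists:
  assumes "compactin T K" shows "\<exists>P \<kappa> \<Omega> \<eta>. unity_partition P \<kappa> \<Omega> \<eta> K"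
proof -
  have "\<exists>c W b Q. (\<exists>v. framed c W v) \<and> C1M b \<and> supported c W b \<and> (\<forall>q. 0 \<le> (b q::real)) \<and>
     openin T Q \<and> p \<in> Q \<and> (\<forall>q\<in>Q. 1 \<le> b q)" if "p \<in> topspace T" for p
    using frame_obtain[OF that] bump_exists by metis
  then obtain \<kappa> \<Omega> b Q where *: "\<And>p. p \<in> topspace T \<Longrightarrow> (\<exists>v. framed (\<kappa> p) (\<Omega> p) v) \<and> C1M (b p) \<and>
     supported (\<kappa> p) (\<Omega> p) (b p) \<and> (\<forall>q. 0 \<le> (b p q::real)) \<and>
     openin T (Q p) \<and> p \<in> Q p \<and> (\<forall>q\<in>Q p. 1 \<le> b p q)"
    by metis
  have K: "K \<subseteq> topspace T" using assms by (rule compactin_subset_topspace)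
  have "openin T U" if "U \<in> Q ` topspace T" for U using that * by blast
  moreover have "K \<subseteq> \<Union>(Q ` topspace T)" using K * by blast
  ultimately have "\<exists>F. finite F \<and> F \<subseteq> Q ` topspace T \<and> K \<subseteq> \<Union>F"
    by (rule compactinD[OF assms])
  then obtain F where F: "finite F" "F \<subseteq> Q ` topspace T" "K \<subseteq> \<Union>F" by blast
  obtain P where P: "P \<subseteq> topspace T" "finite P" "F = Q ` P"
    using finite_subset_image[OF F(1,2)] by blast
  define s where "s = (\<lambda>q. \<Sum>i\<in>P. b i q)"
  \<comment> \<open>a positive denominator that equals \<open>s\<close> wherever \<open>s \<ge> 1\<close>, in particular on \<open>K\<close>\<close>
  define d where "d = (\<lambda>q. s q + max 0 (1 - s q) ^ 2)"
  define \<eta> where "\<eta> = (\<lambda>i q. b i q / d q)"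
  have s0: "0 \<le> s q" for q unfolding s_def using * P(1) by (intro sum_nonneg) blast
  have d0: "0 < d q" for q
    using s0[of q] unfolding d_def by (cases "s q = 0") (auto intro: add_pos_nonneg)
  have cs: "C1M s" unfolding s_def using * P(1) by (intro C1M_sum) blast
  have cd: "C1M d" unfolding d_def
    by (intro C1M_add cs C1M_truncated_power C1M_diff C1M_const) simp
  have "(\<Sum>i\<in>P. \<eta> i q) = 1" if q: "q \<in> K" for q
  proof -
    obtain i where i: "i \<in> P" "q \<in> Q i" using F(3) P(3) q by blast
    have "1 \<le> b i q" using * i P(1) by blast
    also have "b i q \<le> s q" unfolding s_def using * P i by (intro member_le_sum) auto
    finally have "d q = s q" unfolding d_def by simp
    then show ?thesis
      using d0[of q] unfolding \<eta>_def by (simp add: sum_divide_distrib[symmetric] s_def)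
  qed
  moreover have "C1M (\<eta> i)" if "i \<in> P" for i
    unfolding \<eta>_def using * that P(1) d0 by (intro C1M_divide cd) (blast, metis less_irrefl)
  moreover have "supported (\<kappa> i) (\<Omega> i) (\<eta> i)" if "i \<in> P" for i
    by (rule supported_imp[of _ _ "b i"]) (use * that P(1) in \<open>auto simp: \<eta>_def\<close>)
  moreover have "0 \<le> \<eta> i q" if "i \<in> P" for i q
    unfolding \<eta>_def using * that P(1) less_imp_le[OF d0] by (intro divide_nonneg_nonneg) blast+
  ultimately have "unity_partition P \<kappa> \<Omega> \<eta> K"
    unfolding unity_partition_def using * P(1,2) by blast
  then show ?thesis by blast
qed


subsection \<open>The weighted integral\<close>

text \<open>The functional is meant for functions vanishing outside the set over which \<open>\<eta>\<close> is a partition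
  of unity; on them it does not depend on the partition.\<close>

definition weighted_integral :: "'p set \<Rightarrow> ('p \<Rightarrow> ('p, 'n) chart) \<Rightarrow> ('p \<Rightarrow> 'p \<Rightarrow> real) \<Rightarrow> ('p \<Rightarrow> real) \<Rightarrow> real" where
  "weighted_integral P \<kappa> \<eta> g = (\<Sum>i\<in>P. chart_integral (\<kappa> i) (\<lambda>q. \<eta> i q * g q))"

lemma chart_integral_integrable:
  assumes "c \<in> A" "continuous_map T euclidean g" "supported c (img c) g"
  shows "integrable lborel (\<lambda>y. if y \<in> img c then g (par c y) * dens c y else 0)"
  by (rule compactly_supported_integrable[OF chart_integral_compactly_supported[OF assms]])

lemma chart_integral_sum:
  assumes "c \<in> A" "\<And>i. i \<in> P \<Longrightarrow> continuous_map T euclidean (g i)" "\<And>i. i \<in> P \<Longrightarrow> supported c (img c) (g i)"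
  shows "chart_integral c (\<lambda>q. \<Sum>i\<in>P. g i q) = (\<Sum>i\<in>P. chart_integral c (g i))"
proof -
  have "(\<Sum>i\<in>P. chart_integral c (g i)) = integral\<^sup>L lborel (\<lambda>y. \<Sum>i\<in>P. if y \<in> img c then g i (par c y) * dens c y else 0)"
    unfolding chart_integral_def by (rule Bochner_Integration.integral_sum[symmetric]) (rule chart_integral_integrable[OF assms])
  also have "(\<lambda>y. \<Sum>i\<in>P. if y \<in> img c then g i (par c y) * dens c y else 0)
     = (\<lambda>y. if y \<in> img c then (\<Sum>i\<in>P. g i (par c y)) * dens c y else 0)"
    by (auto simp: sum_distrib_right)
  finally show ?thesis unfolding chart_integral_def by simp
qed

lemma chart_integral_cong:
  assumes "c \<in> A" "\<And>q. q \<in> topspace T \<Longrightarrow> f q = g q" shows "chart_integral c f = chart_integral c g"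
proof -
  have "f (par c y) = g (par c y)" if "y \<in> img c" for y
    using assms par_in[OF that] chart_topspace by blast
  then have "(\<lambda>y. if y \<in> img c then f (par c y) * dens c y else 0) = (\<lambda>y. if y \<in> img c then g (par c y) * dens c y else 0)"
    by auto
  then show ?thesis unfolding chart_integral_def by simp
qed

context
  fixes P \<kappa> \<Omega> \<eta> K
  assumes part: "unity_partition P \<kappa> \<Omega> \<eta> K"
begin

lemma partition_props:
  assumes "i \<in> P"
  shows "\<exists>v. framed (\<kappa> i) (\<Omega> i) v" "\<kappa> i \<in> A" "\<Omega> i \<subseteq> img (\<kappa> i)" "C1M (\<eta> i)" "supported (\<kappa> i) (\<Omega> i) (\<eta> i)"
    "supported (\<kappa> i) (img (\<kappa> i)) (\<eta> i)" "\<And>q. q \<in> topspace T \<Longrightarrow> 0 \<le> \<eta> i q" "continuous_map T euclidean (\<eta> i)"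
proof -
  show *: "\<exists>v. framed (\<kappa> i) (\<Omega> i) v" "C1M (\<eta> i)" "supported (\<kappa> i) (\<Omega> i) (\<eta> i)" "\<And>q. q \<in> topspace T \<Longrightarrow> 0 \<le> \<eta> i q"
    using part assms unfolding unity_partition_def by blast+
  show "\<kappa> i \<in> A" "\<Omega> i \<subseteq> img (\<kappa> i)" using *(1) framed_props by blast+
  then show "supported (\<kappa> i) (img (\<kappa> i)) (\<eta> i)" using *(3) supported_mono by blast
  show "continuous_map T euclidean (\<eta> i)" by (rule C1M_continuous[OF *(2)])
qed

lemma finite_P: "finite P" and sum_partition: "q \<in> K \<Longrightarrow> (\<Sum>i\<in>P. \<eta> i q) = 1"
  using part unfolding unity_partition_def by auto

lemma supported_mult:
  assumes "i \<in> P" shows "supported (\<kappa> i) (img (\<kappa> i)) (\<lambda>q. \<eta> i q * g q)"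
    "supported (\<kappa> i) (img (\<kappa> i)) (\<lambda>q. h q * (\<eta> i q * g q))"
  by (rule supported_imp[OF partition_props(6)[OF assms]], simp)+

lemma cont_mult:
  assumes "i \<in> P" "continuous_map T euclidean g" shows "continuous_map T euclidean (\<lambda>q. \<eta> i q * g q :: real)"
  using partition_props(8)[OF assms(1)] assms(2) by (intro continuous_intros)

lemma weighted_integral_add:
  assumes "continuous_map T euclidean f" "continuous_map T euclidean g"
  shows "weighted_integral P \<kappa> \<eta> (\<lambda>q. f q + g q) = weighted_integral P \<kappa> \<eta> f + weighted_integral P \<kappa> \<eta> g"
  unfolding weighted_integral_def sum.distrib[symmetric]
proof (rule sum.cong[OF refl])
  fix i assume i: "i \<in> P"
  have "(\<lambda>y. if y \<in> img (\<kappa> i) then \<eta> i (par (\<kappa> i) y) * (f (par (\<kappa> i) y) + g (par (\<kappa> i) y)) * dens (\<kappa> i) y else 0)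
     = (\<lambda>y. (if y \<in> img (\<kappa> i) then \<eta> i (par (\<kappa> i) y) * f (par (\<kappa> i) y) * dens (\<kappa> i) y else 0)
       + (if y \<in> img (\<kappa> i) then \<eta> i (par (\<kappa> i) y) * g (par (\<kappa> i) y) * dens (\<kappa> i) y else 0))"
    by (auto simp: algebra_simps)
  then show "chart_integral (\<kappa> i) (\<lambda>q. \<eta> i q * (f q + g q)) = chart_integral (\<kappa> i) (\<lambda>q. \<eta> i q * f q) + chart_integral (\<kappa> i) (\<lambda>q. \<eta> i q * g q)"
    unfolding chart_integral_def
    using Bochner_Integration.integral_add[OF
        chart_integral_integrable[OF partition_props(2)[OF i] cont_mult[OF i assms(1)] supported_mult(1)[OF i]]
        chart_integral_integrable[OF partition_props(2)[OF i] cont_mult[OF i assms(2)] supported_mult(1)[OF i]]]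
    by simp
qed

lemma weighted_integral_scale: "weighted_integral P \<kappa> \<eta> (\<lambda>q. a * g q) = a * weighted_integral P \<kappa> \<eta> g"
  unfolding weighted_integral_def sum_distrib_left
proof (rule sum.cong[OF refl])
  fix i
  have "(\<lambda>y. if y \<in> img (\<kappa> i) then \<eta> i (par (\<kappa> i) y) * (a * g (par (\<kappa> i) y)) * dens (\<kappa> i) y else 0)
     = (\<lambda>y. a * (if y \<in> img (\<kappa> i) then \<eta> i (par (\<kappa> i) y) * g (par (\<kappa> i) y) * dens (\<kappa> i) y else 0))"
    by auto
  then show "chart_integral (\<kappa> i) (\<lambda>q. \<eta> i q * (a * g q)) = a * chart_integral (\<kappa> i) (\<lambda>q. \<eta> i q * g q)"
    unfolding chart_integral_def by simp
qed

lemma chart_integral_integrand_nonneg: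
  assumes i: "i \<in> P" and g: "\<forall>q\<in>topspace T. 0 \<le> g q"
  shows "0 \<le> (if y \<in> img (\<kappa> i) then \<eta> i (par (\<kappa> i) y) * g (par (\<kappa> i) y) * dens (\<kappa> i) y else 0)"
proof (cases "y \<in> img (\<kappa> i)")
  case True
  have p: "par (\<kappa> i) y \<in> topspace T" by (rule par_topspace[OF partition_props(2)[OF i] True])
  have "0 \<le> \<eta> i (par (\<kappa> i) y) * dens (\<kappa> i) y"
  proof (cases "\<eta> i (par (\<kappa> i) y) = 0")
    case False
    then have "snd (\<kappa> i) (par (\<kappa> i) y) \<in> \<Omega> i"
      using partition_props(5)[OF i] p unfolding supported_def by blast
    then have "y \<in> \<Omega> i" using True by simp
    then have "dens (\<kappa> i) y > 0" using dens_pos partition_props(1)[OF i] by blast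
    then show ?thesis using partition_props(7)[OF i p] by simp
  qed simp
  then have "0 \<le> (\<eta> i (par (\<kappa> i) y) * dens (\<kappa> i) y) * g (par (\<kappa> i) y)" using bspec[OF g p] by (rule mult_nonneg_nonneg)
  then show ?thesis using True by (simp add: mult_ac)
qed simp

lemma weighted_integral_nonneg:
  assumes "\<forall>q\<in>topspace T. 0 \<le> g q" shows "0 \<le> weighted_integral P \<kappa> \<eta> g"
  unfolding weighted_integral_def chart_integral_def using chart_integral_integrand_nonneg[OF _ assms]
  by (intro sum_nonneg Bochner_Integration.integral_nonneg) auto

lemma weighted_integral_mono:
  assumes "continuous_map T euclidean f" "continuous_map T euclidean g"
    and "\<And>q. q \<in> topspace T \<Longrightarrow> f q \<le> g q"
  shows "weighted_integral P \<kappa> \<eta> f \<le> weighted_integral P \<kappa> \<eta> g"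
proof -
  have "0 \<le> weighted_integral P \<kappa> \<eta> (\<lambda>q. g q + (- 1) * f q)" using assms(3) by (intro weighted_integral_nonneg) simp
  also have "\<dots> = weighted_integral P \<kappa> \<eta> g + weighted_integral P \<kappa> \<eta> (\<lambda>q. (- 1) * f q)"
    by (rule weighted_integral_add[OF assms(2)]) (use assms(1) in \<open>auto intro!: continuous_intros\<close>)
  finally show ?thesis unfolding weighted_integral_scale by simp
qed

lemma weighted_integral_eq_0D:
  assumes g: "continuous_map T euclidean g" "\<forall>q\<in>topspace T. 0 \<le> g q"
    and 0: "weighted_integral P \<kappa> \<eta> g = 0" and q: "q \<in> K" "q \<in> topspace T"
  shows "g q = 0"
proof -
  obtain i where i: "i \<in> P" "\<eta> i q \<noteq> 0"
    using sum_partition[OF q(1)] by (metis sum.neutral zero_neq_one)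
  let ?f = "\<lambda>y. if y \<in> img (\<kappa> i) then \<eta> i (par (\<kappa> i) y) * g (par (\<kappa> i) y) * dens (\<kappa> i) y else 0"
  have "chart_integral (\<kappa> i) (\<lambda>q. \<eta> i q * g q) = 0"
  proof -
    have "0 \<le> chart_integral (\<kappa> k) (\<lambda>q. \<eta> k q * g q)" if "k \<in> P" for k
      unfolding chart_integral_def using chart_integral_integrand_nonneg[OF that g(2)] by (intro Bochner_Integration.integral_nonneg) auto
    then show ?thesis
      using 0 sum_nonneg_eq_0_iff[OF finite_P, of "\<lambda>k. chart_integral (\<kappa> k) (\<lambda>q. \<eta> k q * g q)"] i(1)
      unfolding weighted_integral_def by blast
  qed
  then have "?f (snd (\<kappa> i) q) = 0"
    unfolding chart_integral_def
    using chart_integral_integrand_nonneg[OF i(1) g(2)] chart_integral_compactly_supported[OF partition_props(2)[OF i(1)]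
        cont_mult[OF i(1) g(1)] supported_mult(1)[OF i(1)]]
    by (intro integral_nonneg_eq_0D[of ?f]) auto
  moreover have "q \<in> fst (\<kappa> i)" "snd (\<kappa> i) q \<in> \<Omega> i"
    using partition_props(5)[OF i(1)] i(2) q(2) unfolding supported_def by blast+
  moreover have "dens (\<kappa> i) (snd (\<kappa> i) q) > 0"
    using dens_pos partition_props(1)[OF i(1)] calculation(3) by blast
  ultimately show ?thesis using i(2) partition_props(2)[OF i(1)] by simp
qed

end

text \<open>The order of summation over two partitions of unity can be exchanged since the chart
  integrals of functions supported in both charts agree.\<close>

lemma weighted_integral_independent:
  assumes P: "unity_partition P \<kappa> \<Omega> \<eta> K" and P': "unity_partition P' \<kappa>' \<Omega>' \<eta>' K'"
    and g: "continuous_map T euclidean g" "\<And>q. q \<in> topspace T \<Longrightarrow> g q \<noteq> 0 \<Longrightarrow> q \<in> K \<and> q \<in> K'"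
  shows "weighted_integral P \<kappa> \<eta> g = weighted_integral P' \<kappa>' \<eta>' g"
proof -
  have c2: "continuous_map T euclidean (\<lambda>q. \<eta>' k q * (\<eta> i q * g q))" if "i \<in> P" "k \<in> P'" for i k
    by (intro cont_mult[OF P'] cont_mult[OF P] g that)
  have s2: "supported (\<kappa> i) (img (\<kappa> i)) (\<lambda>q. \<eta>' k q * (\<eta> i q * g q))"
    "supported (\<kappa>' k) (img (\<kappa>' k)) (\<lambda>q. \<eta>' k q * (\<eta> i q * g q))" if "i \<in> P" "k \<in> P'" for i k
    using supported_mult(2)[OF P that(1), of "\<eta>' k" g]
      supported_mult(1)[OF P' that(2), of "\<lambda>q. \<eta> i q * g q"] by blast+
  have "weighted_integral P \<kappa> \<eta> g = (\<Sum>i\<in>P. \<Sum>k\<in>P'. chart_integral (\<kappa> i) (\<lambda>q. \<eta>' k q * (\<eta> i q * g q)))"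
    unfolding weighted_integral_def
  proof (rule sum.cong[OF refl])
    fix i assume i: "i \<in> P"
    have "chart_integral (\<kappa> i) (\<lambda>q. \<eta> i q * g q) = chart_integral (\<kappa> i) (\<lambda>q. \<Sum>k\<in>P'. \<eta>' k q * (\<eta> i q * g q))"
      using partition_props(2)[OF P i] g(2) sum_partition[OF P']
      by (intro chart_integral_cong) (auto simp: sum_distrib_right[symmetric])
    also have "\<dots> = (\<Sum>k\<in>P'. chart_integral (\<kappa> i) (\<lambda>q. \<eta>' k q * (\<eta> i q * g q)))"
      by (rule chart_integral_sum[OF partition_props(2)[OF P i] c2[OF i] s2(1)[OF i]])
    finally show "chart_integral (\<kappa> i) (\<lambda>q. \<eta> i q * g q) = (\<Sum>k\<in>P'. chart_integral (\<kappa> i) (\<lambda>q. \<eta>' k q * (\<eta> i q * g q)))" .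
  qed
  also have "\<dots> = (\<Sum>i\<in>P. \<Sum>k\<in>P'. chart_integral (\<kappa>' k) (\<lambda>q. \<eta>' k q * (\<eta> i q * g q)))"
    by (intro sum.cong refl chart_integral_swap partition_props(2)[OF P] partition_props(2)[OF P'] c2 s2)
  also have "\<dots> = (\<Sum>k\<in>P'. \<Sum>i\<in>P. chart_integral (\<kappa>' k) (\<lambda>q. \<eta>' k q * (\<eta> i q * g q)))"
    by (rule sum.swap)
  also have "\<dots> = weighted_integral P' \<kappa>' \<eta>' g"
    unfolding weighted_integral_def
  proof (rule sum.cong[OF refl])
    fix k assume k: "k \<in> P'"
    have "(\<Sum>i\<in>P. chart_integral (\<kappa>' k) (\<lambda>q. \<eta>' k q * (\<eta> i q * g q))) = chart_integral (\<kappa>' k) (\<lambda>q. \<Sum>i\<in>P. \<eta>' k q * (\<eta> i q * g q))"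
      by (rule chart_integral_sum[symmetric, OF partition_props(2)[OF P' k] c2[OF _ k] s2(2)[OF _ k]])
    also have "\<dots> = chart_integral (\<kappa>' k) (\<lambda>q. \<eta>' k q * g q)"
      using partition_props(2)[OF P' k] g(2) sum_partition[OF P]
      by (intro chart_integral_cong) (auto simp: sum_distrib_left[symmetric] sum_distrib_right[symmetric])
    finally show "(\<Sum>i\<in>P. chart_integral (\<kappa>' k) (\<lambda>q. \<eta>' k q * (\<eta> i q * g q))) = chart_integral (\<kappa>' k) (\<lambda>q. \<eta>' k q * g q)" .
  qed
  finally show ?thesis .
qed

lemma wdiv_continuous:
  assumes "C1M V" shows "continuous_map T euclidean (wdiv V)"
  unfolding wdiv_def
  using tdiv_continuous[OF assms] C1M_continuous[OF C1M_inner[OF C1M_X assms]]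
  by (intro continuous_intros) auto

lemma wdiv_sum:
  assumes "finite P" "\<And>i. i \<in> P \<Longrightarrow> C1M (V i)" "p \<in> topspace T"
  shows "wdiv (\<lambda>q. \<Sum>i\<in>P. V i q) p = (\<Sum>i\<in>P. wdiv (V i) p)"
  using assms(1,2)
proof (induction P)
  case empty
  show ?case using wdiv_eq_0[OF openin_topspace assms(3)] by simp
next
  case (insert i P)
  have "tder (\<lambda>q. V i q + (\<Sum>i\<in>P. V i q)) (\<lambda>x. tderiv (V i) p x + tderiv (\<lambda>q. \<Sum>i\<in>P. V i q) p x) p"
    using insert.prems by (intro tder_add tder_tderiv assms(3) C1M_sum) auto
  from tdiv_eq[OF this assms(3)]
  have "wdiv (\<lambda>q. V i q + (\<Sum>i\<in>P. V i q)) p = wdiv (V i) p + wdiv (\<lambda>q. \<Sum>i\<in>P. V i q) p"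
    by (simp add: wdiv_def tdiv_def sum.distrib inner_add_right field_simps)
  then show ?case using insert by simp
qed

text \<open>Cutting the field into pieces supported in single charts, and exchanging the two summations over
  the partition, reduces the claim to one chart at a time.\<close>

theorem divergence_theorem:
  assumes P: "unity_partition P \<kappa> \<Omega> \<eta> K" and K: "closedin T K" and V: "C1M V" "tangential V"
    and off: "\<And>q. q \<in> topspace T \<Longrightarrow> q \<notin> K \<Longrightarrow> V q = 0"
  shows "weighted_integral P \<kappa> \<eta> (wdiv V) = 0"
proof -
  define U where "U = (\<lambda>k q. \<eta> k q *\<^sub>R V q)"
  have U: "C1M (U k)" "tangential (U k)" "supported (\<kappa> k) (\<Omega> k) (U k)" if "k \<in> P" for k
  proof -
    show "C1M (U k)" unfolding U_def by (intro C1M_scaleR V(1) partition_props(4)[OF P that])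
    show "tangential (U k)" using V(2) unfolding U_def tangential_def by simp
    show "supported (\<kappa> k) (\<Omega> k) (U k)"
      by (rule supported_imp[OF partition_props(5)[OF P that]]) (simp add: U_def)
  qed
  have oK: "openin T (topspace T - K)" using K by blast
  have U0: "wdiv (U k) q = 0" if "q \<in> topspace T" "q \<notin> K" for k q
    by (rule wdiv_eq_0[OF oK]) (use that off in \<open>auto simp: U_def\<close>)
  have Vsum: "wdiv V q = (\<Sum>k\<in>P. wdiv (U k) q)" if "q \<in> topspace T" for q
  proof -
    have "wdiv (\<lambda>q. \<Sum>k\<in>P. U k q) q = (\<Sum>k\<in>P. wdiv (U k) q)"
      by (rule wdiv_sum[OF finite_P[OF P] U(1) that])
    moreover have VU: "V q = (\<Sum>k\<in>P. U k q)" if "q \<in> topspace T" for q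
    proof (cases "q \<in> K")
      case True
      then show ?thesis
        using sum_partition[OF P True] by (simp add: U_def scaleR_sum_left[symmetric])
    qed (use off that in \<open>simp add: U_def\<close>)
    have "tder V D q \<longleftrightarrow> tder (\<lambda>q. \<Sum>k\<in>P. U k q) D q" for D
    proof
      show "tder (\<lambda>q. \<Sum>k\<in>P. U k q) D q" if "tder V D q"
        using that by (rule tder_cong) (rule VU)
      show "tder V D q" if "tder (\<lambda>q. \<Sum>k\<in>P. U k q) D q"
        using that by (rule tder_cong) (rule VU[symmetric])
    qed
    then have "wdiv V q = wdiv (\<lambda>q. \<Sum>k\<in>P. U k q) q"
      using VU[OF that] by (simp add: wdiv_def tdiv_def tderiv_def)
    ultimately show ?thesis by simp
  qed
  have sw: "supported (\<kappa> k) (img (\<kappa> k)) (wdiv (U k))" if "k \<in> P" for k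
    using supported_mono[OF supported_wdiv[OF partition_props(2,3)[OF P that] U(3)[OF that]] partition_props(3)[OF P that]] .
  have s1: "supported (\<kappa> k) (img (\<kappa> k)) (\<lambda>q. \<eta> i q * wdiv (U k) q)" if "k \<in> P" for i k
    by (rule supported_imp[OF sw[OF that]]) simp
  have ct: "continuous_map T euclidean (\<lambda>q. \<eta> i q * wdiv (U k) q)" if "i \<in> P" "k \<in> P" for i k
    by (rule cont_mult[OF P that(1) wdiv_continuous[OF U(1)[OF that(2)]]])
  have "weighted_integral P \<kappa> \<eta> (wdiv V) = (\<Sum>i\<in>P. \<Sum>k\<in>P. chart_integral (\<kappa> i) (\<lambda>q. \<eta> i q * wdiv (U k) q))"
    unfolding weighted_integral_def
  proof (rule sum.cong[OF refl])
    fix i assume i: "i \<in> P"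
    have "chart_integral (\<kappa> i) (\<lambda>q. \<eta> i q * wdiv V q) = chart_integral (\<kappa> i) (\<lambda>q. \<Sum>k\<in>P. \<eta> i q * wdiv (U k) q)"
      by (rule chart_integral_cong[OF partition_props(2)[OF P i]]) (simp add: Vsum sum_distrib_left)
    also have "\<dots> = (\<Sum>k\<in>P. chart_integral (\<kappa> i) (\<lambda>q. \<eta> i q * wdiv (U k) q))"
      by (rule chart_integral_sum[OF partition_props(2)[OF P i] ct[OF i] supported_mult(1)[OF P i]])
    finally show "chart_integral (\<kappa> i) (\<lambda>q. \<eta> i q * wdiv V q) = (\<Sum>k\<in>P. chart_integral (\<kappa> i) (\<lambda>q. \<eta> i q * wdiv (U k) q))" .
  qed
  also have "\<dots> = (\<Sum>i\<in>P. \<Sum>k\<in>P. chart_integral (\<kappa> k) (\<lambda>q. \<eta> i q * wdiv (U k) q))"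
    by (intro sum.cong refl chart_integral_swap partition_props(2)[OF P] ct s1 supported_mult(1)[OF P])
  also have "\<dots> = (\<Sum>k\<in>P. \<Sum>i\<in>P. chart_integral (\<kappa> k) (\<lambda>q. \<eta> i q * wdiv (U k) q))"
    by (rule sum.swap)
  also have "\<dots> = (\<Sum>k\<in>P. chart_integral (\<kappa> k) (wdiv (U k)))"
  proof (rule sum.cong[OF refl])
    fix k assume k: "k \<in> P"
    have "(\<Sum>i\<in>P. chart_integral (\<kappa> k) (\<lambda>q. \<eta> i q * wdiv (U k) q)) = chart_integral (\<kappa> k) (\<lambda>q. \<Sum>i\<in>P. \<eta> i q * wdiv (U k) q)"
      by (rule chart_integral_sum[symmetric, OF partition_props(2)[OF P k] ct[OF _ k] s1[OF k]])
    also have "\<dots> = chart_integral (\<kappa> k) (wdiv (U k))"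
    proof (rule chart_integral_cong[OF partition_props(2)[OF P k]])
      fix q assume q: "q \<in> topspace T"
      show "(\<Sum>i\<in>P. \<eta> i q * wdiv (U k) q) = wdiv (U k) q"
        using U0[OF q, of k] sum_partition[OF P, of q]
        by (cases "q \<in> K") (simp_all add: sum_distrib_right[symmetric])
    qed
    finally show "(\<Sum>i\<in>P. chart_integral (\<kappa> k) (\<lambda>q. \<eta> i q * wdiv (U k) q)) = chart_integral (\<kappa> k) (wdiv (U k))" .
  qed
  also have "\<dots> = 0"
  proof (rule sum.neutral, rule ballI)
    fix k assume k: "k \<in> P"
    obtain v where "framed (\<kappa> k) (\<Omega> k) v" using partition_props(1)[OF P k] by blast
    then show "chart_integral (\<kappa> k) (wdiv (U k)) = 0" by (rule chart_integral_wdiv[OF U(1,2)[OF k] _ U(3)[OF k]])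
  qed
  finally show ?thesis .
qed

end

section \<open>Parabolicity\<close>

locale lambda_hypersurface = framed_hypersurface T A X N
  for T :: "'p topology" and A :: "('p, 'n::finite) chart set" and X N :: "'p \<Rightarrow> real ^ 'm::finite" +
  fixes l :: real
  assumes tr_shape: "p \<in> topspace T \<Longrightarrow> tr_shape p = (X p \<bullet> N p) / 2 - l"
    and proper: "proper_map T euclidean X"
begin

text \<open>For the weighted divergence the derivative of the mean curvature cancels: this is the
  harmonicity of the Gauss map.\<close>

lemma wdiv_shape:
  assumes V: "C1M V" "tangential V" and p: "p \<in> topspace T"
  shows "wdiv (\<lambda>q. shape q (V q)) p = (\<Sum>a\<in>UNIV. shape p (axis a 1) \<bullet> tderiv V p (axis a 1))"
proof -
  have "tder (\<lambda>q. (1/2) * (X q \<bullet> N q) - l)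
      (\<lambda>v. (1/2) * (X p \<bullet> shape p v + (v - (v \<bullet> N p) *\<^sub>R N p) \<bullet> N p) + 0 * (X p \<bullet> N p) - 0) p"
    by (intro tder_diff tder_mult tder_inner tder_const tder_X tder_N p)
  then have "tder tr_shape (\<lambda>v. (1/2) * (X p \<bullet> shape p v + (v - (v \<bullet> N p) *\<^sub>R N p) \<bullet> N p) + 0 * (X p \<bullet> N p) - 0) p"
    by (rule tder_cong) (simp add: tr_shape)
  from tdiv_shape[OF V p this] show ?thesis
    using V(2) p N_unit[OF p] by (simp add: wdiv_def tangential_def inner_diff_left)
qed

lemma sum_axis_linear:
  fixes F :: "real^'m \<Rightarrow> 'b::real_vector"
  assumes "linear F" shows "(\<Sum>a\<in>UNIV. w $ a *\<^sub>R F (axis a 1)) = F w"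
proof -
  have "F (\<Sum>a\<in>UNIV. w $ a *\<^sub>R axis a 1) = (\<Sum>a\<in>UNIV. w $ a *\<^sub>R F (axis a 1))"
    using assms by (simp add: linear_sum linear_scale)
  moreover have "(\<Sum>a\<in>UNIV. w $ a *\<^sub>R axis a 1) = w"
    using basis_expansion[of w] by (simp add: scalar_mult_eq_scaleR)
  ultimately show ?thesis by simp
qed

lemma wdiv_scaleR:
  assumes f: "tder f f' p" and V: "C1M V" and p: "p \<in> topspace T"
  shows "wdiv (\<lambda>q. f q *\<^sub>R V q) p = f p * wdiv V p + f' (V p)"
proof -
  have "tdiv (\<lambda>q. f q *\<^sub>R V q) p = (\<Sum>a\<in>UNIV. (f p *\<^sub>R tderiv V p (axis a 1) + f' (axis a 1) *\<^sub>R V p) $ a)"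
    by (rule tdiv_eq[OF tder_scaleR[OF f tder_tderiv[OF V p]] p])
  also have "\<dots> = f p * tdiv V p + (\<Sum>a\<in>UNIV. V p $ a *\<^sub>R f' (axis a 1))"
    by (simp add: tdiv_def sum.distrib sum_distrib_left mult.commute)
  finally show ?thesis
    unfolding sum_axis_linear[OF tderD(2)[OF f]] by (simp add: wdiv_def algebra_simps)
qed

definition tanX :: "'p \<Rightarrow> real^'m" where
  "tanX q = X q - (X q \<bullet> N q) *\<^sub>R N q"

lemma C1M_tanX: "C1M tanX"
  unfolding tanX_def by (intro C1M_diff C1M_scaleR C1M_inner C1M_X C1M_N)

lemma tangential_tanX: "tangential tanX"
  unfolding tangential_def tanX_def using N_unit by (simp add: inner_diff_left)

lemma X_tangential: "tangential V \<Longrightarrow> p \<in> topspace T \<Longrightarrow> X p \<bullet> V p = tanX p \<bullet> V p"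
  by (simp add: tangential_def tanX_def inner_diff_left inner_commute[of "N p" "V p"])

lemma wdiv_tanX:
  assumes p: "p \<in> topspace T"
  shows "wdiv tanX p = CARD('n) + l * (X p \<bullet> N p) - (X p \<bullet> X p) / 2"
proof -
  let ?P = "\<lambda>v. v - (v \<bullet> N p) *\<^sub>R N p"
  have D: "tder tanX (\<lambda>v. ?P v - ((X p \<bullet> N p) *\<^sub>R shape p v + (X p \<bullet> shape p v + ?P v \<bullet> N p) *\<^sub>R N p)) p"
    unfolding tanX_def by (intro tder_diff tder_scaleR tder_inner tder_X tder_N p)
  have PN: "?P v \<bullet> N p = 0" for v using N_unit[OF p] by (simp add: inner_diff_left)
  have "(\<Sum>a\<in>UNIV. (X p \<bullet> shape p (axis a 1)) * N p $ a) = X p \<bullet> shape p (N p)"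
    using sum_axis_linear[OF shape_linear[OF p], of "N p"]
    by (metis (no_types, lifting) inner_scaleR_right inner_sum_right mult.commute sum.cong)
  then have 1: "(\<Sum>a\<in>UNIV. (X p \<bullet> shape p (axis a 1)) * N p $ a) = 0" using shape_N[OF p] by simp
  have 2: "(\<Sum>a\<in>UNIV. (axis a 1 \<bullet> N p) * N p $ a) = 1"
    using N_unit[OF p] by (simp add: inner_axis' inner_vec_def[of "N p" "N p"])
  have 3: "(\<Sum>a\<in>UNIV. shape p (axis a 1) $ a) = (X p \<bullet> N p) / 2 - l"
    using tr_shape[OF p] by (simp add: tr_shape_def tdiv_def shape_def)
  have "tdiv tanX p = (\<Sum>a\<in>UNIV. axis a (1::real) $ (a::'m)) - (\<Sum>a\<in>UNIV. (axis a 1 \<bullet> N p) * N p $ a)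
     - ((X p \<bullet> N p) * (\<Sum>a\<in>UNIV. shape p (axis a 1) $ a) + (\<Sum>a\<in>UNIV. (X p \<bullet> shape p (axis a 1)) * N p $ a))"
    unfolding tdiv_eq[OF D p] PN by (simp add: sum_subtractf sum.distrib sum_distrib_left)
  also have "(\<Sum>a\<in>UNIV. axis a (1::real) $ (a::'m)) = CARD('m)" by simp
  also have "CARD('m) = CARD('n) + 1" by (simp add: codim_one)
  finally show ?thesis
    unfolding 1 2 3 wdiv_def tanX_def by (simp add: inner_diff_right field_simps)
qed

definition \<gamma> :: "'p \<Rightarrow> real" where "\<gamma> q = X q \<bullet> X q"

definition \<Phi> :: "real \<Rightarrow> 'p \<Rightarrow> real" where "\<Phi> R q = max 0 (R - \<gamma> q)"

definition sublevel :: "real \<Rightarrow> 'p set" where "sublevel R = {q \<in> topspace T. \<gamma> q \<le> R}"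

lemma \<gamma>_nonneg: "0 \<le> \<gamma> q" by (simp add: \<gamma>_def)

lemma C1M_\<gamma>: "C1M \<gamma>" unfolding \<gamma>_def by (intro C1M_inner C1M_X)

lemma compact_sublevel: "0 \<le> R \<Longrightarrow> compactin T (sublevel R)"
proof -
  assume R: "0 \<le> R"
  have "compactin T {q \<in> topspace T. X q \<in> cball 0 (sqrt R)}"
    by (rule compactin_proper_map_preimage[OF proper]) simp
  moreover have "{q \<in> topspace T. X q \<in> cball 0 (sqrt R)} = sublevel R"
    unfolding sublevel_def \<gamma>_def by (auto simp: norm_eq_sqrt_inner)
  ultimately show ?thesis by simp
qed

lemma tder_\<Phi>:
  assumes p: "p \<in> topspace T"
  shows "tder (\<lambda>q. \<Phi> R q ^ Suc (Suc k))
     (\<lambda>v. ((real k + 2) * \<Phi> R p ^ Suc k) * (0 - (X p \<bullet> (v - (v \<bullet> N p) *\<^sub>R N p) + (v - (v \<bullet> N p) *\<^sub>R N p) \<bullet> X p))) p"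
  unfolding \<Phi>_def
proof (rule tder_real_compose[where h="\<lambda>t. max 0 t ^ Suc (Suc k)" and f="\<lambda>q. R - \<gamma> q"])
  show "((\<lambda>t. max 0 t ^ Suc (Suc k)) has_real_derivative (real k + 2) * max 0 (R - \<gamma> p) ^ Suc k) (at (R - \<gamma> p))"
    by (rule DERIV_truncated_power)
  show "tder (\<lambda>q. R - \<gamma> q) (\<lambda>v. 0 - (X p \<bullet> (v - (v \<bullet> N p) *\<^sub>R N p) + (v - (v \<bullet> N p) *\<^sub>R N p) \<bullet> X p)) p"
    unfolding \<gamma>_def by (intro tder_diff tder_const tder_inner tder_X p)
qed

lemma C1M_\<Phi>: "2 \<le> k \<Longrightarrow> C1M (\<lambda>q. \<Phi> R q ^ k)"
  unfolding \<Phi>_def by (intro C1M_truncated_power C1M_diff C1M_const C1M_\<gamma>)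

lemma \<Phi>_continuous: "continuous_map T euclidean (\<Phi> R)"
proof -
  have "continuous_map T euclidean ((\<lambda>t. max 0 (R - t)) \<circ> \<gamma>)"
    by (rule continuous_map_compose[OF C1M_continuous[OF C1M_\<gamma>]]) (simp add: continuous_intros)
  then show ?thesis by (simp add: \<Phi>_def[abs_def] o_def)
qed

lemma wdiv_\<Phi>:
  assumes V: "C1M V" "tangential V" and p: "p \<in> topspace T"
  shows "wdiv (\<lambda>q. \<Phi> R q ^ Suc (Suc k) *\<^sub>R V q) p
     = \<Phi> R p ^ Suc (Suc k) * wdiv V p - 2 * (real k + 2) * \<Phi> R p ^ Suc k * (tanX p \<bullet> V p)"
proof -
  have "V p \<bullet> N p = 0" using V(2) p by (simp add: tangential_def)
  then show ?thesis
    using X_tangential[OF V(2) p] unfolding wdiv_scaleR[OF tder_\<Phi>[OF p] V(1) p]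
    by (simp add: inner_commute algebra_simps)
qed

lemma wdiv_tanX_le:
  assumes p: "p \<in> topspace T"
  shows "4 * wdiv tanX p \<le> \<Phi> (4 * (CARD('n) + l\<^sup>2)) p"
proof -
  have cs: "\<bar>X p \<bullet> N p\<bar> \<le> norm (X p)"
    using Cauchy_Schwarz_ineq2[of "X p" "N p"] unit_N[OF p] by simp
  have "l * (X p \<bullet> N p) \<le> \<bar>l * (X p \<bullet> N p)\<bar>" by (rule abs_ge_self)
  also have "\<dots> \<le> \<bar>l\<bar> * norm (X p)" unfolding abs_mult using cs by (rule mult_left_mono) simp
  also have "\<dots> \<le> l\<^sup>2 + (norm (X p))\<^sup>2 / 4"
  proof -
    have "0 \<le> (\<bar>l\<bar> - norm (X p) / 2)\<^sup>2" by simp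
    also have "\<dots> = l\<^sup>2 - \<bar>l\<bar> * norm (X p) + (norm (X p))\<^sup>2 / 4"
      by (simp add: power2_diff power_divide)
    finally show ?thesis by simp
  qed
  finally have "l * (X p \<bullet> N p) \<le> l\<^sup>2 + \<gamma> p / 4" by (simp add: \<gamma>_def power2_norm_eq_inner)
  then have "4 * wdiv tanX p \<le> 4 * (CARD('n) + l\<^sup>2) - \<gamma> p"
    unfolding wdiv_tanX[OF p] \<gamma>_def[symmetric] by (simp add: algebra_simps)
  also have "\<dots> \<le> \<Phi> (4 * (CARD('n) + l\<^sup>2)) p" unfolding \<Phi>_def by simp
  finally show ?thesis .
qed

text \<open>Young's inequality trades the derivative of the cutoff against \<open>c |W|\<^sup>2\<close>. The remaining energy
  \<open>\<Phi>\<^sup>2 |\<nabla>\<gamma>|\<^sup>2\<close> is, up to a divergence, bounded through \<open>wdiv_tanX_le\<close> by a power of \<open>R\<close> times a fixed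
  function with compact support.\<close>

lemma cutoff_estimate:
  assumes W: "C1M W" "tangential W" and c: "c > 0"
    and ge: "wdiv W p \<ge> q + c * (W p \<bullet> W p)" and p: "p \<in> topspace T" and R: "R > 0"
  defines "\<psi> \<equiv> \<Phi> (4 * (CARD('n) + l\<^sup>2))"
  shows "\<Phi> R p ^ 4 * q \<le> wdiv (\<lambda>q. \<Phi> R q ^ 4 *\<^sub>R W q) p - (4 * R / c) * wdiv (\<lambda>q. \<Phi> R q ^ 2 *\<^sub>R tanX q) p
     + (R ^ 3 / c) * \<psi> p"
proof -
  define F where "F = \<Phi> R p"
  define x where "x = tanX p \<bullet> tanX p"
  define w where "w = W p \<bullet> W p"
  have F: "0 \<le> F" "F \<le> R" unfolding F_def \<Phi>_def using \<gamma>_nonneg[of p] R by auto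
  have x: "0 \<le> x" unfolding x_def by simp
  have \<psi>: "0 \<le> \<psi> p" unfolding \<psi>_def \<Phi>_def by simp
  have 1: "wdiv (\<lambda>q. \<Phi> R q ^ 4 *\<^sub>R W q) p = F ^ 4 * wdiv W p - 8 * F ^ 3 * (tanX p \<bullet> W p)"
    using wdiv_\<Phi>[OF W p, of R 2] by (simp add: F_def numeral_eq_Suc algebra_simps)
  have 2: "wdiv (\<lambda>q. \<Phi> R q ^ 2 *\<^sub>R tanX q) p = F ^ 2 * wdiv tanX p - 4 * F * x"
    using wdiv_\<Phi>[OF C1M_tanX tangential_tanX p, of R 0] by (simp add: F_def x_def numeral_eq_Suc algebra_simps)
  \<comment> \<open>Young's inequality, from expanding a square\<close>
  have "0 \<le> ((c * F\<^sup>2) *\<^sub>R W p - (4 * F) *\<^sub>R tanX p) \<bullet> ((c * F\<^sup>2) *\<^sub>R W p - (4 * F) *\<^sub>R tanX p)" by simp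
  also have "\<dots> = c * (c * F ^ 4 * w) - c * (8 * F ^ 3 * (tanX p \<bullet> W p)) + 16 * F\<^sup>2 * x"
    unfolding w_def x_def
    by (simp add: inner_diff_left inner_diff_right inner_commute power2_eq_square power3_eq_cube power4_eq_xxxx algebra_simps)
  finally have "8 * F ^ 3 * (tanX p \<bullet> W p) \<le> c * F ^ 4 * w + 16 * F\<^sup>2 * x / c"
    using c by (simp add: field_simps)
  moreover have "F ^ 4 * (q + c * w) \<le> F ^ 4 * wdiv W p"
    using ge unfolding w_def by (intro mult_left_mono) auto
  ultimately have 3: "F ^ 4 * q \<le> wdiv (\<lambda>q. \<Phi> R q ^ 4 *\<^sub>R W q) p + 16 * F\<^sup>2 * x / c"
    unfolding 1 by (simp add: algebra_simps)
  have "F\<^sup>2 * x \<le> R * (F * x)"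
    using F x by (simp add: power2_eq_square mult.assoc mult_right_mono)
  then have "16 * (F\<^sup>2 * x) / c \<le> 16 * (R * (F * x)) / c" using c by (simp add: divide_right_mono)
  also have "\<dots> = (4 * R / c) * (F\<^sup>2 * wdiv tanX p) - (4 * R / c) * wdiv (\<lambda>q. \<Phi> R q ^ 2 *\<^sub>R tanX q) p"
    unfolding 2 by (simp add: algebra_simps)
  also have "(4 * R / c) * (F\<^sup>2 * wdiv tanX p) \<le> (R ^ 3 / c) * \<psi> p"
  proof -
    have "F\<^sup>2 * (4 * wdiv tanX p) \<le> F\<^sup>2 * \<psi> p"
      using wdiv_tanX_le[OF p] unfolding \<psi>_def by (intro mult_left_mono) auto
    also have "\<dots> \<le> R\<^sup>2 * \<psi> p" using F \<psi> by (intro mult_right_mono power_mono)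
    finally have "(R / c) * (F\<^sup>2 * (4 * wdiv tanX p)) \<le> (R / c) * (R\<^sup>2 * \<psi> p)"
      using R c by (intro mult_left_mono) auto
    then show ?thesis by (simp add: power2_eq_square power3_eq_cube mult_ac)
  qed
  finally show ?thesis using 3 unfolding F_def by (simp add: mult_ac)
qed

text \<open>Integrating the cutoff estimate bounds \<open>R\<^sup>4\<close> times a weighted integral \<open>m\<close> of \<open>q\<close> by \<open>R\<^sup>3\<close> times a
  constant, up to factors independent of \<open>R\<close>; hence \<open>m = 0\<close>.\<close>

theorem parabolicity:
  assumes W: "C1M W" "tangential W" and c: "c > 0"
    and q: "continuous_map T euclidean q" "\<And>p. p \<in> topspace T \<Longrightarrow> 0 \<le> q p"
    and ge: "\<And>p. p \<in> topspace T \<Longrightarrow> wdiv W p \<ge> q p + c * (W p \<bullet> W p)"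
    and p: "p \<in> topspace T"
  shows "q p = 0"
proof -
  define C where "C = 4 * (real CARD('n) + l\<^sup>2)"
  define R0 where "R0 = \<gamma> p + 1"
  have C0: "0 \<le> C" unfolding C_def by simp
  have R0: "R0 > 0" unfolding R0_def using \<gamma>_nonneg[of p] by simp
  \<comment> \<open>\<open>q\<close> cut off to a function with compact support that keeps the value at \<open>p\<close>\<close>
  define f where "f = (\<lambda>x. q x * \<Phi> R0 x)"
  have fc: "continuous_map T euclidean f" unfolding f_def by (intro continuous_intros q \<Phi>_continuous)
  have f0: "\<forall>x\<in>topspace T. 0 \<le> f x" unfolding f_def \<Phi>_def using q(2) by simp
  obtain P0 \<kappa>0 \<Omega>0 \<eta>0 where P0: "unity_partition P0 \<kappa>0 \<Omega>0 \<eta>0 (sublevel (max C R0))"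
    using partition_exists[OF compact_sublevel[of "max C R0"]] le_max_iff_disj[of 0 C R0] C0 by blast
  define M where "M = weighted_integral P0 \<kappa>0 \<eta>0 (\<Phi> C)"
  define m where "m = weighted_integral P0 \<kappa>0 \<eta>0 f"
  have m0: "0 \<le> m" unfolding m_def by (rule weighted_integral_nonneg[OF P0 f0])
  have main: "m * R \<le> 16 * R0 * M / c" if R: "R \<ge> max C (2 * R0)" for R
  proof -
    have R': "R > 0" "C \<le> R" "2 * R0 \<le> R" "R0 \<le> R" using R R0 by auto
    obtain P \<kappa> \<Omega> \<eta> where P: "unity_partition P \<kappa> \<Omega> \<eta> (sublevel R)"
      using partition_exists[OF compact_sublevel[OF less_imp_le[OF R'(1)]]] by blast
    have cl: "closedin T (sublevel R)"
      using compactin_imp_closedin[OF Hausdorff compact_sublevel] R' by simp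
    have M': "weighted_integral P \<kappa> \<eta> (\<Phi> C) = M" unfolding M_def
      by (rule weighted_integral_independent[OF P P0 \<Phi>_continuous]) (use R' in \<open>auto simp: sublevel_def \<Phi>_def max_def split: if_splits\<close>)
    have m': "weighted_integral P \<kappa> \<eta> f = m" unfolding m_def
      by (rule weighted_integral_independent[OF P P0 fc]) (use R' in \<open>auto simp: sublevel_def f_def \<Phi>_def max_def split: if_splits\<close>)
    let ?Y1 = "\<lambda>x. \<Phi> R x ^ 4 *\<^sub>R W x" and ?Y2 = "\<lambda>x. \<Phi> R x ^ 2 *\<^sub>R tanX x"
    have Y: "C1M ?Y1" "C1M ?Y2" by (intro C1M_scaleR C1M_\<Phi> W C1M_tanX; simp)+
    have tY: "tangential ?Y1" "tangential ?Y2" using W(2) tangential_tanX by (auto simp: tangential_def)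
    have z: "\<Phi> R x = 0" if "x \<in> topspace T" "x \<notin> sublevel R" for x
      using that by (simp add: sublevel_def \<Phi>_def)
    have d1: "weighted_integral P \<kappa> \<eta> (wdiv ?Y1) = 0" by (rule divergence_theorem[OF P cl Y(1) tY(1)]) (simp add: z)
    have d2: "weighted_integral P \<kappa> \<eta> (wdiv ?Y2) = 0" by (rule divergence_theorem[OF P cl Y(2) tY(2)]) (simp add: z)
    have ineq: "((R/2) ^ 4 / R0) * f x \<le> wdiv ?Y1 x + ((- (4 * R / c)) * wdiv ?Y2 x + (R ^ 3 / c) * \<Phi> C x)"
      if x: "x \<in> topspace T" for x
    proof -
      have "((R/2) ^ 4 / R0) * f x \<le> \<Phi> R x ^ 4 * q x"
      proof (cases "\<gamma> x < R0")
        case True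
        have "R / 2 \<le> \<Phi> R x" using True R' unfolding \<Phi>_def by simp
        then have "(R / 2) ^ 4 \<le> \<Phi> R x ^ 4" using R' by (intro power_mono) auto
        moreover have "\<Phi> R0 x / R0 \<le> 1" "0 \<le> \<Phi> R0 x / R0" using R0 \<gamma>_nonneg[of x] unfolding \<Phi>_def by auto
        ultimately have "(R / 2) ^ 4 * (\<Phi> R0 x / R0) \<le> \<Phi> R x ^ 4 * 1"
          using R' by (intro mult_mono) auto
        from mult_right_mono[OF this q(2)[OF x]] show ?thesis unfolding f_def by (simp add: field_simps)
      next
        case False
        then show ?thesis using q(2)[OF x] unfolding f_def \<Phi>_def by simp
      qed
      also have "\<dots> \<le> wdiv ?Y1 x - (4 * R / c) * wdiv ?Y2 x + (R ^ 3 / c) * \<Phi> C x"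
        unfolding C_def by (rule cutoff_estimate[OF W c ge[OF x] x R'(1)])
      finally show ?thesis by simp
    qed
    have "((R/2) ^ 4 / R0) * m = weighted_integral P \<kappa> \<eta> (\<lambda>x. ((R/2) ^ 4 / R0) * f x)" unfolding weighted_integral_scale[OF P] m' by simp
    also have "\<dots> \<le> weighted_integral P \<kappa> \<eta> (\<lambda>x. wdiv ?Y1 x + ((- (4 * R / c)) * wdiv ?Y2 x + (R ^ 3 / c) * \<Phi> C x))"
    proof (rule weighted_integral_mono[OF P])
      show "continuous_map T euclidean (\<lambda>x. ((R/2) ^ 4 / R0) * f x)"
        by (intro continuous_intros fc)
      show "continuous_map T euclidean (\<lambda>x. wdiv ?Y1 x + ((- (4 * R / c)) * wdiv ?Y2 x + (R ^ 3 / c) * \<Phi> C x))"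
        by (intro continuous_intros wdiv_continuous Y \<Phi>_continuous)
    qed (rule ineq)
    also have "\<dots> = weighted_integral P \<kappa> \<eta> (wdiv ?Y1) + (weighted_integral P \<kappa> \<eta> (\<lambda>x. (- (4 * R / c)) * wdiv ?Y2 x) + weighted_integral P \<kappa> \<eta> (\<lambda>x. (R ^ 3 / c) * \<Phi> C x))"
      by (subst weighted_integral_add[OF P], (intro continuous_intros wdiv_continuous Y \<Phi>_continuous)+,
          subst weighted_integral_add[OF P], (intro continuous_intros wdiv_continuous Y \<Phi>_continuous)+) simp
    also have "\<dots> = (R ^ 3 / c) * M" unfolding weighted_integral_scale[OF P] d1 d2 M' by simp
    finally have "(R/2) ^ 4 / R0 * m \<le> R ^ 3 / c * M" .
    then have "R ^ 3 * (m * R) \<le> R ^ 3 * (16 * R0 * M / c)"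
      using R0 c R' by (simp add: field_simps power4_eq_xxxx power3_eq_cube)
    then show ?thesis by (rule mult_left_le_imp_le) (use R' in simp)
  qed
  have "m = 0"
  proof (rule ccontr)
    assume "m \<noteq> 0"
    then have m: "m > 0" using m0 by simp
    define R where "R = max (max C (2 * R0)) (16 * R0 * M / c / m + 1)"
    have "m * R \<le> 16 * R0 * M / c" by (rule main) (simp add: R_def)
    moreover have "16 * R0 * M / c / m < R" unfolding R_def by simp
    then have "16 * R0 * M / c < R * m" unfolding pos_divide_less_eq[OF m] .
    ultimately show False by (simp add: mult.commute)
  qed
  then have "f p = 0"
    unfolding m_def by (rule weighted_integral_eq_0D[OF P0 fc f0]) (use p in \<open>auto simp: sublevel_def R0_def\<close>)
  then show ?thesis unfolding f_def \<Phi>_def R0_def by simp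
qed

end

section \<open>A branch of the angle\<close>

text \<open>On the plane slit along \<open>[0, \<infinity>) \<times> {0}\<close> the angle, shifted by a constant, is the argument
  of \<open>-(x + \<i>y)\<close>.\<close>

definition angle :: "'m::finite \<Rightarrow> 'm \<Rightarrow> real^'m \<Rightarrow> real" where
  "angle i j x = Im (Ln (- Complex (x $ i) (x $ j)))"

definition slit_domain :: "'m::finite \<Rightarrow> 'm \<Rightarrow> (real^'m) set" where
  "slit_domain i j = {x. - Complex (x $ i) (x $ j) \<notin> \<real>\<^sub>\<le>\<^sub>0}"

lemma slit_domain_iff: "x \<in> slit_domain i j \<longleftrightarrow> (x $ i, x $ j) \<notin> {0..} \<times> {0}"
  by (auto simp: slit_domain_def complex_nonpos_Reals_iff)

lemma slit_domain_pos:
  assumes "x \<in> slit_domain i j" shows "0 < (x $ i)\<^sup>2 + (x $ j)\<^sup>2"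
  using assms by (auto simp: slit_domain_iff sum_power2_gt_zero_iff)

lemma bounded_linear_Complex_coords: "bounded_linear (\<lambda>x. - Complex (x $ i) (x $ j))"
  by (intro linear_conv_bounded_linear[THEN iffD1] linearI) (auto simp: complex_eq_iff)

lemma has_derivative_angle:
  assumes x: "x \<in> slit_domain i j"
  shows "(angle i j has_derivative
     (\<lambda>w. (x $ i * w $ j - x $ j * w $ i) / ((x $ i)\<^sup>2 + (x $ j)\<^sup>2))) (at x)"
proof -
  let ?L = "\<lambda>x::real^'a. - Complex (x $ i) (x $ j)"
  have L: "(?L has_derivative ?L) (at x)"
    by (rule bounded_linear_imp_has_derivative[OF bounded_linear_Complex_coords])
  have "(Ln has_derivative (\<lambda>h. inverse (?L x) * h)) (at (?L x))"
    using has_field_derivative_Ln[of "?L x"] x unfolding slit_domain_def has_field_derivative_def by blast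
  from diff_chain_at[OF L this] have "((\<lambda>y. Ln (?L y)) has_derivative (\<lambda>w. inverse (?L x) * ?L w)) (at x)"
    by (simp add: o_def)
  from has_derivative_Im[OF this]
  have "(angle i j has_derivative (\<lambda>w. Im (inverse (?L x) * ?L w))) (at x)"
    by (simp add: angle_def[abs_def])
  moreover have "Im (inverse (?L x) * ?L w) = (x $ i * w $ j - x $ j * w $ i) / ((x $ i)\<^sup>2 + (x $ j)\<^sup>2)" for w
    by (simp add: complex_inverse diff_divide_distrib)
  ultimately show ?thesis by simp
qed

lemma C1_on_angle: "C1_on (slit_domain i j) (angle i j)"
proof (rule C1_onI[OF has_derivative_angle])
  show "continuous_on (slit_domain i j) (\<lambda>x. (x $ i * v $ j - x $ j * v $ i) / ((x $ i)\<^sup>2 + (x $ j)\<^sup>2))" for v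
    by (intro continuous_intros) (auto dest: slit_domain_pos)
qed

lemma abs_angle_le: "x \<in> slit_domain i j \<Longrightarrow> \<bar>angle i j x\<bar> \<le> pi"
proof -
  assume "x \<in> slit_domain i j"
  then have "- Complex (x $ i) (x $ j) \<noteq> 0" unfolding slit_domain_def by auto
  then show ?thesis
    using mpi_less_Im_Ln Im_Ln_le_pi unfolding angle_def by (simp add: abs_le_iff less_imp_le minus_le_iff)
qed


section \<open>Vanishing of the Weingarten map\<close>

context lambda_hypersurface
begin

context
  fixes i j :: 'm
  assumes slit: "\<And>p. p \<in> topspace T \<Longrightarrow> N p \<in> slit_domain i j"
begin

abbreviation "ei \<equiv> axis i (1::real)"
abbreviation "ej \<equiv> axis j (1::real)"

definition r2 :: "'p \<Rightarrow> real" where "r2 q = (N q $ i)\<^sup>2 + (N q $ j)\<^sup>2"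

text \<open>The rotation field of the sphere about the axis of the slit, along the Gauss map.\<close>

definition rot :: "'p \<Rightarrow> real^'m" where "rot q = N q $ i *\<^sub>R ej - N q $ j *\<^sub>R ei"

lemma r2_pos: "p \<in> topspace T \<Longrightarrow> 0 < r2 p"
  unfolding r2_def by (rule slit_domain_pos[OF slit])

lemma r2_le_1: "i \<noteq> j \<Longrightarrow> p \<in> topspace T \<Longrightarrow> r2 p \<le> 1"
proof -
  assume "i \<noteq> j" "p \<in> topspace T"
  then have "r2 p = (\<Sum>a\<in>{i, j}. (N p $ a) * (N p $ a))" by (simp add: r2_def power2_eq_square)
  also have "\<dots> \<le> (\<Sum>a\<in>UNIV. (N p $ a) * (N p $ a))" by (intro sum_mono2) auto
  also have "\<dots> = 1" using N_unit[OF \<open>p \<in> topspace T\<close>] by (simp add: inner_vec_def)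
  finally show ?thesis .
qed

lemma C1M_component: "C1M (\<lambda>q. N q $ a)"
  using C1M_inner[OF C1M_N C1M_const[of "axis a 1"]] by (simp add: inner_axis)

lemma C1M_rot: "C1M rot"
  unfolding rot_def by (intro C1M_diff C1M_scaleR C1M_component C1M_const)

lemma tangential_rot: "tangential rot"
  unfolding tangential_def rot_def by (simp add: inner_diff_left inner_axis')

lemma tder_component: "p \<in> topspace T \<Longrightarrow> tder (\<lambda>q. N q $ a) (\<lambda>v. shape p v $ a) p"
  by (rule tder_linear[OF bounded_linear_vec_nth tder_N])

lemma wdiv_shape_rot:
  assumes p: "p \<in> topspace T" shows "wdiv (\<lambda>q. shape q (rot q)) p = 0"
proof -
  have "tder rot (\<lambda>v. (N p $ i *\<^sub>R 0 + shape p v $ i *\<^sub>R ej) - (N p $ j *\<^sub>R 0 + shape p v $ j *\<^sub>R ei)) p"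
    unfolding rot_def by (intro tder_diff tder_scaleR tder_component tder_const p)
  from tderiv_eq[OF this p]
  have "tderiv rot p v = shape p v $ i *\<^sub>R ej - shape p v $ j *\<^sub>R ei" for v by simp
  then show ?thesis
    unfolding wdiv_shape[OF C1M_rot tangential_rot p] by (simp add: inner_diff_right inner_axis)
qed

lemma C1M_angle: "C1M (\<lambda>q. angle i j (N q))"
  unfolding C1M_def
proof
  fix c assume c: "c \<in> A"
  have "C1_on (img c) (\<lambda>y. angle i j (in_chart c N y))"
    by (rule C1_on_compose[OF C1_on_angle C1MD[OF C1M_N c]])
       (use slit chart_topspace[OF c] in \<open>auto simp: in_chart_apply c\<close>)
  then show "C1_on (img c) (in_chart c (\<lambda>q. angle i j (N q)))" by (simp add: in_chart_def o_def)
qed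

lemma tder_angle:
  assumes p: "p \<in> topspace T"
  shows "tder (\<lambda>q. angle i j (N q)) (\<lambda>v. (shape p v \<bullet> rot p) / r2 p) p"
proof -
  have "tder (\<lambda>q. angle i j (N q)) (\<lambda>v. (N p $ i * shape p v $ j - N p $ j * shape p v $ i) / ((N p $ i)\<^sup>2 + (N p $ j)\<^sup>2)) p"
    by (rule tder_compose[OF has_derivative_angle[OF slit[OF p]] tder_N[OF p]])
  then show ?thesis by (simp add: rot_def r2_def inner_diff_right inner_axis)
qed

text \<open>The field \<open>r\<^sup>2 \<nabla>\<theta> = shape(rot)\<close> is divergence free and the angle is bounded, so parabolicity
  applies to \<open>\<theta> r\<^sup>2 \<nabla>\<theta>\<close>.\<close>

lemma shape_rot_eq_0:
  assumes ne: "i \<noteq> j" and p: "p \<in> topspace T" shows "shape p (rot p) = 0"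
proof -
  let ?th = "\<lambda>q. angle i j (N q)"
  let ?V = "\<lambda>q. shape q (rot q)"
  let ?W = "\<lambda>q. ?th q *\<^sub>R ?V q"
  have V: "C1M ?V" by (rule C1M_shape[OF C1M_rot tangential_rot])
  have W: "C1M ?W" by (rule C1M_scaleR[OF C1M_angle V])
  have tW: "tangential ?W" using shape_normal by (simp add: tangential_def)
  have "(1/2) * (?V p \<bullet> ?V p) = 0"
  proof (rule parabolicity[OF W tW _ _ _ _ p])
    \<comment> \<open>half of the divergence pays for \<open>c |W|\<^sup>2\<close>, as \<open>|\<theta>| \<le> \<pi>\<close>\<close>
    show "(0::real) < 1 / (2 * pi\<^sup>2)" by simp
    show "continuous_map T euclidean (\<lambda>q. (1/2) * (?V q \<bullet> ?V q))"
      by (rule C1M_continuous[OF C1M_mult[OF C1M_const C1M_inner[OF V V]]])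
    show "0 \<le> (1/2) * (?V q \<bullet> ?V q)" for q by simp
    fix q assume q: "q \<in> topspace T"
    have "wdiv ?W q = (?V q \<bullet> ?V q) / r2 q"
      using wdiv_scaleR[OF tder_angle[OF q] V q] wdiv_shape_rot[OF q] shape_symmetric[OF q, of "?V q" "rot q"] by simp
    moreover have "?V q \<bullet> ?V q \<le> (?V q \<bullet> ?V q) / r2 q"
      using r2_pos[OF q] r2_le_1[OF ne q] by (simp add: le_divide_eq mult_left_le)
    moreover have "1 / (2 * pi\<^sup>2) * (?W q \<bullet> ?W q) \<le> (1/2) * (?V q \<bullet> ?V q)"
    proof -
      have "(?th q)\<^sup>2 \<le> pi\<^sup>2" using power_mono[OF abs_angle_le[OF slit[OF q]] abs_ge_zero, of 2] by simp
      then have "(?th q)\<^sup>2 * (?V q \<bullet> ?V q) \<le> pi\<^sup>2 * (?V q \<bullet> ?V q)" by (intro mult_right_mono) auto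
      then show ?thesis by (simp add: field_simps power2_eq_square)
    qed
    ultimately show "(1/2) * (?V q \<bullet> ?V q) + 1 / (2 * pi\<^sup>2) * (?W q \<bullet> ?W q) \<le> wdiv ?W q" by linarith
  qed
  then show ?thesis by simp
qed

definition shape_norm2 :: "'p \<Rightarrow> real" where "shape_norm2 q = (\<Sum>a\<in>UNIV. shape q (axis a 1) \<bullet> shape q (axis a 1))"

definition radial :: "'p \<Rightarrow> real^'m" where "radial q = N q $ i *\<^sub>R ei + N q $ j *\<^sub>R ej - r2 q *\<^sub>R N q"

lemma C1M_r2: "C1M r2"
proof -
  have "C1M (\<lambda>q. N q $ i * N q $ i + N q $ j * N q $ j)" by (intro C1M_add C1M_mult C1M_component)
  then show ?thesis by (simp add: r2_def[abs_def] power2_eq_square)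
qed

lemma tder_r2: "p \<in> topspace T \<Longrightarrow> tder r2 (\<lambda>v. 2 * (N p $ i * shape p v $ i + N p $ j * shape p v $ j)) p"
proof -
  assume p: "p \<in> topspace T"
  have "tder (\<lambda>q. N q $ i * N q $ i + N q $ j * N q $ j)
     (\<lambda>v. (N p $ i * shape p v $ i + shape p v $ i * N p $ i) + (N p $ j * shape p v $ j + shape p v $ j * N p $ j)) p"
    by (intro tder_add tder_mult tder_component p)
  then show ?thesis by (simp add: r2_def[abs_def] power2_eq_square algebra_simps)
qed

lemma C1M_radial: "C1M radial"
  unfolding radial_def by (intro C1M_diff C1M_add C1M_scaleR C1M_component C1M_r2 C1M_N C1M_const)

lemma tangential_radial: "tangential radial"
  unfolding tangential_def radial_def
  using N_unit by (simp add: inner_diff_left inner_add_left inner_axis' r2_def power2_eq_square)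

lemma shape_radial: "p \<in> topspace T \<Longrightarrow> shape p (radial p) = N p $ i *\<^sub>R shape p ei + N p $ j *\<^sub>R shape p ej"
  unfolding radial_def using shape_linear[of p] shape_N[of p] by (simp add: linear_diff linear_add linear_scale)

lemma wdiv_shape_radial:
  assumes p: "p \<in> topspace T"
  shows "wdiv (\<lambda>q. shape q (radial q)) p = shape p ei \<bullet> shape p ei + shape p ej \<bullet> shape p ej - r2 p * shape_norm2 p"
proof -
  have "tder radial (\<lambda>v. ((N p $ i *\<^sub>R 0 + shape p v $ i *\<^sub>R ei) + (N p $ j *\<^sub>R 0 + shape p v $ j *\<^sub>R ej))
     - (r2 p *\<^sub>R shape p v + (2 * (N p $ i * shape p v $ i + N p $ j * shape p v $ j)) *\<^sub>R N p)) p"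
    unfolding radial_def by (intro tder_diff tder_add tder_scaleR tder_component tder_const tder_r2 tder_N p)
  from tderiv_eq[OF this p]
  have D: "shape p v \<bullet> tderiv radial p v = (shape p v $ i)\<^sup>2 + (shape p v $ j)\<^sup>2 - r2 p * (shape p v \<bullet> shape p v)" for v
    using shape_normal[OF p, of v]
    by (simp add: inner_diff_right inner_add_right inner_axis power2_eq_square)
  have comp: "(\<Sum>a\<in>UNIV. (shape p (axis a 1) $ k)\<^sup>2) = shape p (axis k 1) \<bullet> shape p (axis k 1)" for k
  proof -
    have "shape p (axis a 1) $ k = shape p (axis k 1) $ a" for a
      using shape_symmetric[OF p, of "axis a 1" "axis k 1"] by (simp add: inner_axis inner_axis')
    then show ?thesis by (simp add: inner_vec_def power2_eq_square)
  qed
  show ?thesis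
    unfolding wdiv_shape[OF C1M_radial tangential_radial p] D
    by (simp add: sum_subtractf sum.distrib comp shape_norm2_def sum_distrib_left)
qed

text \<open>As the angle is constant, \<open>r\<close> is a positive linear function of \<open>N\<close>. The field is \<open>- \<nabla> log r\<close>, and
  its divergence is the classical computation for a positive Jacobi function.\<close>

lemma shape_eq_0:
  assumes ne: "i \<noteq> j" and p: "p \<in> topspace T" shows "shape p v = 0"
proof -
  let ?V = "\<lambda>q. shape q (radial q)"
  let ?f = "\<lambda>q. - 1 / r2 q"
  let ?W = "\<lambda>q. ?f q *\<^sub>R ?V q"
  have V: "C1M ?V" by (rule C1M_shape[OF C1M_radial tangential_radial])
  have W: "C1M ?W" by (intro C1M_scaleR V C1M_divide C1M_const C1M_r2) (use r2_pos in force)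
  have tW: "tangential ?W" using shape_normal by (simp add: tangential_def)
  have cS: "C1M (\<lambda>q. shape q (axis a 1))" for a
  proof -
    let ?t = "\<lambda>q. axis a 1 - (axis a 1 \<bullet> N q) *\<^sub>R N q"
    have "C1M (\<lambda>q. shape q (?t q))"
      by (rule C1M_shape) (auto intro!: C1M_diff C1M_scaleR C1M_inner C1M_const C1M_N
          simp: tangential_def inner_diff_left N_unit)
    moreover have "shape q (?t q) = shape q (axis a 1)" if "q \<in> topspace T" for q
      using shape_linear[OF that] shape_N[OF that] by (simp add: linear_diff linear_scale)
    ultimately show ?thesis
      unfolding C1M_def
    proof (intro ballI)
      fix c assume c: "c \<in> A" and "\<forall>c\<in>A. C1_on (img c) (in_chart c (\<lambda>q. shape q (?t q)))"
        and eq: "\<And>q. q \<in> topspace T \<Longrightarrow> shape q (?t q) = shape q (axis a 1)"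
      then show "C1_on (img c) (in_chart c (\<lambda>q. shape q (axis a 1)))"
        using C1_on_cong[OF _ chart(2)[OF c], of "in_chart c (\<lambda>q. shape q (?t q))"]
        by (auto simp: in_chart_apply eq par_topspace)
    qed
  qed
  have "shape_norm2 p = 0"
  proof (rule parabolicity[OF W tW _ _ _ _ p])
    show "(0::real) < 1" by simp
    show "continuous_map T euclidean shape_norm2"
      unfolding shape_norm2_def by (intro C1M_continuous C1M_sum C1M_inner cS)
    show "0 \<le> shape_norm2 q" for q unfolding shape_norm2_def by (intro sum_nonneg) simp
    fix q assume q: "q \<in> topspace T"
    note r = r2_pos[OF q]
    define x where "x = N q $ i" define y where "y = N q $ j"
    define u where "u = shape q ei" define w where "w = shape q ej"
    have rr: "r2 q = x\<^sup>2 + y\<^sup>2" by (simp add: r2_def x_def y_def)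
    have rot0: "x *\<^sub>R w = y *\<^sub>R u"
      using shape_rot_eq_0[OF ne q] shape_linear[OF q] unfolding rot_def
      by (simp add: linear_diff linear_scale x_def y_def u_def w_def)
    have Vq: "?V q = x *\<^sub>R u + y *\<^sub>R w" using shape_radial[OF q] by (simp add: x_def y_def u_def w_def)
    have VV: "?V q \<bullet> ?V q = r2 q * (u \<bullet> u + w \<bullet> w)"
    proof -
      have w1: "x * (w \<bullet> w) = y * (u \<bullet> w)" and u1: "y * (u \<bullet> u) = x * (u \<bullet> w)"
        using arg_cong[OF rot0, of "\<lambda>z. w \<bullet> z"] arg_cong[OF rot0, of "\<lambda>z. u \<bullet> z"]
        by (simp_all add: inner_commute)
      have "x * (y * (u \<bullet> w)) = x * (x * (w \<bullet> w))" "x * (y * (u \<bullet> w)) = y * (y * (u \<bullet> u))"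
        unfolding w1 u1 by simp_all
      then show ?thesis
        unfolding Vq rr
        by (simp add: inner_add_left inner_add_right inner_commute power2_eq_square algebra_simps)
    qed
    have "tder ?f (\<lambda>v. (1 / (r2 q)\<^sup>2) * (2 * (N q $ i * shape q v $ i + N q $ j * shape q v $ j))) q"
    proof (rule tder_real_compose[where h="\<lambda>t. - 1 / t" and f=r2])
      show "((\<lambda>t. - 1 / t) has_real_derivative 1 / (r2 q)\<^sup>2) (at (r2 q))"
        using r by (auto intro!: derivative_eq_intros simp: power2_eq_square)
    qed (rule tder_r2[OF q])
    from wdiv_scaleR[OF this V q]
    have "wdiv ?W q = ?f q * wdiv ?V q + (1 / (r2 q)\<^sup>2) * (2 * (N q $ i * shape q (?V q) $ i + N q $ j * shape q (?V q) $ j))" .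
    moreover have "N q $ i * shape q (?V q) $ i + N q $ j * shape q (?V q) $ j = ?V q \<bullet> ?V q"
    proof -
      have "shape q (?V q) $ i = ?V q \<bullet> u" "shape q (?V q) $ j = ?V q \<bullet> w"
        using shape_symmetric[OF q, of "?V q" ei] shape_symmetric[OF q, of "?V q" ej]
        by (simp_all add: inner_axis u_def w_def)
      then show ?thesis
        unfolding x_def[symmetric] y_def[symmetric] by (subst (4) Vq) (simp add: inner_add_right)
    qed
    moreover have "wdiv ?V q = (?V q \<bullet> ?V q) / r2 q - r2 q * shape_norm2 q"
      using wdiv_shape_radial[OF q] VV r by (simp add: u_def w_def)
    ultimately have "wdiv ?W q = shape_norm2 q + (?V q \<bullet> ?V q) / (r2 q)\<^sup>2"
      using r by (simp add: field_simps power2_eq_square)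
    then show "shape_norm2 q + 1 * (?W q \<bullet> ?W q) \<le> wdiv ?W q"
      by (simp add: power2_eq_square)
  qed
  then have "shape p (axis a 1) = 0" for a
    unfolding shape_norm2_def by (simp add: sum_nonneg_eq_0_iff)
  then show ?thesis using sum_axis_linear[OF shape_linear[OF p], of v] by simp
qed

end

end

section \<open>Proper local homeomorphisms onto convex sets\<close>

locale proper_local_homeomorphism =
  fixes T :: "'p topology" and X :: "'p \<Rightarrow> 'a::euclidean_space" and H :: "'a set"
  assumes Hausdorff: "Hausdorff_space T"
    and connected_T: "connected_space T"
    and proper: "proper_map T euclidean X"
    and cont: "continuous_map T euclidean X"
    and into: "X ` topspace T \<subseteq> H"
    and H: "convex H" "closed H"
    and local_homeo: "\<And>q. q \<in> topspace T \<Longrightarrow> \<exists>Q. openin T Q \<and> q \<in> Q \<and> inj_on X Q \<and>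
       (\<forall>Q'. openin T Q' \<and> Q' \<subseteq> Q \<longrightarrow> openin (top_of_set H) (X ` Q'))"
begin

definition lift :: "'a set \<Rightarrow> ('a \<Rightarrow> 'p) \<Rightarrow> bool" where
  "lift C s \<longleftrightarrow> continuous_map (top_of_set C) T s \<and> (\<forall>y\<in>C. X (s y) = y)"

lemma liftD:
  assumes "lift C s" "y \<in> C" shows "s y \<in> topspace T" "X (s y) = y"
  using assms unfolding lift_def continuous_map_def by auto

lemma lift_open:
  assumes "lift C s" "openin T Q" shows "openin (top_of_set C) {y \<in> C. s y \<in> Q}"
  using openin_continuous_map_preimage[of "top_of_set C" T s Q] assms unfolding lift_def by simp

lemma lift_subset: "lift C s \<Longrightarrow> D \<subseteq> C \<Longrightarrow> lift D s"
  unfolding lift_def by (auto intro: continuous_map_from_subtopology_mono)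

text \<open>The set where two sections agree is open since \<open>X\<close> is locally injective, and closed since the
  source is Hausdorff.\<close>

lemma lift_unique:
  assumes s: "lift C s" "lift C s'" and C: "connected C" and y0: "y0 \<in> C" "s y0 = s' y0" and y: "y \<in> C"
  shows "s y = s' y"
proof (rule ccontr)
  assume ne: "s y \<noteq> s' y"
  let ?E1 = "{y \<in> C. s y = s' y}" and ?E2 = "{y \<in> C. s y \<noteq> s' y}"
  have "openin (top_of_set C) ?E1"
  proof (subst openin_subopen, rule ballI)
    fix x assume x: "x \<in> ?E1"
    obtain Q where Q: "openin T Q" "s x \<in> Q" "inj_on X Q"
      using local_homeo[of "s x"] liftD[OF s(1)] x by blast
    let ?G = "{y \<in> C. s y \<in> Q} \<inter> {y \<in> C. s' y \<in> Q}"
    have "openin (top_of_set C) ?G" by (intro openin_Int lift_open s Q)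
    moreover have "x \<in> ?G" using x Q by auto
    moreover have "?G \<subseteq> ?E1"
    proof
      fix z assume z: "z \<in> ?G"
      then have "X (s z) = X (s' z)" using liftD(2)[OF s(1)] liftD(2)[OF s(2)] by simp
      then show "z \<in> ?E1" using inj_onD[OF Q(3)] z by blast
    qed
    ultimately show "\<exists>G. openin (top_of_set C) G \<and> x \<in> G \<and> G \<subseteq> ?E1" by blast
  qed
  moreover have "openin (top_of_set C) ?E2"
  proof (subst openin_subopen, rule ballI)
    fix x assume x: "x \<in> ?E2"
    then have "s x \<in> topspace T" "s' x \<in> topspace T" "s x \<noteq> s' x" using liftD s by auto
    then obtain Q Q' where Q: "openin T Q" "openin T Q'" "s x \<in> Q" "s' x \<in> Q'" "disjnt Q Q'"
      using Hausdorff unfolding Hausdorff_space_def by metis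
    let ?G = "{y \<in> C. s y \<in> Q} \<inter> {y \<in> C. s' y \<in> Q'}"
    have "openin (top_of_set C) ?G" by (intro openin_Int lift_open s Q)
    moreover have "x \<in> ?G" using x Q by auto
    moreover have "?G \<subseteq> ?E2" using Q(5) by (auto simp: disjnt_iff)
    ultimately show "\<exists>G. openin (top_of_set C) G \<and> x \<in> G \<and> G \<subseteq> ?E2" by blast
  qed
  ultimately show False
    using C y0 y ne unfolding connected_openin by blast
qed

text \<open>Every point of the target has a neighbourhood over which all points of the source lie on
  sections: the fibre is finite up to compactness, and properness confines the nearby points of
  the source to neighbourhoods of the fibre.\<close>

lemma local_lifts:
  assumes z: "z \<in> H"
  shows "\<exists>e>0. \<forall>q\<in>topspace T. X q \<in> ball z e \<longrightarrow> (\<exists>\<sigma>. lift (ball z e \<inter> H) \<sigma> \<and> \<sigma> (X q) = q)"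
proof -
  define F where "F = {q \<in> topspace T. X q = z}"
  have F: "compactin T F"
    using proper unfolding proper_map_def F_def by simp
  have "\<exists>Q e. openin T Q \<and> q \<in> Q \<and> inj_on X Q \<and> e > 0 \<and> ball z e \<inter> H \<subseteq> X ` Q \<and>
       (\<forall>Q'. openin T Q' \<and> Q' \<subseteq> Q \<longrightarrow> openin (top_of_set H) (X ` Q'))" if q: "q \<in> F" for q
  proof -
    obtain Q where Q: "openin T Q" "q \<in> Q" "inj_on X Q"
      "\<forall>Q'. openin T Q' \<and> Q' \<subseteq> Q \<longrightarrow> openin (top_of_set H) (X ` Q')"
      using local_homeo[of q] q unfolding F_def by blast
    have "openin (top_of_set H) (X ` Q)" using Q by blast
    moreover have "z \<in> X ` Q" using Q(2) q unfolding F_def by blast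
    ultimately obtain e where "e > 0" "ball z e \<inter> H \<subseteq> X ` Q"
      unfolding openin_contains_ball by blast
    then show ?thesis using Q by blast
  qed
  then obtain Q e where *: "\<And>q. q \<in> F \<Longrightarrow> openin T (Q q) \<and> q \<in> Q q \<and> inj_on X (Q q) \<and> e q > 0 \<and>
     ball z (e q) \<inter> H \<subseteq> X ` Q q \<and> (\<forall>Q'. openin T Q' \<and> Q' \<subseteq> Q q \<longrightarrow> openin (top_of_set H) (X ` Q'))"
    by metis
  have "\<exists>\<F>. finite \<F> \<and> \<F> \<subseteq> Q ` F \<and> F \<subseteq> \<Union>\<F>"
  proof (rule compactinD[OF F])
    show "openin T U" if "U \<in> Q ` F" for U using that * by blast
    show "F \<subseteq> \<Union>(Q ` F)" using * by blast
  qed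
  then obtain \<F> where \<F>: "finite \<F>" "\<F> \<subseteq> Q ` F" "F \<subseteq> \<Union>\<F>" by blast
  obtain G where G: "G \<subseteq> F" "finite G" "\<F> = Q ` G" using finite_subset_image[OF \<F>(1,2)] by blast
  define e0 where "e0 = Min (insert 1 (e ` G))"
  have e0: "e0 > 0" unfolding e0_def using G * by (subst Min_gr_iff) auto
  have e0': "e0 \<le> e q" if "q \<in> G" for q unfolding e0_def using G(2) that by (intro Min_le) auto
  let ?U = "\<Union>(Q ` G)"
  have "openin T ?U" using G(1) * by (intro openin_Union) auto
  then have "closedin T (topspace T - ?U)" by blast
  then have "closed (X ` (topspace T - ?U))"
    using proper unfolding proper_map_def closed_map_def by auto
  moreover have "z \<notin> X ` (topspace T - ?U)"
    using \<F>(3) unfolding G(3) F_def by blast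
  ultimately obtain d where d: "d > 0" "ball z d \<inter> X ` (topspace T - ?U) = {}"
    by (metis closed_def open_contains_ball ComplI disjoint_eq_subset_Compl)
  define r where "r = min e0 d"
  show ?thesis
  proof (intro exI[of _ r] conjI ballI impI)
    show "r > 0" unfolding r_def using e0 d by simp
    fix q assume q: "q \<in> topspace T" "X q \<in> ball z r"
    then have "q \<in> ?U" using d(2) unfolding r_def by auto
    then obtain k where k: "k \<in> G" "q \<in> Q k" by blast
    then have kF: "k \<in> F" using G by blast
    let ?s = "inv_into (Q k) X"
    have sub: "ball z r \<inter> H \<subseteq> X ` Q k" using * [OF kF] e0'[OF k(1)] unfolding r_def by (auto simp: subset_iff)
    have "lift (ball z r \<inter> H) ?s"
      unfolding lift_def
    proof (intro conjI ballI)
      show "X (?s y) = y" if "y \<in> ball z r \<inter> H" for y using sub that by (intro f_inv_into_f) blast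
      have inQ: "?s y \<in> Q k" if "y \<in> ball z r \<inter> H" for y using sub that by (intro inv_into_into) blast
      have QT: "Q k \<subseteq> topspace T" using *[OF kF] openin_subset by blast
      show "continuous_map (top_of_set (ball z r \<inter> H)) T ?s"
        unfolding continuous_map_def
      proof (intro conjI allI impI)
        show "?s \<in> topspace (top_of_set (ball z r \<inter> H)) \<rightarrow> topspace T" using inQ QT by auto
        fix V assume V: "openin T V"
        have "openin (top_of_set H) (X ` (Q k \<inter> V))" using *[OF kF] openin_Int[of T "Q k" V] V by blast
        then obtain U where U: "open U" "X ` (Q k \<inter> V) = H \<inter> U" unfolding openin_open by blast
        have "(ball z r \<inter> H) \<inter> X ` (Q k \<inter> V) = (ball z r \<inter> H) \<inter> U" unfolding U(2) by blast
        then have o: "openin (top_of_set (ball z r \<inter> H)) ((ball z r \<inter> H) \<inter> X ` (Q k \<inter> V))"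
          using openin_open_Int[OF U(1), of "ball z r \<inter> H"] by simp
        have "{y \<in> ball z r \<inter> H. ?s y \<in> V} = (ball z r \<inter> H) \<inter> X ` (Q k \<inter> V)"
        proof (intro equalityI subsetI)
          fix y assume y: "y \<in> {y \<in> ball z r \<inter> H. ?s y \<in> V}"
          then have "y = X (?s y)" using sub f_inv_into_f[of y X "Q k"] by auto
          moreover have "?s y \<in> Q k \<inter> V" using y inQ by blast
          ultimately have "y \<in> X ` (Q k \<inter> V)" by (rule image_eqI)
          then show "y \<in> (ball z r \<inter> H) \<inter> X ` (Q k \<inter> V)" using y by blast
        next
          fix y assume y: "y \<in> (ball z r \<inter> H) \<inter> X ` (Q k \<inter> V)"
          then obtain x where x: "x \<in> Q k" "x \<in> V" "y = X x" by blast
          then have "?s y = x" using *[OF kF] by (simp add: inv_into_f_f)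
          then show "y \<in> {y \<in> ball z r \<inter> H. ?s y \<in> V}" using x y by blast
        qed
        then show "openin (top_of_set (ball z r \<inter> H)) {x \<in> topspace (top_of_set (ball z r \<inter> H)). ?s x \<in> V}"
          using o by simp
      qed
    qed
    moreover have "?s (X q) = q" using k *[OF kF] by (simp add: inv_into_f_f)
    ultimately show "\<exists>\<sigma>. lift (ball z r \<inter> H) \<sigma> \<and> \<sigma> (X q) = q" by blast
  qed
qed

lemma lift_local:
  assumes "\<And>y. y \<in> C \<Longrightarrow> \<exists>G \<sigma>. open G \<and> y \<in> G \<and> lift (G \<inter> H) \<sigma> \<and> (\<forall>x\<in>G \<inter> C. s x = \<sigma> x)" and "C \<subseteq> H"
  shows "lift C s"
  unfolding lift_def continuous_map_def
proof (intro conjI allI impI ballI)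
  have "s y \<in> topspace T \<and> X (s y) = y" if y: "y \<in> C" for y
  proof -
    obtain G \<sigma> where G: "y \<in> G" "lift (G \<inter> H) \<sigma>" "\<forall>x\<in>G \<inter> C. s x = \<sigma> x"
      using assms(1)[OF y] by blast
    then show ?thesis using liftD[OF G(2), of y] y assms(2) by auto
  qed
  then show "s \<in> topspace (top_of_set C) \<rightarrow> topspace T" "\<And>y. y \<in> C \<Longrightarrow> X (s y) = y" by auto
  fix V assume V: "openin T V"
  have "openin (top_of_set C) {x \<in> C. s x \<in> V}"
  proof (subst openin_subopen, rule ballI)
    fix y assume y: "y \<in> {x \<in> C. s x \<in> V}"
    obtain G \<sigma> where G: "open G" "y \<in> G" "lift (G \<inter> H) \<sigma>" "\<forall>x\<in>G \<inter> C. s x = \<sigma> x"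
      using assms(1)[of y] y by blast
    obtain U where U: "open U" "{x \<in> G \<inter> H. \<sigma> x \<in> V} = (G \<inter> H) \<inter> U"
      using lift_open[OF G(3) V] unfolding openin_open by blast
    have "openin (top_of_set C) (C \<inter> (G \<inter> U))" using G(1) U(1) by (intro openin_open_Int open_Int)
    moreover have "y \<in> C \<inter> (G \<inter> U)" using y G(2,4) U(2) assms(2) by auto
    moreover have "C \<inter> (G \<inter> U) \<subseteq> {x \<in> C. s x \<in> V}" using G(4) U(2) assms(2) by auto
    ultimately show "\<exists>W. openin (top_of_set C) W \<and> y \<in> W \<and> W \<subseteq> {x \<in> C. s x \<in> V}" by blast
  qed
  then show "openin (top_of_set C) {x \<in> topspace (top_of_set C). s x \<in> V}" by simp
qed

text \<open>Local sections at the boundary points of the ball continue the given section, and compactness of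
  the closed ball yields a uniform gain in the radius.\<close>

lemma extend_lift:
  assumes s: "lift (ball x0 \<rho> \<inter> H) s" and \<rho>: "\<rho> > 0" and x0: "x0 \<in> H"
  shows "\<exists>\<rho>' s'. \<rho>' > \<rho> \<and> lift (ball x0 \<rho>' \<inter> H) s' \<and> s' x0 = s x0"
proof -
  let ?B = "ball x0 \<rho> \<inter> H"
  have "\<exists>e \<sigma>. e > 0 \<and> lift (ball z e \<inter> H) \<sigma> \<and> (\<forall>y \<in> ball z e \<inter> ?B. \<sigma> y = s y)"
    if z: "z \<in> sphere x0 \<rho> \<inter> H" for z
  proof -
    obtain e where e: "e > 0" "\<forall>q\<in>topspace T. X q \<in> ball z e \<longrightarrow> (\<exists>\<sigma>. lift (ball z e \<inter> H) \<sigma> \<and> \<sigma> (X q) = q)"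
      using local_lifts[of z] z by blast
    \<comment> \<open>move from \<open>z\<close> towards the centre, staying within \<open>e\<close>\<close>
    define t where "t = min (1/2) (e / (2 * \<rho>))"
    have t: "0 < t" "t \<le> 1/2" "t * \<rho> < e" using e \<rho> unfolding t_def by (auto simp: min_def field_simps)
    define y where "y = (1 - t) *\<^sub>R z + t *\<^sub>R x0"
    have yz: "y - z = t *\<^sub>R (x0 - z)" "y - x0 = (1 - t) *\<^sub>R (z - x0)" by (simp_all add: y_def algebra_simps)
    have nz: "norm (x0 - z) = \<rho>" "norm (z - x0) = \<rho>" using z by (auto simp: dist_norm norm_minus_commute)
    have "dist y z = t * \<rho>" "dist y x0 = (1 - t) * \<rho>"
      unfolding dist_norm yz using nz t by simp_all
    then have "dist z y = t * \<rho>" "dist x0 y = (1 - t) * \<rho>" by (simp_all add: dist_commute)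
    moreover have "y \<in> H" unfolding y_def using z x0 t H(1) by (intro convexD) auto
    moreover have "(1 - t) * \<rho> < \<rho>" using t \<rho> by simp
    ultimately have y: "y \<in> ball z e \<inter> ?B" using t by simp
    then obtain \<sigma> where \<sigma>: "lift (ball z e \<inter> H) \<sigma>" "\<sigma> y = s y"
      using e(2) liftD[OF s, of y] by auto
    have "\<sigma> x = s x" if x: "x \<in> ball z e \<inter> ?B" for x
    proof (rule lift_unique[where s=\<sigma> and s'=s and C="ball z e \<inter> ?B", OF _ _ _ y \<sigma>(2) x])
      show "lift (ball z e \<inter> ?B) \<sigma>" by (rule lift_subset[OF \<sigma>(1)]) blast
      show "lift (ball z e \<inter> ?B) s" by (rule lift_subset[OF s]) blast
      show "connected (ball z e \<inter> ?B)" by (intro convex_connected convex_Int convex_ball H)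
    qed
    then show ?thesis using e(1) \<sigma>(1) by blast
  qed
  then obtain e \<sigma> where *: "\<And>z. z \<in> sphere x0 \<rho> \<inter> H \<Longrightarrow> e z > 0 \<and> lift (ball z (e z) \<inter> H) (\<sigma> z) \<and>
      (\<forall>y \<in> ball z (e z) \<inter> ?B. \<sigma> z y = s y)" by metis
  \<comment> \<open>the new sections agree, as their domains meet inside the old ball by strict convexity\<close>
  have agree: "\<sigma> z y = \<sigma> z' y" if z: "z \<in> sphere x0 \<rho> \<inter> H" "z' \<in> sphere x0 \<rho> \<inter> H"
    and y: "y \<in> ball z (e z) \<inter> H" "y \<in> ball z' (e z')" for z z' y
  proof (cases "z = z'")
    case False
    define t where "t = e z / (e z + e z')"
    have ez: "e z > 0" "e z' > 0" using * z by blast+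
    have t: "0 < t" "t < 1" using ez unfolding t_def by (auto simp: field_simps)
    have dz: "dist z z' < e z + e z'" using y dist_triangle[of z z' y] by (auto simp: dist_commute)
    define w where "w = (1 - t) *\<^sub>R z + t *\<^sub>R z'"
    have "w - z = t *\<^sub>R (z' - z)" "w - z' = (1 - t) *\<^sub>R (z - z')" by (simp_all add: w_def algebra_simps)
    then have dw: "dist z w = t * dist z z'" "dist z' w = (1 - t) * dist z z'"
      using t by (simp_all add: dist_norm norm_minus_commute)
    have "t * dist z z' < t * (e z + e z')" "(1 - t) * dist z z' < (1 - t) * (e z + e z')"
      using dz t by simp_all
    moreover have "t * (e z + e z') = e z" "(1 - t) * (e z + e z') = e z'"
      using ez unfolding t_def by (simp_all add: field_simps)
    ultimately have w1: "w \<in> ball z (e z)" "w \<in> ball z' (e z')" using dw by simp_all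
    have wH: "w \<in> H" unfolding w_def using z t H(1) by (intro convexD) auto
    have "(dist x0 w)\<^sup>2 < \<rho>\<^sup>2"
    proof -
      define a b where "a = z - x0" and "b = z' - x0"
      have ab: "a \<bullet> a = \<rho>\<^sup>2" "b \<bullet> b = \<rho>\<^sup>2"
        using z by (auto simp: a_def b_def dist_norm norm_minus_commute power2_norm_eq_inner[symmetric])
      have "(dist x0 w)\<^sup>2 = ((1 - t) *\<^sub>R a + t *\<^sub>R b) \<bullet> ((1 - t) *\<^sub>R a + t *\<^sub>R b)"
        unfolding power2_norm_eq_inner[symmetric] dist_norm
        by (subst norm_minus_commute) (simp add: w_def a_def b_def algebra_simps)
      also have "\<dots> = (1 - t) * (a \<bullet> a) + t * (b \<bullet> b) - t * (1 - t) * ((a - b) \<bullet> (a - b))"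
        by (simp add: inner_add_left inner_add_right inner_diff_left inner_diff_right inner_commute algebra_simps)
      also have "\<dots> < \<rho>\<^sup>2"
      proof -
        have "0 < (a - b) \<bullet> (a - b)" using False by (simp add: a_def b_def)
        then have "0 < t * (1 - t) * ((a - b) \<bullet> (a - b))" using t by simp
        then show ?thesis unfolding ab by (simp add: algebra_simps)
      qed
      finally show ?thesis .
    qed
    then have "dist x0 w < \<rho>" using \<rho> by (intro power2_less_imp_less[of _ \<rho>]) auto
    then have wB: "w \<in> ?B" using wH by simp
    let ?C = "ball z (e z) \<inter> (ball z' (e z') \<inter> H)"
    show ?thesis
    proof (rule lift_unique[of ?C _ _ w])
      show "lift ?C (\<sigma> z)" by (rule lift_subset[of "ball z (e z) \<inter> H"]) (use * z in auto)
      show "lift ?C (\<sigma> z')" by (rule lift_subset[of "ball z' (e z') \<inter> H"]) (use * z in auto)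
      show "connected ?C" by (intro convex_connected convex_Int convex_ball H)
      show "\<sigma> z w = \<sigma> z' w" using *[OF z(1)] *[OF z(2)] w1 wB by (metis IntI)
    qed (use w1 wH y in auto)
  qed simp
  let ?U = "ball x0 \<rho> \<union> (\<Union>z\<in>sphere x0 \<rho> \<inter> H. ball z (e z))"
  have "cball x0 \<rho> \<inter> H \<subseteq> ?U"
  proof
    fix y assume y: "y \<in> cball x0 \<rho> \<inter> H"
    show "y \<in> ?U"
    proof (cases "dist x0 y < \<rho>")
      case False
      then have "y \<in> sphere x0 \<rho> \<inter> H" using y by auto
      then show ?thesis using * centre_in_ball by blast
    qed simp
  qed
  moreover have "compact (cball x0 \<rho> \<inter> H)" by (intro compact_Int_closed compact_cball H)
  moreover have "open ?U" by auto
  ultimately obtain d where d: "d > 0" "(\<Union>x\<in>cball x0 \<rho> \<inter> H. cball x d) \<subseteq> ?U"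
    using compact_subset_open_imp_cball_epsilon_subset[of "cball x0 \<rho> \<inter> H" ?U] by metis
  have cover: "y \<in> ?U" if y: "y \<in> ball x0 (\<rho> + d) \<inter> H" for y
  proof (cases "dist x0 y < \<rho>")
    case False
    define n where "n = dist x0 y"
    have n: "\<rho> \<le> n" "n < \<rho> + d" "n > 0" using False y \<rho> unfolding n_def by auto
    define x where "x = (1 - \<rho> / n) *\<^sub>R x0 + (\<rho> / n) *\<^sub>R y"
    have xy: "x - x0 = (\<rho> / n) *\<^sub>R (y - x0)" "y - x = (1 - \<rho> / n) *\<^sub>R (y - x0)"
      by (simp_all add: x_def algebra_simps)
    have nn: "norm (y - x0) = n" unfolding n_def by (simp add: dist_norm norm_minus_commute)
    have "dist x x0 = \<rho>" "dist y x = n - \<rho>"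
      unfolding dist_norm xy using nn n \<rho> by (simp_all add: left_diff_distrib)
    then have "dist x0 x \<le> \<rho>" "dist x y \<le> d" using n by (simp_all add: dist_commute)
    moreover have "x \<in> H" unfolding x_def using n \<rho> y x0 H(1) by (intro convexD) auto
    ultimately have "y \<in> (\<Union>x\<in>cball x0 \<rho> \<inter> H. cball x d)" by auto
    then show ?thesis by (rule subsetD[OF d(2)])
  qed simp
  define s' where "s' = (\<lambda>y. if dist x0 y < \<rho> then s y else \<sigma> (SOME z. z \<in> sphere x0 \<rho> \<inter> H \<and> y \<in> ball z (e z)) y)"
  have s'\<sigma>: "s' y = \<sigma> z y" if z: "z \<in> sphere x0 \<rho> \<inter> H" and y: "y \<in> ball z (e z) \<inter> H" for y z
  proof (cases "dist x0 y < \<rho>")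
    case True
    then show ?thesis using *[OF z] y by (simp add: s'_def)
  next
    case False
    have "\<exists>z. z \<in> sphere x0 \<rho> \<inter> H \<and> y \<in> ball z (e z)" using z y by blast
    from someI_ex[OF this] show ?thesis
      using agree[OF _ z _ _] y False unfolding s'_def by auto
  qed
  have "lift (ball x0 (\<rho> + d) \<inter> H) s'"
  proof (rule lift_local)
    fix y assume y: "y \<in> ball x0 (\<rho> + d) \<inter> H"
    then consider "y \<in> ball x0 \<rho>" | z where "z \<in> sphere x0 \<rho> \<inter> H" "y \<in> ball z (e z)"
      using cover by blast
    then show "\<exists>G \<tau>. open G \<and> y \<in> G \<and> lift (G \<inter> H) \<tau> \<and> (\<forall>x\<in>G \<inter> (ball x0 (\<rho> + d) \<inter> H). s' x = \<tau> x)"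
    proof cases
      case 1
      then show ?thesis using s by (intro exI[of _ "ball x0 \<rho>"] exI[of _ s]) (auto simp: s'_def)
    next
      case (2 z)
      then show ?thesis using * s'\<sigma> by (intro exI[of _ "ball z (e z)"] exI[of _ "\<sigma> z"]) auto
    qed
  qed auto
  moreover have "s' x0 = s x0" using \<rho> by (simp add: s'_def)
  moreover have "\<rho> + d > \<rho>" using d by simp
  ultimately show ?thesis by blast
qed

text \<open>Sections over concentric balls with the same value at the centre agree, and by the previous lemma
  their radii have no finite supremum.\<close>

lemma global_lift:
  assumes p: "p \<in> topspace T" shows "\<exists>s. lift H s \<and> s (X p) = p"
proof -
  define x0 where "x0 = X p"
  have x0: "x0 \<in> H" using into p by (auto simp: x0_def)
  define \<R> where "\<R> = {\<rho>. \<rho> > 0 \<and> (\<exists>s. lift (ball x0 \<rho> \<inter> H) s \<and> s x0 = p)}"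
  have "\<exists>s. \<rho> > 0 \<and> lift (ball x0 \<rho> \<inter> H) s \<and> s x0 = p" if "\<rho> \<in> \<R>" for \<rho>
    using that unfolding \<R>_def by blast
  then obtain s where s: "\<And>\<rho>. \<rho> \<in> \<R> \<Longrightarrow> \<rho> > 0 \<and> lift (ball x0 \<rho> \<inter> H) (s \<rho>) \<and> s \<rho> x0 = p" by metis
  have agree: "s \<rho> y = s \<rho>' y" if r: "\<rho> \<in> \<R>" "\<rho>' \<in> \<R>" "\<rho> \<le> \<rho>'" and y: "y \<in> ball x0 \<rho> \<inter> H" for \<rho> \<rho>' y
  proof (rule lift_unique[where s="s \<rho>" and s'="s \<rho>'" and ?y0.0=x0, OF _ _ _ _ _ y])
    show "lift (ball x0 \<rho> \<inter> H) (s \<rho>)" using s r by blast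
    show "lift (ball x0 \<rho> \<inter> H) (s \<rho>')"
      by (rule lift_subset[of "ball x0 \<rho>' \<inter> H"]) (use s r in auto)
    show "connected (ball x0 \<rho> \<inter> H)" by (intro convex_connected convex_Int convex_ball H)
  qed (use s r x0 in auto)
  define S where "S = (\<lambda>y. s (SOME \<rho>. \<rho> \<in> \<R> \<and> y \<in> ball x0 \<rho>) y)"
  have S: "S y = s \<rho> y" if "\<rho> \<in> \<R>" "y \<in> ball x0 \<rho> \<inter> H" for y \<rho>
  proof -
    define \<rho>' where "\<rho>' = (SOME \<rho>. \<rho> \<in> \<R> \<and> y \<in> ball x0 \<rho>)"
    have "\<exists>\<rho>. \<rho> \<in> \<R> \<and> y \<in> ball x0 \<rho>" using that by blast
    then have r': "\<rho>' \<in> \<R> \<and> y \<in> ball x0 \<rho>'" unfolding \<rho>'_def by (rule someI_ex)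
    have "s \<rho>' y = s \<rho> y"
    proof (cases "\<rho>' \<le> \<rho>")
      case True
      show ?thesis by (rule agree[OF _ that(1) True]) (use r' that in auto)
    next
      case False
      then show ?thesis by (intro agree[OF that(1) _ _ that(2), symmetric]) (use r' in auto)
    qed
    then show ?thesis unfolding S_def \<rho>'_def .
  qed
  have lift_S: "lift C S" if C: "C \<subseteq> H" "\<And>y. y \<in> C \<Longrightarrow> \<exists>\<rho>\<in>\<R>. y \<in> ball x0 \<rho>" for C
  proof (rule lift_local[OF _ C(1)])
    fix y assume "y \<in> C"
    then obtain \<rho> where r: "\<rho> \<in> \<R>" "y \<in> ball x0 \<rho>" using C(2) by blast
    then show "\<exists>G \<sigma>. open G \<and> y \<in> G \<and> lift (G \<inter> H) \<sigma> \<and> (\<forall>x\<in>G \<inter> C. S x = \<sigma> x)"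
      using s S C(1) by (intro exI[of _ "ball x0 \<rho>"] exI[of _ "s \<rho>"]) auto
  qed
  have ne: "\<R> \<noteq> {}"
  proof -
    obtain e where "e > 0" "\<forall>q\<in>topspace T. X q \<in> ball x0 e \<longrightarrow> (\<exists>\<sigma>. lift (ball x0 e \<inter> H) \<sigma> \<and> \<sigma> (X q) = q)"
      using local_lifts[OF x0] by blast
    then have "e \<in> \<R>" unfolding \<R>_def using p by (auto simp: x0_def)
    then show ?thesis by blast
  qed
  then obtain r0 where r0: "r0 \<in> \<R>" by blast
  have Sx0: "S x0 = p" using S[OF r0, of x0] s[OF r0] x0 by simp
  have "\<exists>\<rho>\<in>\<R>. y \<in> ball x0 \<rho>" if "y \<in> H" for y
  proof (cases "bdd_above \<R>")
    case False
    then obtain \<rho> where "\<rho> \<in> \<R>" "dist x0 y < \<rho>" unfolding bdd_above_def by (meson not_le)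
    then show ?thesis by auto
  next
    case True
    define m where "m = Sup \<R>"
    have m: "m > 0" using cSup_upper[OF r0 True] s[OF r0] unfolding m_def by simp
    have "lift (ball x0 m \<inter> H) S"
    proof (rule lift_S)
      fix y assume "y \<in> ball x0 m \<inter> H"
      then have "dist x0 y < Sup \<R>" by (simp add: m_def)
      then show "\<exists>\<rho>\<in>\<R>. y \<in> ball x0 \<rho>" using less_cSup_iff[OF ne True] by auto
    qed simp
    then obtain \<rho>' s' where "\<rho>' > m" "lift (ball x0 \<rho>' \<inter> H) s'" "s' x0 = S x0"
      using extend_lift[OF _ m x0] by blast
    then have "\<rho>' \<in> \<R>" "\<rho>' > m" using m Sx0 unfolding \<R>_def by auto
    then show ?thesis using cSup_upper[OF _ True] unfolding m_def by fastforce
  qed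
  then have "lift H S" using lift_S[of H] by blast
  then show ?thesis using Sx0 unfolding x0_def by blast
qed

text \<open>The image of a global section is open and closed, hence everything.\<close>

theorem homeomorphism_onto:
  assumes ne: "topspace T \<noteq> {}"
  shows "inj_on X (topspace T)" "X ` topspace T = H"
proof -
  obtain p where p: "p \<in> topspace T" using ne by blast
  obtain s where s: "lift H s" "s (X p) = p" using global_lift[OF p] by blast
  let ?E1 = "{q \<in> topspace T. s (X q) = q}" and ?E2 = "{q \<in> topspace T. s (X q) \<noteq> q}"
  have XH: "X q \<in> H" if "q \<in> topspace T" for q using that into by blast
  have "continuous_map T (top_of_set H) X" using cont into by (simp add: continuous_map_in_subtopology image_subset_iff)
  then have sX: "continuous_map T T (s \<circ> X)"
    using s(1) unfolding lift_def by (blast intro: continuous_map_compose)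
  have pre: "openin T {q \<in> topspace T. s (X q) \<in> Q}" if "openin T Q" for Q
    using openin_continuous_map_preimage[OF sX that] by simp
  have "openin T ?E1"
  proof (subst openin_subopen, rule ballI)
    fix q assume q: "q \<in> ?E1"
    obtain Q where Q: "openin T Q" "q \<in> Q" "inj_on X Q" using local_homeo[of q] q by blast
    have "{q \<in> topspace T. s (X q) \<in> Q} \<inter> Q \<subseteq> ?E1"
    proof
      fix x assume x: "x \<in> {q \<in> topspace T. s (X q) \<in> Q} \<inter> Q"
      then have "X (s (X x)) = X x" using liftD(2)[OF s(1) XH] by blast
      then show "x \<in> ?E1" using inj_onD[OF Q(3)] x by blast
    qed
    then show "\<exists>W. openin T W \<and> q \<in> W \<and> W \<subseteq> ?E1"
      using q Q(1,2) by (intro exI[of _ "{q \<in> topspace T. s (X q) \<in> Q} \<inter> Q"]) (auto intro!: openin_Int pre)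
  qed
  moreover have "openin T ?E2"
  proof (subst openin_subopen, rule ballI)
    fix q assume q: "q \<in> ?E2"
    then have "s (X q) \<in> topspace T" using liftD(1)[OF s(1) XH] by blast
    then obtain Q Q' where Q: "openin T Q" "openin T Q'" "s (X q) \<in> Q" "q \<in> Q'" "disjnt Q Q'"
      using Hausdorff q unfolding Hausdorff_space_def by (metis (mono_tags, lifting) mem_Collect_eq)
    then show "\<exists>W. openin T W \<and> q \<in> W \<and> W \<subseteq> ?E2"
      using q by (intro exI[of _ "{q \<in> topspace T. s (X q) \<in> Q} \<inter> Q'"])
        (auto intro!: openin_Int pre simp: disjnt_iff)
  qed
  moreover have "?E1 \<noteq> {}" using p s(2) by auto
  ultimately have "?E2 = {}" using connected_T unfolding connected_space_def by blast
  then have inv: "s (X q) = q" if "q \<in> topspace T" for q using that by blast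
  then show "inj_on X (topspace T)" by (rule inj_on_inverseI)
  show "X ` topspace T = H"
  proof
    show "H \<subseteq> X ` topspace T" using liftD[OF s(1)] by (metis image_eqI subsetI)
  qed (rule into)
qed

end

section \<open>From vanishing curvature to hyperplanes\<close>

context immersed_hypersurface
begin

lemma framed_hypersurface_of_mean_curvature:
  assumes "\<And>p. p \<in> topspace T \<Longrightarrow> \<exists>h. has_mean_curvature A X N p h"
  shows "framed_hypersurface T A X N"
proof
  fix p assume "p \<in> topspace T"
  then obtain h where "has_mean_curvature A X N p h" using assms by blast
  then obtain c W v where "c \<in> A" "p \<in> fst c" "open W" "snd c p \<in> W" "W \<subseteq> img c"
    "orthonormal_frame (in_chart c X) W v"
    unfolding has_mean_curvature_def Let_def by force
  then show "\<exists>c W v. framed c W v \<and> p \<in> fst c \<and> snd c p \<in> W" unfolding framed_def by blast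
qed

end

context framed_hypersurface
begin

text \<open>Differentiating \<open>\<langle>e\<^sub>i, N\<rangle> = 0\<close> in the direction \<open>e\<^sub>i\<close>.\<close>

lemma has_mean_curvature_tr_shape:
  assumes h: "has_mean_curvature A X N p h"
  shows "h = - tr_shape p"
proof -
  obtain c W v where W: "c \<in> A" "p \<in> fst c" "open W" "snd c p \<in> W" "W \<subseteq> img c"
    "orthonormal_frame (in_chart c X) W v"
    and h: "h = (\<Sum>i\<in>UNIV. frechet_derivative (push_field (in_chart c X) (v i)) (at (snd c p)) (v i (snd c p)) \<bullet> N p)"
    using h unfolding has_mean_curvature_def Let_def by force
  have fr: "framed c W v" using W unfolding framed_def by blast
  define x where "x = snd c p"
  have x: "x \<in> W" "x \<in> img c" using W by (auto simp: x_def)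
  have "frechet_derivative (push_field (in_chart c X) (v i)) (at x) (v i x) \<bullet> N p
      = - (differential c N p (v i x) \<bullet> differential c X p (v i x))" for i
  proof -
    let ?e = "push_field (in_chart c X) (v i)"
    have e: "C1_on W ?e" using C1_push_field[OF fr] by (simp add: push_field_def[abs_def])
    have 1: "((\<lambda>y. ?e y \<bullet> in_chart c N y) has_derivative
       (\<lambda>k. ?e x \<bullet> frechet_derivative (in_chart c N) (at x) k + frechet_derivative ?e (at x) k \<bullet> in_chart c N x)) (at x)"
      by (intro has_derivative_inner C1_onD(1)[OF e x(1)] C1_onD(1)[OF C1MD[OF C1M_N W(1)] x(2)])
    have "((\<lambda>y. ?e y \<bullet> in_chart c N y) has_derivative (\<lambda>k. 0)) (at x)"
    proof (rule has_derivative_transform_within_open[OF has_derivative_const W(3) x(1)])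
      fix y assume "y \<in> W"
      then have y: "y \<in> img c" by (rule subsetD[OF W(5)])
      show "0 = ?e y \<bullet> in_chart c N y"
        using differential_normal[OF W(1) par_in[OF y], of "v i y"] y
        by (simp add: push_field_def differential_def in_chart_apply)
    qed
    from has_derivative_unique[OF 1 this]
    have "?e x \<bullet> frechet_derivative (in_chart c N) (at x) (v i x) + frechet_derivative ?e (at x) (v i x) \<bullet> in_chart c N x = 0"
      by (rule fun_cong)
    then show ?thesis
      using W(1,2) by (simp add: push_field_def differential_def in_chart_apply x_def inner_commute)
  qed
  then show ?thesis
    unfolding h tr_shape_frame[OF fr W(2,4)] x_def by (simp add: sum_negf)
qed

text \<open>Level sets are open by the mean value inequality in charts.\<close>

lemma constant_of_tder_0:
  fixes f :: "'p \<Rightarrow> 'b::real_normed_vector"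
  assumes f: "\<And>p. p \<in> topspace T \<Longrightarrow> tder f (\<lambda>x. 0) p"
    and p: "p \<in> topspace T" "q \<in> topspace T"
  shows "f p = f q"
proof (rule ccontr)
  assume ne: "f p \<noteq> f q"
  have nbhd: "\<exists>Q. openin T Q \<and> x \<in> Q \<and> (\<forall>y\<in>Q. f y = f x)" if x: "x \<in> topspace T" for x
  proof -
    obtain c where c: "c \<in> A" "x \<in> fst c" using chart_cover[OF x] by blast
    then have "snd c x \<in> img c" by blast
    then obtain r where r: "r > 0" "ball (snd c x) r \<subseteq> img c"
      using chart(2)[OF c(1)] by (meson open_contains_ball)
    have d: "(in_chart c f has_derivative (\<lambda>h. 0)) (at y within ball (snd c x) r)"
      if y: "y \<in> ball (snd c x) r" for y
    proof -
      have y': "y \<in> img c" using r y by blast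
      have "(in_chart c f has_derivative (\<lambda>u. 0)) (at (snd c (par c y)))"
        by (rule tderD(4)[OF f[OF par_topspace[OF c(1) y']] c(1) par_in[OF y']])
      then show ?thesis using y' by (simp add: has_derivative_at_withinI)
    qed
    obtain a where a: "\<And>y. y \<in> ball (snd c x) r \<Longrightarrow> in_chart c f y = a"
      using has_derivative_zero_constant[OF convex_ball d] by blast
    have "f y = f x" if y: "y \<in> par c ` ball (snd c x) r" for y
    proof -
      obtain z where "z \<in> ball (snd c x) r" "y = par c z" using y by blast
      then have "f y = a" using a[of z] by (simp add: in_chart_apply)
      moreover have "f x = a" using a[of "snd c x"] r(1) c by (simp add: in_chart_apply)
      ultimately show ?thesis by simp
    qed
    moreover have "x \<in> par c ` ball (snd c x) r"
      using r(1) c by (intro image_eqI[of _ _ "snd c x"]) auto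
    moreover have "openin T (par c ` ball (snd c x) r)"
      by (rule open_par_image[OF c(1) open_ball r(2)])
    ultimately show ?thesis by blast
  qed
  let ?E1 = "{x \<in> topspace T. f x = f p}" and ?E2 = "{x \<in> topspace T. f x \<noteq> f p}"
  have "openin T ?E1" "openin T ?E2"
  proof -
    show "openin T ?E1"
    proof (subst openin_subopen, rule ballI)
      fix x assume x: "x \<in> ?E1"
      then obtain Q where Q: "openin T Q" "x \<in> Q" "\<forall>y\<in>Q. f y = f x" using nbhd[of x] by blast
      have "Q \<subseteq> ?E1"
      proof
        fix y assume "y \<in> Q"
        then have "y \<in> topspace T" "f y = f x" using openin_subset[OF Q(1)] Q(3) by blast+
        then show "y \<in> ?E1" using x by simp
      qed
      then show "\<exists>Q. openin T Q \<and> x \<in> Q \<and> Q \<subseteq> ?E1" using Q(1,2) by blast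
    qed
    show "openin T ?E2"
    proof (subst openin_subopen, rule ballI)
      fix x assume x: "x \<in> ?E2"
      then obtain Q where Q: "openin T Q" "x \<in> Q" "\<forall>y\<in>Q. f y = f x" using nbhd[of x] by blast
      have "Q \<subseteq> ?E2"
      proof
        fix y assume "y \<in> Q"
        then have "y \<in> topspace T" "f y = f x" using openin_subset[OF Q(1)] Q(3) by blast+
        then show "y \<in> ?E2" using x by simp
      qed
      then show "\<exists>Q. openin T Q \<and> x \<in> Q \<and> Q \<subseteq> ?E2" using Q(1,2) by blast
    qed
  qed
  moreover have "p \<in> ?E1" "q \<in> ?E2" using p ne by auto
  moreover have "topspace T \<subseteq> ?E1 \<union> ?E2" "?E1 \<inter> ?E2 = {}" by auto
  ultimately show False using connected unfolding connected_space_def by blast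
qed

text \<open>If the Weingarten map vanishes, the immersion is an open map, locally injective, into a
  fixed hyperplane.\<close>

lemma hyperplane_of_shape_0:
  assumes shape: "\<And>p v. p \<in> topspace T \<Longrightarrow> shape p v = 0" and proper: "proper_map T euclidean X"
  shows "is_hyperplane T X"
proof -
  obtain p0 where p0: "p0 \<in> topspace T" using nonempty by blast
  define \<nu> where "\<nu> = N p0"
  define b where "b = \<nu> \<bullet> X p0"
  have \<nu>: "\<nu> \<noteq> 0" using unit_N[OF p0] unfolding \<nu>_def by auto
  have "tder N (\<lambda>x. 0) p" if p: "p \<in> topspace T" for p
  proof -
    have "shape p = (\<lambda>x. 0)" using shape[OF p] by (simp add: fun_eq_iff)
    then show ?thesis using tder_N[OF p] by simp
  qed
  from constant_of_tder_0[OF this _ p0] have N: "N p = \<nu>" if "p \<in> topspace T" for p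
    using that by (simp add: \<nu>_def)
  have "tder (\<lambda>q. X q \<bullet> N q) (\<lambda>x. 0) p" if p: "p \<in> topspace T" for p
    using tder_inner[OF tder_X[OF p] tder_N[OF p]] shape[OF p] N_unit[OF p] by (simp add: inner_diff_left)
  note dXN = this
  have X: "\<nu> \<bullet> X p = b" if p: "p \<in> topspace T" for p
  proof -
    have "X p \<bullet> N p = X p0 \<bullet> N p0"
      by (rule constant_of_tder_0[where f="\<lambda>q. X q \<bullet> N q", OF dXN p p0])
    then have "X p \<bullet> \<nu> = X p0 \<bullet> \<nu>" unfolding N[OF p] N[OF p0] .
    then show ?thesis unfolding b_def by (simp only: inner_commute[of \<nu>])
  qed
  define H where "H = {x. \<nu> \<bullet> x = b}"
  have aff: "affine H" unfolding H_def by (rule affine_hyperplane)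
  have dim: "aff_dim H \<le> aff_dim (UNIV :: (real^'n) set)"
    unfolding H_def using \<nu> codim_one by (simp add: aff_dim_hyperplane)
  interpret proper_local_homeomorphism T X H
  proof
    show "Hausdorff_space T" by (rule Hausdorff)
    show "connected_space T" by (rule connected)
    show "proper_map T euclidean X" by (rule proper)
    show "continuous_map T euclidean X" by (rule C1M_continuous[OF C1M_X])
    show "X ` topspace T \<subseteq> H" using X unfolding H_def by blast
    show "convex H" "closed H" unfolding H_def by (rule convex_hyperplane closed_hyperplane)+
    fix q assume q: "q \<in> topspace T"
    obtain c where c: "c \<in> A" "q \<in> fst c" using chart_cover[OF q] by blast
    let ?F = "in_chart c X" and ?D = "\<lambda>y. frechet_derivative (in_chart c X) (at y)"
    define x where "x = snd c q"
    have x: "x \<in> img c" unfolding x_def using c by blast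
    have "linear (?D x)" by (rule linear_dX[OF c(1) x])
    moreover have "inj (?D x)" using differential_injective[OF c] by (simp add: differential_def x_def)
    ultimately obtain g' where g': "linear g'" "g' \<circ> ?D x = id"
      using linear_injective_left_inverse by blast
    have der: "(?F has_derivative ?D y) (at y)" if "y \<in> img c" for y
      by (rule C1_onD(1)[OF C1MD[OF C1M_X c(1)] that])
    have close: "\<exists>d>0. \<forall>y. dist x y < d \<longrightarrow> onorm (\<lambda>v. ?D y v - ?D x v) < e" if e: "e > 0" for e
    proof -
      have "continuous_on (img c) (\<lambda>y. \<Sum>b\<in>Basis. norm (?D y b - ?D x b))"
        by (intro continuous_intros C1_onD(2)[OF C1MD[OF C1M_X c(1)]])
      then have "isCont (\<lambda>y. \<Sum>b\<in>Basis. norm (?D y b - ?D x b)) x"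
        unfolding continuous_on_eq_continuous_at[OF chart(2)[OF c(1)]] by (rule bspec[OF _ x])
      then obtain d1 where d1: "d1 > 0" "\<And>y. dist y x < d1 \<Longrightarrow> \<bar>\<Sum>b\<in>Basis. norm (?D y b - ?D x b)\<bar> < e"
        using e unfolding continuous_at_eps_delta by (auto simp: dist_real_def)
      obtain d2 where d2: "d2 > 0" "ball x d2 \<subseteq> img c"
        using x chart(2)[OF c(1)] by (meson open_contains_ball)
      show ?thesis
      proof (intro exI[of _ "min d1 d2"] conjI allI impI)
        fix y assume y: "dist x y < min d1 d2"
        then have "y \<in> img c" using d2(2) by auto
        then have "bounded_linear (\<lambda>v. ?D y v - ?D x v)"
          by (intro bounded_linear_sub has_derivative_bounded_linear[OF der] x)
        then have "onorm (\<lambda>v. ?D y v - ?D x v) \<le> (\<Sum>b\<in>Basis. norm (?D y b - ?D x b))"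
          by (rule onorm_componentwise)
        also have "\<dots> < e" using d1(2)[of y] y by (simp add: dist_commute)
        finally show "onorm (\<lambda>v. ?D y v - ?D x v) < e" .
      qed (use d1 d2 in auto)
    qed
    obtain r where r: "r > 0" "ball x r \<subseteq> img c" "inj_on ?F (ball x r)"
      using has_derivative_locally_injective[OF x chart(2)[OF c(1)]
          linear_conv_bounded_linear[THEN iffD1, OF g'(1)] g'(2) der close] by blast
    let ?Q = "par c ` ball x r"
    show "\<exists>Q. openin T Q \<and> q \<in> Q \<and> inj_on X Q \<and>
       (\<forall>Q'. openin T Q' \<and> Q' \<subseteq> Q \<longrightarrow> openin (top_of_set H) (X ` Q'))"
    proof (intro exI[of _ ?Q] conjI allI impI)
      show "openin T ?Q" by (rule open_par_image[OF c(1) open_ball r(2)])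
      show "q \<in> ?Q" using r(1) c by (intro image_eqI[of _ _ x]) (auto simp: x_def)
      show "inj_on X ?Q" using r(3) by (auto simp: inj_on_def in_chart_apply)
      fix Q' assume Q': "openin T Q' \<and> Q' \<subseteq> ?Q"
      have Qc: "Q' \<subseteq> fst c"
      proof
        fix z assume "z \<in> Q'"
        then obtain y where "y \<in> ball x r" "z = par c y" using Q' by blast
        then show "z \<in> fst c" using par_in[of y c] r(2) by auto
      qed
      let ?G = "snd c ` Q'"
      have G: "open ?G" using open_chart_image[OF c(1), of Q'] Q' Qc by (simp add: Int_absorb2)
      have Gb: "?G \<subseteq> ball x r"
      proof
        fix y assume "y \<in> ?G"
        then obtain z where z: "z \<in> Q'" "y = snd c z" by blast
        then obtain y' where y': "y' \<in> ball x r" "z = par c y'" using Q' by blast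
        then have "y' \<in> img c" using r(2) by blast
        then show "y \<in> ball x r" using y' z by simp
      qed
      have XG: "X ` Q' = ?F ` ?G"
        unfolding image_image using par_chart[OF c(1)] Qc by (intro image_cong) (auto simp: in_chart_apply)
      have "openin (top_of_set H) (?F ` ?G)"
      proof (rule invariance_of_domain_affine_sets[of UNIV])
        show "continuous_on ?G ?F"
          by (rule continuous_on_subset[OF C1_on_continuous[OF C1MD[OF C1M_X c(1)]]]) (use Gb r(2) in blast)
        show "?F \<in> ?G \<rightarrow> H"
          using X Q' openin_subset[of T Q'] par_chart[OF c(1)] Qc
          by (auto simp: in_chart_apply H_def subset_iff)
        show "inj_on ?F ?G" by (rule inj_on_subset[OF r(3) Gb])
      qed (use G aff dim in auto)
      then show "openin (top_of_set H) (X ` Q')" unfolding XG .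
    qed
  qed
  show ?thesis
    unfolding is_hyperplane_def
    using homeomorphism_onto[OF nonempty] \<nu> unfolding H_def by blast
qed

end

theorem theorem3:
  fixes T :: "'p topology"
    and A :: "('p, 'n::finite) chart set"
    and X N :: "'p \<Rightarrow> real ^ 'm::finite"
    and l :: real
    and i j :: 'm
  assumes "immersed_hypersurface T A X N"
    and "complete_hypersurface T A X"
    and "proper_map T euclidean X"
    and "constant_weighted_mean_curvature T A X N l"
    and "i \<noteq> j"
    and "N ` topspace T \<subseteq> slit_sphere i j"
  shows "is_hyperplane T X"
proof -
  interpret immersed_hypersurface T A X N by fact
  have H: "\<exists>h. has_mean_curvature A X N p h \<and> h + (1/2) * (X p \<bullet> N p) = l" if "p \<in> topspace T" for p
    using assms(4) that unfolding constant_weighted_mean_curvature_def by blast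
  interpret framed_hypersurface T A X N
    by (rule framed_hypersurface_of_mean_curvature) (use H in blast)
  interpret lambda_hypersurface T A X N l
  proof
    fix p assume "p \<in> topspace T"
    then obtain h where h: "has_mean_curvature A X N p h" "h + (1/2) * (X p \<bullet> N p) = l" using H by blast
    then show "tr_shape p = (X p \<bullet> N p) / 2 - l" using has_mean_curvature_tr_shape[OF h(1)] by simp
  qed fact
  have slit: "N p \<in> slit_domain i j" if "p \<in> topspace T" for p
    using assms(6) that unfolding slit_domain_iff slit_sphere_def by blast
  have "shape p v = 0" if "p \<in> topspace T" for p v
    by (rule shape_eq_0[OF slit assms(5) that])
  then show ?thesis using assms(3) by (intro hyperplane_of_shape_0) auto
qed

end
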